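(* For any $1\le s\le n$, there exists an algorithm for wildcard pattern matching in the non-streaming setting that runs in time $\tilde O(n^2/s)$ and uses space $O(s)$, where $n$ is the length of the text.
   Context: Wildcard pattern matching: given a text $T$ of length $n$ over an alphabet $\Sigma$ and a pattern $P$ (of length at most $n$) over $\Sigma\cup\{?\}$, decide whether there is a position at which $P$ matches a contiguous substring of $T$ of length $|P|$ (and report such a position if one exists), where '?' in $P$ matches any character of $T$ and every other character of $P$ must equal the corresponding character of $T$. In the non-streaming (random access) setting, both $T$ and $P$ are fixed and every character of each can be accessed by its index; space counts the working memory beyond this read-only access. $\tilde O$ hides polylogarithmic factors. *)

theory Defs
  imports Complex_Main
begin

definition matches_at :: "nat list \<Rightarrow> nat option list \<Rightarrow> nat \<Rightarrow> bool" where
  "matches_at T P i \<longleftrightarrow> i + length P \<le> length T \<and>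
     (\<forall>j < length P. P ! j = None \<or> P ! j = Some (T ! (i + j)))"

text \<open>Output convention: 0 = no occurrence, i+1 = occurrence at position i.\<close>
definition wpm_correct_output :: "nat list \<Rightarrow> nat option list \<Rightarrow> nat \<Rightarrow> bool" where
  "wpm_correct_output T P out \<longleftrightarrow>
     (if \<exists>i. matches_at T P i then out > 0 \<and> matches_at T P (out - 1) else out = 0)"

datatype aop = OAdd | OSub | OMul | ODiv | OMod

fun aop_sem :: "aop \<Rightarrow> nat \<Rightarrow> nat \<Rightarrow> nat" where
  "aop_sem OAdd x y = x + y"
| "aop_sem OSub x y = x - y"
| "aop_sem OMul x y = x * y"
| "aop_sem ODiv x y = x div y"
| "aop_sem OMod x y = x mod y"

text \<open>Registers (working memory) are indexed by naturals. The input (text,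
  pattern, parameter s) is read-only and accessed by index.\<close>
datatype instr =
    Const nat nat
  | Arith aop nat nat nat
  | LoadI nat nat
  | StoreI nat nat
  | ReadT nat nat
  | ReadP nat nat
  | LenT nat
  | LenP nat
  | ParS nat
  | Jz nat nat

type_synonym conf = "nat \<times> (nat \<Rightarrow> nat)"

type_synonym wpm_input = "nat list \<times> nat option list \<times> nat"

definition in_text :: "wpm_input \<Rightarrow> nat list" where "in_text I = fst I"
definition in_pat :: "wpm_input \<Rightarrow> nat option list" where "in_pat I = fst (snd I)"
definition in_par :: "wpm_input \<Rightarrow> nat" where "in_par I = snd (snd I)"

fun instr_step :: "wpm_input \<Rightarrow> instr \<Rightarrow> conf \<Rightarrow> conf" where
  "instr_step I (Const a v) (pc, R) = (Suc pc, R(a := v))"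
| "instr_step I (Arith f a b c) (pc, R) = (Suc pc, R(a := aop_sem f (R b) (R c)))"
| "instr_step I (LoadI a b) (pc, R) = (Suc pc, R(a := R (R b)))"
| "instr_step I (StoreI a b) (pc, R) = (Suc pc, R(R a := R b))"
| "instr_step I (ReadT a b) (pc, R) =
     (Suc pc, R(a := (if R b < length (in_text I) then in_text I ! R b else 0)))"
| "instr_step I (ReadP a b) (pc, R) =
     (Suc pc, R(a := (if R b < length (in_pat I)
                      then (case in_pat I ! R b of None \<Rightarrow> 0 | Some c \<Rightarrow> c + 1) else 0)))"
| "instr_step I (LenT a) (pc, R) = (Suc pc, R(a := length (in_text I)))"
| "instr_step I (LenP a) (pc, R) = (Suc pc, R(a := length (in_pat I)))"
| "instr_step I (ParS a) (pc, R) = (Suc pc, R(a := in_par I))"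
| "instr_step I (Jz a t) (pc, R) = (if R a = 0 then t else Suc pc, R)"

fun instr_regs :: "instr \<Rightarrow> (nat \<Rightarrow> nat) \<Rightarrow> nat set" where
  "instr_regs (Const a v) R = {a}"
| "instr_regs (Arith f a b c) R = {a, b, c}"
| "instr_regs (LoadI a b) R = {a, b, R b}"
| "instr_regs (StoreI a b) R = {a, b, R a}"
| "instr_regs (ReadT a b) R = {a, b}"
| "instr_regs (ReadP a b) R = {a, b}"
| "instr_regs (LenT a) R = {a}"
| "instr_regs (LenP a) R = {a}"
| "instr_regs (ParS a) R = {a}"
| "instr_regs (Jz a t) R = {a}"

definition halted :: "instr list \<Rightarrow> conf \<Rightarrow> bool" where
  "halted prog c \<longleftrightarrow> fst c \<ge> length prog"

definition step :: "instr list \<Rightarrow> wpm_input \<Rightarrow> conf \<Rightarrow> conf" where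
  "step prog I c = (if halted prog c then c else instr_step I (prog ! fst c) c)"

definition init_conf :: conf where
  "init_conf = (0, \<lambda>_. 0)"

definition conf_at :: "instr list \<Rightarrow> wpm_input \<Rightarrow> nat \<Rightarrow> conf" where
  "conf_at prog I k = (step prog I ^^ k) init_conf"

text \<open>Run of prog on wpm_input I halts after exactly t steps (t = running time),
  touching only registers with index < S (space S words), with all register
  contents bounded by B (word size log B bits), and outputs r_0.\<close>
definition runs_within ::
  "instr list \<Rightarrow> wpm_input \<Rightarrow> nat \<Rightarrow> nat \<Rightarrow> nat \<Rightarrow> nat \<Rightarrow> bool" where
  "runs_within prog I t S B out \<longleftrightarrow>
     halted prog (conf_at prog I t) \<and>
     (\<forall>k < t. \<not> halted prog (conf_at prog I k)) \<and>
     (\<forall>k < t. instr_regs (prog ! fst (conf_at prog I k)) (snd (conf_at prog I k)) \<subseteq> {..<S}) \<and>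
     (\<forall>k \<le> t. \<forall>r. snd (conf_at prog I k) r < B) \<and>
     out = snd (conf_at prog I t) 0"

end

theory Submission
  imports Defs
begin

text \<open>Write the pattern as v (with v = 0 for a wildcard and c + 1 for the symbol c) and the text as
  t (again shifted by one). An alignment i is an occurrence iff the sum over j of
  [v j > 0] (v j - t (i + j))^2 vanishes; expanding the square leaves one constant and two
  cross-correlations. Choose a power of two L with L <= s < 2 L, cut the alignments and the pattern
  into blocks of length L, and compute for each of the O((n / L)^2) pairs of blocks the L correlation
  values by transforms of length 4 L, accumulating over the pattern blocks: O(L) words and
  O(L log L) steps per pair.

  The transform is a complex FFT in fixed-point arithmetic. Precision 1 / poly(n) fits into a
  constant number of words, and with log N stages even an error bound that triples at each stage
  grows only polynomially, so the integer correlation values are recovered by rounding. The root of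
  unity is obtained from cos (pi / 2) = 0 by halving the angle with integer square roots.

  The program is written in a small structured language with arrays and bounded loops whose compiler
  to the machine is verified once, including running time, number of registers and register
  contents.\<close>

subsection \<open>A structured language and its compiler\<close>

text \<open>Register contents must stay below a power of n + 1 whose exponent depends on the
  alphabet exponent d alone, and this shapes every constant. Precision is lost mainly at two places.
  Recovering the sine from the cosine near angle 0 turns an error into its square root, so the scale
  is taken essentially as the square of the required accuracy. The tripling over K stages costs 3^K
  <= (2^K)^2, the square of the transform length. Both losses are powers of \<open>G\<close>, the
  power of two with n < G <= 2 n in which all precisions are measured; taking a power of two also
  lets the integer square root work by halving. The length 4 L has two reasons: indices b + u with
  b, u < L stay below 2 L, so the cyclic correlation does not wrap around, and K >= 2 holds even for
  L = 1, so that the angle recursion can start at pi / 2. Registers hold naturals with truncated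
  subtraction; the offset Z must therefore exceed every scaled magnitude that occurs. Two bounds are
  kept apart throughout: R for what a program stores, and a fixed power of R for intermediate
  results and addresses.\<close>

type_synonym store = "(nat \<Rightarrow> nat) \<times> (nat \<Rightarrow> nat \<Rightarrow> nat)"

datatype exp = Num nat | Var nat | Bin aop exp exp | Arr nat exp | Txt exp | Pat exp
  | TLen | PLen | Par

datatype com = Skip | Asg nat exp | Sto nat exp exp | Seq com com | If exp com com
  | For nat nat exp com

definition txt_at :: "wpm_input \<Rightarrow> nat \<Rightarrow> nat" where
  "txt_at I i = (if i < length (in_text I) then in_text I ! i else 0)"

definition pat_at :: "wpm_input \<Rightarrow> nat \<Rightarrow> nat" where
  "pat_at I i = (if i < length (in_pat I)
     then (case in_pat I ! i of None \<Rightarrow> 0 | Some c \<Rightarrow> c + 1) else 0)"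

definition setv :: "nat \<Rightarrow> nat \<Rightarrow> store \<Rightarrow> store" where
  "setv x v st = ((fst st)(x := v), snd st)"

definition seta :: "nat \<Rightarrow> nat \<Rightarrow> nat \<Rightarrow> store \<Rightarrow> store" where
  "seta f i v st = (fst st, (snd st)(f := (snd st f)(i := v)))"

lemma fst_setv [simp]: "fst (setv x v st) y = (if y = x then v else fst st y)"
  by (simp add: setv_def)

lemma snd_setv [simp]: "snd (setv x v st) = snd st"
  by (simp add: setv_def)

lemma fst_seta [simp]: "fst (seta f i v st) = fst st"
  by (simp add: seta_def)

lemma snd_seta [simp]:
  "snd (seta f i v st) g = (if g = f then (snd st f)(i := v) else snd st g)"
  by (simp add: seta_def)

primrec val :: "wpm_input \<Rightarrow> exp \<Rightarrow> store \<Rightarrow> nat" where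
  "val I (Num c) st = c"
| "val I (Var x) st = fst st x"
| "val I (Bin f a b) st = aop_sem f (val I a st) (val I b st)"
| "val I (Arr f a) st = snd st f (val I a st)"
| "val I (Txt a) st = txt_at I (val I a st)"
| "val I (Pat a) st = pat_at I (val I a st)"
| "val I TLen st = length (in_text I)"
| "val I PLen st = length (in_pat I)"
| "val I Par st = in_par I"

text \<open>Register layout: variables occupy registers below 40, temporaries 40 to 59, and entry i
  of the array f < 10 lives in register 60 + 10 i + f.\<close>

primrec comp_exp :: "nat \<Rightarrow> exp \<Rightarrow> instr list" where
  "comp_exp k (Num c) = [Const k c]"
| "comp_exp k (Var x) = [Const k 0, Arith OAdd k x k]"
| "comp_exp k (Bin f a b) = comp_exp k a @ comp_exp (Suc k) b @ [Arith f k k (Suc k)]"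
| "comp_exp k (Arr f a) = comp_exp k a @ [Const (Suc k) 10, Arith OMul k k (Suc k),
     Const (Suc k) (60 + f), Arith OAdd k k (Suc k), LoadI k k]"
| "comp_exp k (Txt a) = comp_exp k a @ [ReadT k k]"
| "comp_exp k (Pat a) = comp_exp k a @ [ReadP k k]"
| "comp_exp k TLen = [LenT k]"
| "comp_exp k PLen = [LenP k]"
| "comp_exp k Par = [ParS k]"

primrec elen :: "exp \<Rightarrow> nat" where
  "elen (Num c) = 1"
| "elen (Var x) = 2"
| "elen (Bin f a b) = elen a + elen b + 1"
| "elen (Arr f a) = elen a + 5"
| "elen (Txt a) = elen a + 1"
| "elen (Pat a) = elen a + 1"
| "elen TLen = 1"
| "elen PLen = 1"
| "elen Par = 1"

lemma length_comp_exp [simp]: "length (comp_exp k e) = elen e"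
  by (induction e arbitrary: k) auto

text \<open>The number of consecutive temporaries needed from register k on. The right operand is
  evaluated one register higher, because the left value waits in k; an array access needs a second
  register for the constants of its address.\<close>

primrec edepth :: "exp \<Rightarrow> nat" where
  "edepth (Num c) = 1"
| "edepth (Var x) = 1"
| "edepth (Bin f a b) = max (edepth a) (Suc (edepth b))"
| "edepth (Arr f a) = max (edepth a) 2"
| "edepth (Txt a) = edepth a"
| "edepth (Pat a) = edepth a"
| "edepth TLen = 1"
| "edepth PLen = 1"
| "edepth Par = 1"

primrec wf_exp :: "exp \<Rightarrow> bool" where
  "wf_exp (Num c) = True"
| "wf_exp (Var x) = (x < 40)"
| "wf_exp (Bin f a b) = (wf_exp a \<and> wf_exp b)"
| "wf_exp (Arr f a) = (f < 10 \<and> wf_exp a)"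
| "wf_exp (Txt a) = wf_exp a"
| "wf_exp (Pat a) = wf_exp a"
| "wf_exp TLen = True"
| "wf_exp PLen = True"
| "wf_exp Par = True"

text \<open>If all variables and array entries are below R, then all values that occur in
  the evaluation of e, addresses included, are below R raised to the power esize e.\<close>

primrec esize :: "exp \<Rightarrow> nat" where
  "esize (Num c) = c + 1"
| "esize (Var x) = 1"
| "esize (Bin f a b) = esize a + esize b"
| "esize (Arr f a) = esize a + 11 + (61 + f)"
| "esize (Txt a) = esize a"
| "esize (Pat a) = esize a"
| "esize TLen = 1"
| "esize PLen = 1"
| "esize Par = 1"

lemma esize_pos [simp]: "0 < esize e"
  by (induction e) auto

text \<open>Only array reads touch a register that depends on a computed value, so bounding their
  indices by M is what limits the space. Reads beyond the text or the pattern yield 0 on the machine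
  as well and need no condition.\<close>

primrec idx_ok :: "wpm_input \<Rightarrow> nat \<Rightarrow> exp \<Rightarrow> store \<Rightarrow> bool" where
  "idx_ok I M (Num c) st = True"
| "idx_ok I M (Var x) st = True"
| "idx_ok I M (Bin f a b) st = (idx_ok I M a st \<and> idx_ok I M b st)"
| "idx_ok I M (Arr f a) st = (idx_ok I M a st \<and> val I a st < M)"
| "idx_ok I M (Txt a) st = idx_ok I M a st"
| "idx_ok I M (Pat a) st = idx_ok I M a st"
| "idx_ok I M TLen st = True"
| "idx_ok I M PLen st = True"
| "idx_ok I M Par st = True"

text \<open>The machine has neither a move nor an unconditional jump: a move adds the constant 0, a
  jump tests a register just set to 0. Jump targets are absolute, hence the start address p as an
  argument. A loop saves its bound in y and leaves when the truncated difference y - x is 0.\<close>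

primrec comp_com :: "nat \<Rightarrow> com \<Rightarrow> instr list" where
  "comp_com p Skip = []"
| "comp_com p (Asg x e) = comp_exp 40 e @ [Const 41 0, Arith OAdd x 40 41]"
| "comp_com p (Sto f a e) = comp_exp 40 a @ [Const 41 10, Arith OMul 40 40 41,
     Const 41 (60 + f), Arith OAdd 40 40 41] @ comp_exp 41 e @ [StoreI 40 41]"
| "comp_com p (Seq a b) = comp_com p a @ comp_com (p + length (comp_com p a)) b"
| "comp_com p (If e a b) =
     (let ca = comp_com (p + elen e + 1) a;
          q = p + elen e + 1 + length ca + 2;
          cb = comp_com q b
      in comp_exp 40 e @ [Jz 40 q] @ ca @ [Const 40 0, Jz 40 (q + length cb)] @ cb)"
| "comp_com p (For x y e c) =
     (let ph = p + elen e + 3;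
          body = comp_com (ph + 2) c
      in comp_exp 40 e @ [Const 41 0, Arith OAdd y 40 41, Const x 0]
         @ [Arith OSub 40 y x, Jz 40 (ph + 2 + length body + 4)] @ body
         @ [Const 40 1, Arith OAdd x x 40, Const 40 0, Jz 40 ph])"

primrec vars :: "com \<Rightarrow> nat set" where
  "vars Skip = {}"
| "vars (Asg x e) = {x}"
| "vars (Sto f a e) = {}"
| "vars (Seq a b) = vars a \<union> vars b"
| "vars (If e a b) = vars a \<union> vars b"
| "vars (For x y e c) = insert x (insert y (vars c))"

primrec arrs :: "com \<Rightarrow> nat set" where
  "arrs Skip = {}"
| "arrs (Asg x e) = {}"
| "arrs (Sto f a e) = {f}"
| "arrs (Seq a b) = arrs a \<union> arrs b"
| "arrs (If e a b) = arrs a \<union> arrs b"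
| "arrs (For x y e c) = arrs c"

text \<open>There are 20 temporaries from register 40 on; a store keeps its address in register 40,
  which leaves 19 for the stored value. The body of a loop may assign neither the counter nor the
  saved bound.\<close>

primrec wf_com :: "com \<Rightarrow> bool" where
  "wf_com Skip = True"
| "wf_com (Asg x e) = (x < 40 \<and> wf_exp e \<and> edepth e \<le> 20)"
| "wf_com (Sto f a e) = (f < 10 \<and> wf_exp a \<and> wf_exp e \<and> edepth a \<le> 20 \<and> edepth e \<le> 19)"
| "wf_com (Seq a b) = (wf_com a \<and> wf_com b)"
| "wf_com (If e a b) = (wf_exp e \<and> edepth e \<le> 20 \<and> wf_com a \<and> wf_com b)"
| "wf_com (For x y e c) = (x < 40 \<and> y < 40 \<and> x \<noteq> y \<and> x \<notin> vars c \<and> y \<notin> vars c \<and>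
     wf_exp e \<and> edepth e \<le> 20 \<and> wf_com c)"

primrec csize :: "com \<Rightarrow> nat" where
  "csize Skip = 1"
| "csize (Asg x e) = esize e + 1"
| "csize (Sto f a e) = esize a + 11 + (61 + f) + esize e"
| "csize (Seq a b) = csize a + csize b"
| "csize (If e a b) = esize e + csize a + csize b"
| "csize (For x y e c) = esize e + 2 + csize c"

text \<open>The number of rounds is fixed on entry, so every program denotes a total function. The
  counter is incremented from its value before the body, which on well-formed loops is also its
  value after the body.\<close>

primrec sem :: "wpm_input \<Rightarrow> com \<Rightarrow> store \<Rightarrow> store" where
  "sem I Skip st = st"
| "sem I (Asg x e) st = setv x (val I e st) st"
| "sem I (Sto f a e) st = seta f (val I a st) (val I e st) st"
| "sem I (Seq a b) st = sem I b (sem I a st)"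
| "sem I (If e a b) st = (if val I e st \<noteq> 0 then sem I a st else sem I b st)"
| "sem I (For x y e c) st =
     ((\<lambda>st'. setv x (Suc (fst st' x)) (sem I c st')) ^^ val I e st) (setv x 0 (setv y (val I e st) st))"

text \<open>An upper bound rather than an exact count: a conditional is always charged for the jump
  over the else branch. A loop pays 3 instructions for initialisation, 2 for the last test, and per
  round 2 for the test and 4 for increment and jump back.\<close>

primrec cost :: "wpm_input \<Rightarrow> com \<Rightarrow> store \<Rightarrow> nat" where
  "cost I Skip st = 0"
| "cost I (Asg x e) st = elen e + 2"
| "cost I (Sto f a e) st = elen a + elen e + 5"
| "cost I (Seq a b) st = cost I a st + cost I b (sem I a st)"
| "cost I (If e a b) st = elen e + 3 + (if val I e st \<noteq> 0 then cost I a st else cost I b st)"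
| "cost I (For x y e c) st = elen e + 5 + (\<Sum>i<val I e st.
     6 + cost I c (((\<lambda>st'. setv x (Suc (fst st' x)) (sem I c st')) ^^ i)
       (setv x 0 (setv y (val I e st) st))))"

text \<open>Only values that reach a variable or an array entry have to be below R. Intermediate
  results may be larger; they are controlled by \<open>esize\<close> and
  \<open>csize\<close>.\<close>

primrec ok :: "wpm_input \<Rightarrow> nat \<Rightarrow> nat \<Rightarrow> com \<Rightarrow> store \<Rightarrow> bool" where
  "ok I R M Skip st = True"
| "ok I R M (Asg x e) st = (idx_ok I M e st \<and> val I e st < R)"
| "ok I R M (Sto f a e) st = (idx_ok I M a st \<and> idx_ok I M e st \<and> val I a st < M \<and> val I e st < R)"
| "ok I R M (Seq a b) st = (ok I R M a st \<and> ok I R M b (sem I a st))"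
| "ok I R M (If e a b) st = (idx_ok I M e st \<and>
     (if val I e st \<noteq> 0 then ok I R M a st else ok I R M b st))"
| "ok I R M (For x y e c) st = (idx_ok I M e st \<and> val I e st < R \<and> (\<forall>i<val I e st.
     ok I R M c (((\<lambda>st'. setv x (Suc (fst st' x)) (sem I c st')) ^^ i)
       (setv x 0 (setv y (val I e st) st)))))"

definition agree :: "nat set \<Rightarrow> nat set \<Rightarrow> store \<Rightarrow> store \<Rightarrow> bool" where
  "agree X F st st' \<longleftrightarrow> (\<forall>x. x \<notin> X \<longrightarrow> fst st' x = fst st x) \<and> (\<forall>f. f \<notin> F \<longrightarrow> snd st' f = snd st f)"

lemma agree_trans: "agree X F a b \<Longrightarrow> agree X F b c \<Longrightarrow> agree X F a c"
  by (simp add: agree_def)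

lemma agree_mono: "agree X F a b \<Longrightarrow> X \<subseteq> X' \<Longrightarrow> F \<subseteq> F' \<Longrightarrow> agree X' F' a b"
  by (auto simp: agree_def)

lemma agree_sem: "agree (vars c) (arrs c) st (sem I c st)"
proof (induction c arbitrary: st)
  case (Seq a b)
  then show ?case
    by (simp, meson agree_mono agree_trans sup_ge1 sup_ge2)
next
  case (If e a b)
  then show ?case
    by (simp, meson agree_mono sup_ge1 sup_ge2)
next
  case (For x y e c)
  let ?F = "\<lambda>st'. setv x (Suc (fst st' x)) (sem I c st')"
  let ?st = "setv x 0 (setv y (val I e st) st)"
  have "agree (vars (For x y e c)) (arrs (For x y e c)) st ((?F ^^ i) ?st)" for i
  proof (induction i)
    case 0
    then show ?case by (simp add: agree_def)
  next
    case (Suc i)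
    have "agree (vars c) (arrs c) st' (sem I c st')" for st' using For .
    then have "agree (vars (For x y e c)) (arrs (For x y e c)) st' (?F st')" for st'
      by (simp add: agree_def)
    from agree_trans[OF Suc this] show ?case by simp
  qed
  then show ?case by simp
qed (auto simp: agree_def)

subsection \<open>Traces of the machine\<close>

text \<open>A run segment with exactly the side conditions of \<open>runs_within\<close> on
  registers and contents. In contrast to a complete run from the initial configuration, segments can
  be concatenated.\<close>

inductive trace :: "instr list \<Rightarrow> wpm_input \<Rightarrow> nat \<Rightarrow> nat \<Rightarrow> conf \<Rightarrow> nat \<Rightarrow> conf \<Rightarrow> bool"
  for prog I S B where
  stop: "\<forall>j. snd c j < B \<Longrightarrow> trace prog I S B c 0 c"
| move: "fst c < length prog \<Longrightarrow> \<forall>j. snd c j < B \<Longrightarrow> instr_regs (prog ! fst c) (snd c) \<subseteq> {..<S}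
    \<Longrightarrow> trace prog I S B (instr_step I (prog ! fst c) c) t c' \<Longrightarrow> trace prog I S B c (Suc t) c'"

lemma trace_trans: "trace prog I S B c t c' \<Longrightarrow> trace prog I S B c' t' c'' \<Longrightarrow> trace prog I S B c (t + t') c''"
  by (induction rule: trace.induct) (auto intro: trace.move)

lemma trace_bounded: "trace prog I S B c t c' \<Longrightarrow> \<forall>j. snd c' j < B"
  by (induction rule: trace.induct) auto

lemma trace_step_at:
  assumes "trace prog I S B c t c'"
  shows "(step prog I ^^ t) c = c' \<and>
    (\<forall>k<t. \<not> halted prog ((step prog I ^^ k) c) \<and>
      instr_regs (prog ! fst ((step prog I ^^ k) c)) (snd ((step prog I ^^ k) c)) \<subseteq> {..<S}) \<and>
    (\<forall>k\<le>t. \<forall>r. snd ((step prog I ^^ k) c) r < B)"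
  using assms
proof (induction rule: trace.induct)
  case (stop c)
  then show ?case by simp
next
  case (move c t c')
  have st: "step prog I c = instr_step I (prog ! fst c) c"
    using move by (simp add: step_def halted_def)
  have pow_exp: "(step prog I ^^ Suc k) c = (step prog I ^^ k) (instr_step I (prog ! fst c) c)" for k
    by (simp add: funpow_Suc_right st del: funpow.simps)
  have less: "(\<forall>k<Suc t. P k) \<longleftrightarrow> P 0 \<and> (\<forall>k<t. P (Suc k))" for P
    by (auto simp: less_Suc_eq_0_disj)
  have "(\<forall>k\<le>Suc t. P k) \<longleftrightarrow> P 0 \<and> (\<forall>k\<le>t. P (Suc k))" for P
    using All_less_Suc2[of "Suc t" P] by (simp add: less_Suc_eq_le)
  then show ?case
    unfolding less using move by (simp add: pow_exp halted_def del: funpow.simps(2))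
qed

section \<open>Code fragments at absolute addresses and single instructions\<close>

definition code_at :: "instr list \<Rightarrow> nat \<Rightarrow> instr list \<Rightarrow> bool" where
  "code_at prog p xs \<longleftrightarrow> (\<exists>ys zs. prog = ys @ xs @ zs \<and> length ys = p)"

lemma code_at_append:
  "code_at prog p (xs @ ys) \<longleftrightarrow> code_at prog p xs \<and> code_at prog (p + length xs) ys"
proof
  assume "code_at prog p (xs @ ys)"
  then obtain us zs where "prog = us @ (xs @ ys) @ zs" "length us = p"
    by (auto simp: code_at_def)
  then have "prog = us @ xs @ (ys @ zs)" "prog = (us @ xs) @ ys @ zs" "length us = p"
    "length (us @ xs) = p + length xs"
    by auto
  then show "code_at prog p xs \<and> code_at prog (p + length xs) ys"
    unfolding code_at_def by blast
next
  assume "code_at prog p xs \<and> code_at prog (p + length xs) ys"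
  then obtain us zs us' zs' where *: "prog = us @ xs @ zs" "length us = p"
    "prog = us' @ ys @ zs'" "length us' = p + length xs"
    unfolding code_at_def by blast
  have "us' @ (ys @ zs') = (us @ xs) @ zs" using * by simp
  then have "us' = us @ xs \<and> ys @ zs' = zs"
    using *(2,4) by (subst (asm) append_eq_append_conv) auto
  then have "prog = us @ (xs @ ys) @ zs'" using * by simp
  then show "code_at prog p (xs @ ys)"
    using *(2) unfolding code_at_def by blast
qed

lemma code_at_Cons:
  "code_at prog p (i # xs) \<longleftrightarrow> code_at prog p [i] \<and> code_at prog (Suc p) xs"
  using code_at_append[of prog p "[i]" xs] by simp

lemma trace_instr:
  assumes "code_at prog p [i]" "\<forall>j. r j < B" "instr_regs i r \<subseteq> {..<S}"
    "instr_step I i (p, r) = (p', r')" "\<forall>j. r' j < B"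
  shows "trace prog I S B (p, r) (Suc 0) (p', r')"
proof -
  have "p < length prog" "prog ! p = i"
    using assms(1) by (auto simp: code_at_def)
  then show ?thesis
    using assms trace.move[of "(p, r)" prog B S I 0 "(p', r')"] trace.stop[of "(p', r')"] by simp
qed

lemma trace_instr_Cons:
  assumes "code_at prog p [i]" "\<forall>j. r j < B" "instr_regs i r \<subseteq> {..<S}"
    "instr_step I i (p, r) = (p', r')" "\<forall>j. r' j < B" "trace prog I S B (p', r') t c'"
  shows "trace prog I S B (p, r) (Suc t) c'"
  using trace_trans[OF trace_instr[OF assms(1-5)] assms(6)] by simp

text \<open>The ten arrays are interleaved, so indices below M occupy only registers below 60 + 10 M
  and no array size has to be known to the compiler. The temporaries 40 to 59 are left
  unconstrained.\<close>

definition repr :: "store \<Rightarrow> (nat \<Rightarrow> nat) \<Rightarrow> bool" where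
  "repr st r \<longleftrightarrow> (\<forall>x<40. r x = fst st x) \<and> (\<forall>f<10. \<forall>i. r (60 + 10 * i + f) = snd st f i)"

section \<open>Size bounds for stores, inputs and values of expressions\<close>

definition below :: "nat \<Rightarrow> store \<Rightarrow> bool" where
  "below R st \<longleftrightarrow> (\<forall>x. fst st x < R) \<and> (\<forall>f i. snd st f i < R)"

definition inp_below :: "wpm_input \<Rightarrow> nat \<Rightarrow> bool" where
  "inp_below I R \<longleftrightarrow> 2 \<le> R \<and> length (in_text I) < R \<and> length (in_pat I) < R \<and> in_par I < R \<and>
     (\<forall>i. txt_at I i < R) \<and> (\<forall>i. pat_at I i < R)"

lemma repr_cong: "repr st r \<Longrightarrow> (\<And>j. j < 40 \<or> 60 \<le> j \<Longrightarrow> r' j = r j) \<Longrightarrow> repr st r'"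
  by (auto simp: repr_def)

text \<open>A sum, like a product, only adds the exponents, since u + v <= u v as soon as both are
  at least 2. Thus one additive size measure covers all operations.\<close>

lemma add_less_power_add:
  fixes x y R :: nat
  assumes "x < R ^ a" "y < R ^ b" "2 \<le> R" "0 < a" "0 < b"
  shows "x + y < R ^ (a + b)"
proof -
  have "2 \<le> R ^ a" "2 \<le> R ^ b"
    using assms by (meson le_trans self_le_power less_le_trans zero_less_numeral one_le_numeral)+
  then obtain u v where "R ^ a = 2 + u" "R ^ b = 2 + v" by (meson le_Suc_ex)
  then have "R ^ a + R ^ b \<le> R ^ a * R ^ b" by (simp add: algebra_simps)
  then show ?thesis using assms by (simp add: power_add)
qed

lemma mult_less_power_add:
  fixes x y R :: nat
  assumes "x < R ^ a" "y < R ^ b"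
  shows "x * y < R ^ (a + b)"
  using assms by (simp add: power_add mult_strict_mono')

lemma const_less_power: "2 \<le> (R::nat) \<Longrightarrow> c < R ^ (c + 1)"
  by (metis add.commute less_exp order_less_le_trans plus_1_eq_Suc power_mono zero_le
      Suc_lessD)

lemma val_less:
  assumes "below R st" "inp_below I R"
  shows "val I e st < R ^ esize e"
proof (induction e)
  case (Num c)
  then show ?case using assms const_less_power by (auto simp: inp_below_def simp del: power_Suc)
next
  case (Bin f a b)
  have R: "2 \<le> R" using assms by (simp add: inp_below_def)
  have *: "R ^ esize a \<le> R ^ (esize a + esize b)" using R by (intro power_increasing) auto
  have "aop_sem f x y < R ^ (esize a + esize b)" if "x < R ^ esize a" "y < R ^ esize b" for x y
  proof -
    have "z < R ^ (esize a + esize b)" if "z \<le> x" for z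
      using that \<open>x < R ^ esize a\<close> * by linarith
    then show ?thesis
      using that R by (cases f) (auto simp: add_less_power_add mult_less_power_add)
  qed
  then show ?case using Bin by simp
next
  case (Arr f a)
  have "R ^ 1 \<le> R ^ (esize a + 11 + (61 + f))"
    using assms by (intro power_increasing) (auto simp: inp_below_def)
  then show ?case using assms by (auto simp: below_def intro: less_le_trans)
next
  case (Txt a)
  have "R ^ 1 \<le> R ^ esize a"
    using assms by (intro power_increasing) (auto simp: inp_below_def Suc_le_eq)
  then show ?case using assms by (auto simp: inp_below_def intro: less_le_trans)
next
  case (Pat a)
  have "R ^ 1 \<le> R ^ esize a"
    using assms by (intro power_increasing) (auto simp: inp_below_def Suc_le_eq)
  then show ?case using assms by (auto simp: inp_below_def intro: less_le_trans)
qed (use assms in \<open>auto simp: below_def inp_below_def\<close>)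

section \<open>Correctness of compiled expressions\<close>

lemma pow_le_trans: "(R::nat) ^ m \<le> B \<Longrightarrow> 2 \<le> R \<Longrightarrow> n \<le> m \<Longrightarrow> R ^ n \<le> B"
  by (rule order_trans[OF power_increasing]) simp_all

text \<open>The address 60 + 10 v + f is computed in registers, so the literals 10 and 60 + f must
  respect the content bound too. The exponents 11 and 61 + f come from c < R^(c + 1).\<close>

lemma comp_exp_addr:
  assumes "code_at prog p [Const (Suc k) 10, Arith OMul k k (Suc k), Const (Suc k) (60 + f),
      Arith OAdd k k (Suc k)]"
    and "\<forall>j. r j < B" and v: "v < R ^ a" "r k = v" "0 < a"
    and "40 \<le> k" "Suc k < 60" "60 \<le> S" "R ^ (a + 11 + (61 + f)) \<le> B" "2 \<le> R"
  shows "trace prog I S B (p, r) 4 (p + 4, r(k := 60 + 10 * v + f, Suc k := 60 + f))"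
proof -
  have mon: "R ^ i \<le> B" if "i \<le> a + 11 + (61 + f)" for i
    using power_increasing[OF that, of R] assms by linarith
  have c1: "10 < R ^ 11" using const_less_power[of R 10] assms by simp
  have c2: "60 + f < R ^ (61 + f)" using const_less_power[of R "60 + f"] assms by (simp add: add_ac)
  have m: "v * 10 < R ^ (a + 11)" using mult_less_power_add[OF v(1) c1] .
  have s: "v * 10 + (60 + f) < R ^ (a + 11 + (61 + f))"
    using add_less_power_add[OF m c2] assms by simp
  have B: "10 < B" "60 + f < B" "v * 10 < B" "v * 10 + (60 + f) < B"
    using c1 c2 m s mon[of 11] mon[of "61 + f"] mon[of "a + 11"] mon[of "a + 11 + (61 + f)"] by auto
  have code: "code_at prog p [Const (Suc k) 10]" "code_at prog (Suc p) [Arith OMul k k (Suc k)]"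
    "code_at prog (Suc (Suc p)) [Const (Suc k) (60 + f)]" "code_at prog (Suc (Suc (Suc p))) [Arith OAdd k k (Suc k)]"
    using assms(1) by (simp_all add: code_at_Cons[of _ _ _ "_ # _"])
  have "trace prog I S B (p, r) (Suc (Suc (Suc (Suc 0))))
      (Suc (Suc (Suc (Suc p))), r(k := 60 + 10 * v + f, Suc k := 60 + f))"
    by (intro trace_instr_Cons[OF code(1), where r' = "r(Suc k := 10)" and p' = "Suc p"]
        trace_instr_Cons[OF code(2), where r' = "r(Suc k := 10, k := v * 10)" and p' = "Suc (Suc p)"]
        trace_instr_Cons[OF code(3), where r' = "r(Suc k := 60 + f, k := v * 10)" and p' = "Suc (Suc (Suc p))"]
        trace_instr[OF code(4)])
      (use assms B in \<open>auto simp: fun_eq_iff algebra_simps\<close>)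
  moreover have "4 = Suc (Suc (Suc (Suc 0)))" "p + 4 = Suc (Suc (Suc (Suc p)))" by simp_all
  ultimately show ?thesis by metis
qed

text \<open>Preservation of all registers below k is the part that makes the induction work: the
  value of a left operand in k survives the evaluation of the right operand from
  \<open>Suc k\<close> on. Preservation from 60 on keeps the arrays intact.\<close>

lemma comp_exp_correct:
  assumes "code_at prog p (comp_exp k e)" "repr st r" "\<forall>j. r j < B" "wf_exp e" "40 \<le> k"
    "k + edepth e \<le> 60" "idx_ok I M e st" "below R st" "R ^ esize e \<le> B" "inp_below I R" "60 + 10 * M \<le> S"
  shows "\<exists>r'. trace prog I S B (p, r) (elen e) (p + elen e, r') \<and> r' k = val I e st \<and>
    (\<forall>j. j < k \<or> 60 \<le> j \<longrightarrow> r' j = r j)"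
  using assms
proof (induction e arbitrary: p k r)
  case (Num c)
  have "c < R ^ (c + 1)" using Num by (intro const_less_power) (auto simp: inp_below_def)
  then have "trace prog I S B (p, r) (Suc 0) (Suc p, r(k := c))"
    using Num by (intro trace_instr[where i = "Const k c"]) auto
  then show ?case
    using Num.prems by (intro exI[of _ "r(k := c)"] conjI) (simp_all add: fun_upd_def)
next
  case (Var x)
  have v: "r x = fst st x" using Var by (simp add: repr_def)
  have *: "fst st x < B" using Var(3) v by metis
  have code: "code_at prog p [Const k 0]" "code_at prog (Suc p) [Arith OAdd k x k]"
    using Var by (simp_all add: code_at_Cons[of _ _ _ "[_]"])
  have "trace prog I S B (p, r) (Suc (Suc 0)) (p + 2, r(k := fst st x))"
    apply (rule trace_instr_Cons[OF code(1), where r' = "r(k := 0)" and p' = "Suc p"])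
    subgoal using Var by simp
    subgoal using Var by auto
    subgoal by simp
    subgoal using Var * by auto
    apply (rule trace_instr[OF code(2)])
    using Var * v by auto
  then show ?case using Var.prems
    by (intro exI[of _ "r(k := fst st x)"] conjI) (simp_all add: fun_upd_def numeral_2_eq_2)
next
  case (Bin f a b)
  have R: "2 \<le> R" using Bin by (simp add: inp_below_def)
  have le: "R ^ esize a \<le> B" "R ^ esize b \<le> B"
    using R by (auto intro: pow_le_trans[OF Bin.prems(9)])
  note code = Bin.prems(1)[simplified, unfolded code_at_append]
  have "k + edepth a \<le> 60" "Suc k + edepth b \<le> 60"
    using Bin.prems(6) max.cobounded1[of "edepth a" "Suc (edepth b)"]
      max.cobounded2[of "Suc (edepth b)" "edepth a"] by auto
  note dep = this
  obtain r1 where r1: "trace prog I S B (p, r) (elen a) (p + elen a, r1)" "r1 k = val I a st"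
    "\<forall>j. j < k \<or> 60 \<le> j \<longrightarrow> r1 j = r j"
    using Bin.IH(1)[of p k r] Bin.prems dep code le by auto
  have b1: "\<forall>j. r1 j < B" using trace_bounded[OF r1(1)] by simp
  have rep1: "repr st r1" using r1(3) Bin.prems(2,5) by (auto intro: repr_cong)
  obtain r2 where r2: "trace prog I S B (p + elen a, r1) (elen b) (p + elen a + elen b, r2)"
    "r2 (Suc k) = val I b st" "\<forall>j. j < Suc k \<or> 60 \<le> j \<longrightarrow> r2 j = r1 j"
    using Bin.IH(2)[of "p + elen a" "Suc k" r1] Bin.prems dep code le b1 rep1 by auto
  have b2: "\<forall>j. r2 j < B" using trace_bounded[OF r2(1)] by simp
  define v where "v = val I (Bin f a b) st"
  have v: "v < B" using val_less[OF Bin.prems(8,10), of "Bin f a b"] Bin.prems(9) by (simp add: v_def)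
  have "0 < edepth b" by (induction b) auto
  then have k: "Suc k < S" using Bin.prems by simp
  have "trace prog I S B (p + elen a + elen b, r2) (Suc 0) (p + elen a + elen b + 1, r2(k := v))"
    by (rule trace_instr[where i = "Arith f k k (Suc k)"])
      (use code b2 r2 r1 v k in \<open>auto simp: v_def add.assoc\<close>)
  from trace_trans[OF r1(1) trace_trans[OF r2(1) this]]
  show ?case
    by (intro exI[of _ "r2(k := v)"]) (use r1 r2 Bin.prems in \<open>auto simp: v_def add_ac fun_upd_def\<close>)
next
  case (Arr f a)
  have R: "2 \<le> R" using Arr by (simp add: inp_below_def)
  have le: "R ^ esize a \<le> B"
    using R by (auto intro: pow_le_trans[OF Arr.prems(9)])
  have dep: "k + edepth a \<le> 60" "Suc k < 60"
    using Arr.prems(6) max.cobounded1[of "edepth a" 2] max.cobounded2[of 2 "edepth a"] by auto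
  have code: "code_at prog p (comp_exp k a)" "code_at prog (p + elen a) [Const (Suc k) 10, Arith OMul k k (Suc k), Const (Suc k) (60 + f),
      Arith OAdd k k (Suc k)]" "code_at prog (p + elen a + 4) [LoadI k k]"
    using Arr.prems(1) code_at_append[of prog p "comp_exp k a"]
      code_at_append[of prog "p + elen a" "[Const (Suc k) 10, Arith OMul k k (Suc k), Const (Suc k) (60 + f),
      Arith OAdd k k (Suc k)]" "[LoadI k k]"] by (auto simp: eval_nat_numeral)
  obtain r1 where r1: "trace prog I S B (p, r) (elen a) (p + elen a, r1)" "r1 k = val I a st"
    "\<forall>j. j < k \<or> 60 \<le> j \<longrightarrow> r1 j = r j"
    using Arr.IH[of p k r] Arr.prems dep code le by auto
  have b1: "\<forall>j. r1 j < B" using trace_bounded[OF r1(1)] by simp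
  let ?v = "val I a st"
  define r2 where "r2 = r1(k := 60 + 10 * ?v + f, Suc k := 60 + f)"
  have t2: "trace prog I S B (p + elen a, r1) 4 (p + elen a + 4, r2)"
    unfolding r2_def using Arr.prems dep R r1 b1 by (intro comp_exp_addr[OF code(2) b1 val_less[OF Arr.prems(8,10)]]) (auto simp: add_ac)
  have b2: "\<forall>j. r2 j < B" using trace_bounded[OF t2] by simp
  have v: "r2 (60 + 10 * ?v + f) = snd st f ?v"
    using Arr.prems dep r1(3) by (auto simp: repr_def r2_def)
  have r2k: "r2 k = 60 + 10 * ?v + f" by (simp add: r2_def)
  have r2j: "r2 j = r1 j" if "j < k \<or> 60 \<le> j" for j
    using that dep by (auto simp: r2_def)
  have vB: "snd st f ?v < B" using v b2 by metis
  have "60 + 10 * ?v + f < S" using Arr.prems by simp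
  then have "trace prog I S B (p + elen a + 4, r2) (Suc 0) (p + elen a + 5, r2(k := snd st f ?v))"
    by (intro trace_instr[OF code(3)]) (use Arr.prems dep b2 v vB in \<open>auto simp: r2k\<close>)
  from trace_trans[OF r1(1) trace_trans[OF t2 this]]
  show ?case
    by (intro exI[of _ "r2(k := snd st f ?v)"]) (use r1 r2j Arr.prems dep in \<open>auto simp: add_ac fun_upd_def\<close>)
next
  case (Txt a)
  note code = Txt.prems(1)[simplified, unfolded code_at_append]
  obtain r1 where r1: "trace prog I S B (p, r) (elen a) (p + elen a, r1)" "r1 k = val I a st"
    "\<forall>j. j < k \<or> 60 \<le> j \<longrightarrow> r1 j = r j"
    using Txt.IH[of p k r] Txt.prems code by auto
  have b1: "\<forall>j. r1 j < B" using trace_bounded[OF r1(1)] by simp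
  define v where "v = val I (Txt a) st"
  have v: "v < B" using val_less[OF Txt.prems(8,10), of "Txt a"] Txt.prems(9) by (simp add: v_def)
  have "0 < edepth a" by (induction a) auto
  then have k: "k < S" "k < 60" using Txt.prems by simp_all
  have "trace prog I S B (p + elen a, r1) (Suc 0) (p + elen a + 1, r1(k := v))"
    by (rule trace_instr[where i = "ReadT k k"])
      (use code b1 r1 v k in \<open>auto simp: v_def txt_at_def\<close>)
  from trace_trans[OF r1(1) this]
  show ?case
    by (intro exI[of _ "r1(k := v)"]) (use r1 k Txt.prems in \<open>auto simp: v_def add_ac fun_upd_def\<close>)
next
  case (Pat a)
  note code = Pat.prems(1)[simplified, unfolded code_at_append]
  obtain r1 where r1: "trace prog I S B (p, r) (elen a) (p + elen a, r1)" "r1 k = val I a st"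
    "\<forall>j. j < k \<or> 60 \<le> j \<longrightarrow> r1 j = r j"
    using Pat.IH[of p k r] Pat.prems code by auto
  have b1: "\<forall>j. r1 j < B" using trace_bounded[OF r1(1)] by simp
  define v where "v = val I (Pat a) st"
  have v: "v < B" using val_less[OF Pat.prems(8,10), of "Pat a"] Pat.prems(9) by (simp add: v_def)
  have "0 < edepth a" by (induction a) auto
  then have k: "k < S" "k < 60" using Pat.prems by simp_all
  have "trace prog I S B (p + elen a, r1) (Suc 0) (p + elen a + 1, r1(k := v))"
    by (rule trace_instr[where i = "ReadP k k"])
      (use code b1 r1 v k in \<open>auto simp: v_def pat_at_def\<close>)
  from trace_trans[OF r1(1) this]
  show ?case
    by (intro exI[of _ "r1(k := v)"]) (use r1 k Pat.prems in \<open>auto simp: v_def add_ac fun_upd_def\<close>)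
next
  case TLen
  then have "trace prog I S B (p, r) (Suc 0) (Suc p, r(k := length (in_text I)))"
    by (intro trace_instr[where i = "LenT k"]) (auto simp: inp_below_def)
  then show ?case using TLen.prems
    by (intro exI[of _ "r(k := length (in_text I))"] conjI) (simp_all add: fun_upd_def)
next
  case PLen
  then have "trace prog I S B (p, r) (Suc 0) (Suc p, r(k := length (in_pat I)))"
    by (intro trace_instr[where i = "LenP k"]) (auto simp: inp_below_def)
  then show ?case using PLen.prems
    by (intro exI[of _ "r(k := length (in_pat I))"] conjI) (simp_all add: fun_upd_def)
next
  case Par
  then have "trace prog I S B (p, r) (Suc 0) (Suc p, r(k := in_par I))"
    by (intro trace_instr[where i = "ParS k"]) (auto simp: inp_below_def)
  then show ?case using Par.prems
    by (intro exI[of _ "r(k := in_par I)"] conjI) (simp_all add: fun_upd_def)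
qed

section \<open>Correctness of compiled commands\<close>

lemma trace_move:
  assumes "code_at prog p [Const 41 0, Arith OAdd x 40 41]" "\<forall>j. r j < B" "x < 40" "60 \<le> S"
  shows "trace prog I S B (p, r) (Suc (Suc 0)) (Suc (Suc p), r(41 := 0, x := r 40))"
proof -
  have code: "code_at prog p [Const 41 0]" "code_at prog (Suc p) [Arith OAdd x 40 41]"
    using assms(1) by (simp_all add: code_at_Cons[of _ _ _ "[_]"])
  have "0 < B" using assms(2) by (metis gr_zeroI less_nat_zero_code)
  then show ?thesis
    apply (intro trace_instr_Cons[OF code(1), where p' = "Suc p" and r' = "r(41 := 0)"] trace_instr[OF code(2)])
    using assms by (auto simp: fun_eq_iff)
qed

lemma code_at_appendD:
  assumes "code_at prog p (xs @ ys)"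
  shows "code_at prog p xs" "code_at prog (p + length xs) ys"
  using assms code_at_append by auto

text \<open>The induction maintains two bounds at once: the store stays below R, which is what the
  size estimates for the next expression start from, while all registers including temporaries stay
  below B. The step count is existential because \<open>cost\<close> may overestimate.\<close>

lemma comp_com_correct:
  assumes "code_at prog p (comp_com p c)" "wf_com c" "ok I R M c st" "below R st" "repr st r" "\<forall>j. r j < B"
    "R ^ csize c \<le> B" "inp_below I R" "60 + 10 * M \<le> S"
  shows "\<exists>t r'. t \<le> cost I c st \<and> trace prog I S B (p, r) t (p + length (comp_com p c), r') \<and>
    repr (sem I c st) r' \<and> below R (sem I c st)"
  using assms
proof (induction c arbitrary: p st r)
  case Skip
  then show ?case by (intro exI[of _ 0] exI[of _ r]) (auto intro: trace.stop)
next
  case (Asg x e)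
  have R: "2 \<le> R" using Asg by (simp add: inp_below_def)
  have le: "R ^ esize e \<le> B"
    using R by (auto intro: pow_le_trans[OF Asg.prems(7)])
  have code: "code_at prog p (comp_exp 40 e)" "code_at prog (p + elen e) [Const 41 0, Arith OAdd x 40 41]"
    using Asg.prems(1) by (simp_all add: code_at_append)
  obtain r1 where r1: "trace prog I S B (p, r) (elen e) (p + elen e, r1)" "r1 40 = val I e st"
    "\<forall>j. j < 40 \<or> 60 \<le> j \<longrightarrow> r1 j = r j"
    using comp_exp_correct[OF code(1) Asg.prems(5,6) _ _ _ _ Asg.prems(4) le Asg.prems(8,9)] Asg.prems by auto
  have t2: "trace prog I S B (p + elen e, r1) (Suc (Suc 0)) (Suc (Suc (p + elen e)), r1(41 := 0, x := r1 40))"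
    using Asg.prems trace_bounded[OF r1(1)] by (intro trace_move[OF code(2)]) auto
  have rp: "repr (setv x (val I e st) st) (r1(41 := 0, x := r1 40))"
    using Asg.prems(2,5) r1 by (auto simp: repr_def)
  have "below R (setv x (val I e st) st)" using Asg.prems by (auto simp: below_def)
  then show ?case using trace_trans[OF r1(1) t2] rp
    by (intro exI[of _ "elen e + 2"] exI[of _ "r1(41 := 0, x := r1 40)"]) (auto simp: fun_upd_def numeral_2_eq_2)
next
  case (Sto f a e)
  have R: "2 \<le> R" using Sto by (simp add: inp_below_def)
  have f: "f < 10" using Sto by simp
  have le: "R ^ esize a \<le> B" "R ^ esize e \<le> B" "R ^ (esize a + 11 + (61 + f)) \<le> B"
    using R by (auto intro: pow_le_trans[OF Sto.prems(7)])
  have four: "x + 4 = Suc (Suc (Suc (Suc x)))" for x by simp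
  let ?ad = "[Const 41 10, Arith OMul 40 40 41, Const 41 (60 + f), Arith OAdd 40 40 41]"
  have 1: "code_at prog p (comp_exp 40 a @ ?ad @ comp_exp 41 e @ [StoreI 40 41])" using Sto.prems(1) by simp
  note 2 = code_at_appendD[OF 1] note 3 = code_at_appendD[OF 2(2)] note 4 = code_at_appendD[OF 3(2)]
  have code: "code_at prog p (comp_exp 40 a)" "code_at prog (p + elen a) ?ad"
    "code_at prog (p + elen a + 4) (comp_exp 41 e)" "code_at prog (p + elen a + 4 + elen e) [StoreI 40 41]"
    unfolding four using 2(1) 3(1) 4 by simp_all
  obtain r1 where r1: "trace prog I S B (p, r) (elen a) (p + elen a, r1)" "r1 40 = val I a st"
    "\<forall>j. j < 40 \<or> 60 \<le> j \<longrightarrow> r1 j = r j"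
    using comp_exp_correct[OF code(1) Sto.prems(5,6) _ _ _ _ Sto.prems(4) le(1) Sto.prems(8,9)] Sto.prems by auto
  let ?v = "val I a st"
  define r2 where "r2 = r1(40 := 60 + 10 * ?v + f, Suc 40 := 60 + f)"
  have b1: "\<forall>j. r1 j < B" using trace_bounded[OF r1(1)] by simp
  have t2: "trace prog I S B (p + elen a, r1) 4 (p + elen a + 4, r2)"
    using Sto.prems R r1 b1 le code(2)
    unfolding r2_def
    by (intro comp_exp_addr[OF _ b1 val_less[OF Sto.prems(4,8)]]) auto
  have b2: "\<forall>j. r2 j < B" using trace_bounded[OF t2] by simp
  have rp2: "repr st r2" using r1(3) Sto.prems(5) by (auto intro: repr_cong simp: r2_def)
  obtain r3 where r3: "trace prog I S B (p + elen a + 4, r2) (elen e) (p + elen a + 4 + elen e, r3)" "r3 41 = val I e st"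
    "\<forall>j. j < 41 \<or> 60 \<le> j \<longrightarrow> r3 j = r2 j"
    using comp_exp_correct[OF code(3) rp2 b2 _ _ _ _ Sto.prems(4) le(2) Sto.prems(8,9)] Sto.prems by auto
  have r340: "r3 40 = 60 + 10 * ?v + f" using r3(3) by (simp add: r2_def)
  have b3: "\<forall>j. r3 j < B" using trace_bounded[OF r3(1)] by simp
  have b4: "val I e st < B" using r3(2) b3 by metis
  define r4 where "r4 = r3(60 + 10 * ?v + f := val I e st)"
  have S: "60 + 10 * ?v + f < S" using Sto.prems by simp
  have t4: "trace prog I S B (p + elen a + 4 + elen e, r3) (Suc 0) (Suc (p + elen a + 4 + elen e), r4)"
    using S r340 r3(2) b3 b4 unfolding r4_def by (intro trace_instr[OF code(4)]) auto
  have end_pc: "Suc (p + elen a + 4 + elen e) = p + length (comp_com p (Sto f a e))" by simp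
  have "repr st r3" using r3(3) rp2 by (auto intro: repr_cong)
  then have "repr (seta f ?v (val I e st) st) r4"
    using f unfolding repr_def r4_def by (auto; presburger)
  moreover have "below R (seta f ?v (val I e st) st)" using Sto.prems by (auto simp: below_def)
  moreover note trace_trans[OF r1(1) trace_trans[OF t2 trace_trans[OF r3(1) t4[unfolded end_pc]]]]
  ultimately show ?case
    by (intro exI[of _ "elen a + (4 + (elen e + Suc 0))"] exI[of _ r4]) simp
next
  case (Seq a b)
  have R: "2 \<le> R" using Seq by (simp add: inp_below_def)
  have le: "R ^ csize a \<le> B" "R ^ csize b \<le> B"
    using R by (auto intro: pow_le_trans[OF Seq.prems(7)])
  have 1: "code_at prog p (comp_com p a @ comp_com (p + length (comp_com p a)) b)" using Seq.prems(1) by simp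
  note code = code_at_appendD[OF 1]
  obtain t1 r1 where 1: "t1 \<le> cost I a st" "trace prog I S B (p, r) t1 (p + length (comp_com p a), r1)"
    "repr (sem I a st) r1" "below R (sem I a st)"
    using Seq.IH(1)[OF code(1) _ _ Seq.prems(4,5,6) le(1)] Seq.prems by auto
  obtain t2 r2 where 2: "t2 \<le> cost I b (sem I a st)"
    "trace prog I S B (p + length (comp_com p a), r1) t2 (p + length (comp_com p a) + length (comp_com (p + length (comp_com p a)) b), r2)"
    "repr (sem I b (sem I a st)) r2" "below R (sem I b (sem I a st))"
    using Seq.IH(2)[OF code(2) _ _ 1(4,3) trace_bounded[OF 1(2), simplified] le(2)] Seq.prems by auto
  show ?case using trace_trans[OF 1(2) 2(2)] 1 2
    by (intro exI[of _ "t1 + t2"] exI[of _ r2]) (auto simp: add.assoc)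
next
  case (If e a b)
  have R: "2 \<le> R" using If by (simp add: inp_below_def)
  have le: "R ^ csize a \<le> B" "R ^ csize b \<le> B" "R ^ esize e \<le> B"
    using R by (auto intro: pow_le_trans[OF If.prems(7)])
  have "R ^ 1 \<le> B" using power_increasing[of 1 "esize e" R] R le by (auto simp: Suc_le_eq intro: order_trans)
  then have B: "0 < B" using R by simp
  define pa where "pa = p + elen e + 1"
  define ca where "ca = comp_com pa a"
  define q where "q = pa + length ca + 2"
  define cb where "cb = comp_com q b"
  have len: "length (comp_com p (If e a b)) = elen e + 1 + length ca + 2 + length cb"
    by (simp add: Let_def pa_def ca_def q_def cb_def)
  have 1: "code_at prog p (comp_exp 40 e @ [Jz 40 q] @ ca @ [Const 40 0, Jz 40 (q + length cb)] @ cb)"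
    using If.prems(1) by (simp add: Let_def pa_def ca_def q_def cb_def)
  note 2 = code_at_appendD[OF 1] note 3 = code_at_appendD[OF 2(2)] note 4 = code_at_appendD[OF 3(2)]
  note 5 = code_at_appendD[OF 4(2)]
  have code: "code_at prog p (comp_exp 40 e)" "code_at prog (p + elen e) [Jz 40 q]" "code_at prog pa ca"
    "code_at prog (pa + length ca) [Const 40 0]" "code_at prog (Suc (pa + length ca)) [Jz 40 (q + length cb)]"
    "code_at prog q cb"
    using 2(1) 3(1) 4(1) 5 by (simp_all add: pa_def q_def code_at_Cons[of _ _ _ "[_]"])
  obtain r1 where r1: "trace prog I S B (p, r) (elen e) (p + elen e, r1)" "r1 40 = val I e st"
    "\<forall>j. j < 40 \<or> 60 \<le> j \<longrightarrow> r1 j = r j"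
    using comp_exp_correct[OF code(1) If.prems(5,6) _ _ _ _ If.prems(4) le(3) If.prems(8,9)] If.prems by auto
  have b1: "\<forall>j. r1 j < B" using trace_bounded[OF r1(1)] by simp
  have rp1: "repr st r1" using r1(3) If.prems(5) by (auto intro: repr_cong)
  have S: "40 < S" using If.prems by simp
  show ?case
  proof (cases "val I e st = 0")
    case True
    have j: "trace prog I S B (p + elen e, r1) (Suc 0) (q, r1)"
      using True r1 b1 S by (intro trace_instr[OF code(2)]) auto
    obtain t2 r2 where 2: "t2 \<le> cost I b st" "trace prog I S B (q, r1) t2 (q + length cb, r2)"
      "repr (sem I b st) r2" "below R (sem I b st)"
      using If.IH(2)[OF code(6)[unfolded cb_def] _ _ If.prems(4) rp1 b1 le(2)] If.prems True by (auto simp: cb_def)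
    show ?thesis using trace_trans[OF r1(1) trace_trans[OF j 2(2)]] 2 True
      unfolding len
      by (intro exI[of _ "elen e + (Suc 0 + t2)"] exI[of _ r2]) (auto simp: q_def pa_def add_ac)
  next
    case False
    have j: "trace prog I S B (p + elen e, r1) (Suc 0) (pa, r1)"
      using False r1 b1 S by (intro trace_instr[OF code(2)]) (auto simp: pa_def)
    obtain t2 r2 where 2: "t2 \<le> cost I a st" "trace prog I S B (pa, r1) t2 (pa + length ca, r2)"
      "repr (sem I a st) r2" "below R (sem I a st)"
      using If.IH(1)[OF code(3)[unfolded ca_def] _ _ If.prems(4) rp1 b1 le(1)] If.prems False by (auto simp: ca_def)
    have b2: "\<forall>j. r2 j < B" using trace_bounded[OF 2(2)] by simp
    have j2: "trace prog I S B (pa + length ca, r2) (Suc (Suc 0)) (q + length cb, r2(40 := 0))"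
      by (intro trace_instr_Cons[OF code(4), where r' = "r2(40 := 0)" and p' = "Suc (pa + length ca)"]
          trace_instr[OF code(5)])
        (use b2 S B in auto)
    have "repr (sem I a st) (r2(40 := 0))" using 2(3) by (auto intro: repr_cong)
    then show ?thesis using trace_trans[OF r1(1) trace_trans[OF j trace_trans[OF 2(2) j2]]] 2 False
      unfolding len
      by (intro exI[of _ "elen e + (Suc 0 + (t2 + Suc (Suc 0)))"] exI[of _ "r2(40 := 0)"])
        (auto simp: q_def pa_def add_ac fun_upd_def)
  qed
next
  case (For x y e c)
  have R: "2 \<le> R" using For by (simp add: inp_below_def)
  have le: "R ^ csize c \<le> B" "R ^ esize e \<le> B"
    using R by (auto intro: pow_le_trans[OF For.prems(7)])
  have RB: "R ^ 1 \<le> B" using power_increasing[of 1 "esize e" R] R le by (auto simp: Suc_le_eq intro: order_trans)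
  have xy: "x < 40" "y < 40" "x \<noteq> y" "x \<notin> vars c" "y \<notin> vars c" using For.prems by auto
  define ph where "ph = p + elen e + 3"
  define cb where "cb = comp_com (ph + 2) c"
  define pe where "pe = ph + 2 + length cb + 4"
  define n where "n = val I e st"
  define F where "F = (\<lambda>st'. setv x (Suc (fst st' x)) (sem I c st'))"
  define st' where "st' i = (F ^^ i) (setv x 0 (setv y n st))" for i
  have len: "length (comp_com p (For x y e c)) = elen e + 3 + 2 + length cb + 4"
    by (simp add: Let_def ph_def cb_def)
  have 1: "code_at prog p (comp_exp 40 e @ [Const 41 0, Arith OAdd y 40 41] @ [Const x 0] @ [Arith OSub 40 y x] @ [Jz 40 pe]
     @ cb @ [Const 40 1] @ [Arith OAdd x x 40] @ [Const 40 0] @ [Jz 40 ph])"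
    using For.prems(1) by (simp add: Let_def ph_def cb_def pe_def)
  note 2 = code_at_appendD[OF 1] note 3 = code_at_appendD[OF 2(2)] note 4 = code_at_appendD[OF 3(2)]
  note 5 = code_at_appendD[OF 4(2)] note 6 = code_at_appendD[OF 5(2)] note 7 = code_at_appendD[OF 6(2)]
  note 8 = code_at_appendD[OF 7(2)] note 9 = code_at_appendD[OF 8(2)] note 10 = code_at_appendD[OF 9(2)]
  have code: "code_at prog p (comp_exp 40 e)" "code_at prog (p + elen e) [Const 41 0, Arith OAdd y 40 41]"
    "code_at prog (p + elen e + 2) [Const x 0]" "code_at prog ph [Arith OSub 40 y x]"
    "code_at prog (Suc ph) [Jz 40 pe]" "code_at prog (ph + 2) cb"
    "code_at prog (ph + 2 + length cb) [Const 40 1]" "code_at prog (Suc (ph + 2 + length cb)) [Arith OAdd x x 40]"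
    "code_at prog (Suc (Suc (ph + 2 + length cb))) [Const 40 0]" "code_at prog (Suc (Suc (Suc (ph + 2 + length cb)))) [Jz 40 ph]"
    using 2(1) 3(1) 4(1) 5(1) 6(1) 7(1) 8(1) 9(1) 10 by (simp_all add: ph_def eval_nat_numeral)
  have S: "60 \<le> S" using For.prems by simp
  have nR: "n < R" using For.prems by (simp add: n_def)
  obtain r1 where r1: "trace prog I S B (p, r) (elen e) (p + elen e, r1)" "r1 40 = n"
    "\<forall>j. j < 40 \<or> 60 \<le> j \<longrightarrow> r1 j = r j"
    using comp_exp_correct[OF code(1) For.prems(5,6) _ _ _ _ For.prems(4) le(2) For.prems(8,9)] For.prems
    by (auto simp: n_def)
  have b1: "\<forall>j. r1 j < B" using trace_bounded[OF r1(1)] by simp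
  define r2 where "r2 = r1(41 := 0, y := r1 40)"
  have t2: "trace prog I S B (p + elen e, r1) (Suc (Suc 0)) (p + elen e + 2, r2)"
    using trace_move[OF code(2) b1 xy(2) S] by (simp add: r2_def)
  have b2: "\<forall>j. r2 j < B" using trace_bounded[OF t2] by simp
  define r3 where "r3 = r2(x := 0)"
  have t3: "trace prog I S B (p + elen e + 2, r2) (Suc 0) (ph, r3)"
    using b2 S xy RB R by (intro trace_instr[OF code(3)]) (auto simp: ph_def r3_def)
  have rp3: "repr (st' 0) (r3)"
    using For.prems(5) r1 xy by (auto simp: repr_def r2_def r3_def st'_def)
  have okc: "ok I R M c (st' i)" if "i < n" for i
    using For.prems(3) that by (simp add: st'_def n_def F_def)
  \<comment> \<open>After i rounds control is back at the loop test \<open>ph\<close>, with the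
    counter at i and the saved bound unchanged; the exit test is handled only once, after this
    induction.\<close>
  have it: "\<exists>t r'. t \<le> (\<Sum>j<i. 6 + cost I c (st' j)) \<and> trace prog I S B (ph, r3) t (ph, r') \<and>
      repr (st' i) r' \<and> below R (st' i) \<and> fst (st' i) x = i \<and> fst (st' i) y = n" if "i \<le> n" for i
    using that
  proof (induction i)
    case 0
    have "below R (st' 0)" using For.prems(4) nR by (auto simp: st'_def below_def)
    then show ?case using rp3 xy trace_bounded[OF t3]
      by (intro exI[of _ 0] exI[of _ r3]) (auto intro: trace.stop simp: st'_def)
  next
    case (Suc i)
    then obtain t r' where IH: "t \<le> (\<Sum>j<i. 6 + cost I c (st' j))" "trace prog I S B (ph, r3) t (ph, r')"
      "repr (st' i) r'" "below R (st' i)" "fst (st' i) x = i" "fst (st' i) y = n" by auto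
    have b': "\<forall>j. r' j < B" using trace_bounded[OF IH(2)] by simp
    have r'xy: "r' x = i" "r' y = n" using IH xy by (auto simp: repr_def)
    have j1: "trace prog I S B (ph, r') (Suc (Suc 0)) (ph + 2, r'(40 := n - i))"
      using b' S xy r'xy Suc.prems nR RB
      by (intro trace_instr_Cons[OF code(4), where r' = "r'(40 := n - i)" and p' = "Suc ph"]
          trace_instr[OF code(5)]) auto
    have bb: "\<forall>j. (r'(40 := n - i)) j < B" using trace_bounded[OF j1] by simp
    have "repr (st' i) (r'(40 := n - i))" using IH(3) by (auto intro: repr_cong)
    then obtain t4 r4 where 4: "t4 \<le> cost I c (st' i)"
      "trace prog I S B (ph + 2, r'(40 := n - i)) t4 (ph + 2 + length cb, r4)"
      "repr (sem I c (st' i)) r4" "below R (sem I c (st' i))"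
      using For.IH[OF code(6)[unfolded cb_def] _ okc IH(4) _ bb le(1) For.prems(8,9)] For.prems(2) Suc.prems
      by (auto simp: cb_def fun_upd_def)
    \<comment> \<open>The frame property transfers the counter and the bound across the body, which
      reconciles the increment of the register after the body with the semantics that reads the
      counter before it.\<close>
    have ag: "fst (sem I c (st' i)) x = i" "fst (sem I c (st' i)) y = n"
      using agree_sem[of c "st' i" I] IH xy by (auto simp: agree_def)
    have b4: "\<forall>j. r4 j < B" using trace_bounded[OF 4(2)] by simp
    have r4x: "r4 x = i" using 4(3) xy ag by (simp add: repr_def)
    have SB: "Suc i < B" "Suc 0 < B" using Suc.prems nR RB R by auto
    define r5 where "r5 = r4(40 := 0, x := Suc i)"
    have b5: "\<forall>j. r5 j < B" using b4 SB by (auto simp: r5_def)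
    have j2: "trace prog I S B (ph + 2 + length cb, r4) (Suc (Suc (Suc (Suc 0)))) (ph, r5)"
      by (intro trace_instr_Cons[OF code(7), where p' = "Suc (ph + 2 + length cb)" and r' = "r4(40 := 1)"]
          trace_instr_Cons[OF code(8), where p' = "Suc (Suc (ph + 2 + length cb))" and r' = "r4(40 := 1, x := Suc i)"]
          trace_instr_Cons[OF code(9), where p' = "Suc (Suc (Suc (ph + 2 + length cb)))" and r' = r5]
          trace_instr[OF code(10)])
        (use b4 SB S xy r4x b5 in \<open>auto simp: r5_def fun_eq_iff\<close>)
    have st'S: "st' (Suc i) = setv x (Suc i) (sem I c (st' i))" using IH by (simp add: st'_def F_def)
    have "repr (st' (Suc i)) r5" using 4(3) xy by (auto simp: repr_def r5_def st'S)
    moreover have "below R (st' (Suc i))" using 4(4) Suc.prems nR by (auto simp: below_def st'S)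
    moreover have "fst (st' (Suc i)) x = Suc i" "fst (st' (Suc i)) y = n" using ag xy by (auto simp: st'S)
    moreover note trace_trans[OF IH(2) trace_trans[OF j1 trace_trans[OF 4(2) j2]]]
    ultimately show ?case using IH(1) 4(1)
      by (intro exI[of _ "t + (Suc (Suc 0) + (t4 + Suc (Suc (Suc (Suc 0)))))"] exI[of _ r5]) auto
  qed
  obtain t r' where E: "t \<le> (\<Sum>j<n. 6 + cost I c (st' j))" "trace prog I S B (ph, r3) t (ph, r')"
      "repr (st' n) r'" "below R (st' n)" "fst (st' n) x = n" "fst (st' n) y = n" using it[of n] by auto
  have b': "\<forall>j. r' j < B" using trace_bounded[OF E(2)] by simp
  have r'xy: "r' x = n" "r' y = n" using E xy by (auto simp: repr_def)
  have j: "trace prog I S B (ph, r') (Suc (Suc 0)) (pe, r'(40 := 0))"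
    using b' S xy r'xy RB R
    by (intro trace_instr_Cons[OF code(4), where r' = "r'(40 := 0)" and p' = "Suc ph"]
        trace_instr[OF code(5)]) auto
  have "repr (st' n) (r'(40 := 0))" using E(3) by (auto intro: repr_cong)
  moreover have "sem I (For x y e c) st = st' n" by (simp add: st'_def n_def F_def)
  moreover have "cost I (For x y e c) st = elen e + 5 + (\<Sum>j<n. 6 + cost I c (st' j))"
    by (simp add: st'_def n_def F_def)
  moreover note trace_trans[OF r1(1) trace_trans[OF t2 trace_trans[OF t3 trace_trans[OF E(2) j]]]]
  moreover have "p + length (comp_com p (For x y e c)) = pe" unfolding len by (simp add: pe_def ph_def)
  ultimately show ?case using E(1,4)
    by (intro exI[of _ "elen e + (Suc (Suc 0) + (Suc 0 + (t + Suc (Suc 0))))"] exI[of _ "r'(40 := 0)"]) (auto simp: fun_upd_def)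
qed

subsection \<open>Total correctness with running time\<close>

text \<open>A judgement about one given start state instead of a precondition. It can therefore
  occur inside the postcondition of another judgement, which is how sequential composition is
  expressed.\<close>

definition hoare :: "wpm_input \<Rightarrow> nat \<Rightarrow> nat \<Rightarrow> com \<Rightarrow> store \<Rightarrow> nat \<Rightarrow> (store \<Rightarrow> bool) \<Rightarrow> bool" where
  "hoare I R M c st t Q \<longleftrightarrow> ok I R M c st \<and> cost I c st \<le> t \<and> Q (sem I c st)"

lemma hoare_conseq:
  assumes "hoare I R M c st t Q" "t \<le> t'" "\<And>st'. Q st' \<Longrightarrow> agree (vars c) (arrs c) st st' \<Longrightarrow> Q' st'"
  shows "hoare I R M c st t' Q'"
  using assms agree_sem by (auto simp: hoare_def)

lemma hoare_Seq:
  assumes "hoare I R M a st ta (\<lambda>st'. hoare I R M b st' tb Q)" "ta + tb \<le> t"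
  shows "hoare I R M (Seq a b) st t Q"
  using assms by (auto simp: hoare_def)

text \<open>The body may use that everything outside the assigned variables and arrays still has its
  value from before the loop. \<open>Inv\<close> thus needs to speak only about what the loop
  changes, and configuration data are carried through by framing.\<close>

lemma hoare_For:
  assumes wf: "wf_com (For x y e c)" and n: "val I e st = n" "n < R" "idx_ok I M e st"
    and init: "Inv 0 (setv x 0 (setv y n st))"
    and body: "\<And>i st'. i < n \<Longrightarrow> fst st' x = i \<Longrightarrow> agree (vars (For x y e c)) (arrs c) st st' \<Longrightarrow> Inv i st' \<Longrightarrow>
      hoare I R M c st' t (\<lambda>st''. Inv (Suc i) (setv x (Suc i) st''))"
    and fin: "\<And>st'. fst st' x = n \<Longrightarrow> agree (vars (For x y e c)) (arrs c) st st' \<Longrightarrow> Inv n st' \<Longrightarrow> Q st'"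
    and T: "elen e + 5 + n * (t + 6) \<le> T"
  shows "hoare I R M (For x y e c) st T Q"
proof -
  define st' where "st' i = ((\<lambda>st'. setv x (Suc (fst st' x)) (sem I c st')) ^^ i) (setv x 0 (setv y n st))" for i
  have *: "fst (st' i) x = i \<and> agree (vars (For x y e c)) (arrs c) st (st' i) \<and> Inv i (st' i)" if "i \<le> n" for i
    using that
  proof (induction i)
    case 0
    then show ?case using init by (simp add: st'_def agree_def)
  next
    case (Suc i)
    then have IH: "fst (st' i) x = i" "agree (vars (For x y e c)) (arrs c) st (st' i)" "Inv i (st' i)" by auto
    have st'S: "st' (Suc i) = setv x (Suc i) (sem I c (st' i))" using IH by (simp add: st'_def)
    have "agree (vars c) (arrs c) (st' i) (sem I c (st' i))" by (rule agree_sem)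
    then show ?case
      using body[of i "st' i"] IH Suc.prems unfolding st'S hoare_def by (auto simp: agree_def)
  qed
  have "hoare I R M c (st' i) t (\<lambda>st''. Inv (Suc i) (setv x (Suc i) st''))" if "i < n" for i
    using body[of i "st' i"] *[of i] that by auto
  then have okc: "ok I R M c (st' i) \<and> cost I c (st' i) \<le> t" if "i < n" for i
    using that by (simp add: hoare_def)
  have "(\<Sum>i<n. 6 + cost I c (st' i)) \<le> (\<Sum>i<n. t + 6)"
    using okc by (intro sum_mono) auto
  then have "cost I (For x y e c) st \<le> T"
    using T n(1) by (simp add: st'_def)
  moreover have "ok I R M (For x y e c) st"
    using okc n by (simp add: st'_def)
  moreover have "Q (sem I (For x y e c) st)"
    using fin[of "st' n"] *[of n] n(1) by (simp add: st'_def)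
  ultimately show ?thesis by (simp add: hoare_def)
qed

lemma hoare_runs_within:
  assumes "hoare I R M c (\<lambda>_. 0, \<lambda>_ _. 0) t Q" "wf_com c" "inp_below I R" "R ^ csize c \<le> B"
  shows "\<exists>t' st'. t' \<le> t \<and> Q st' \<and> runs_within (comp_com 0 c) I t' (60 + 10 * M) B (fst st' 0)"
proof -
  let ?st = "(\<lambda>_. 0, \<lambda>_ _. 0) :: store"
  let ?S = "60 + 10 * M"
  have R: "2 \<le> R" using assms by (simp add: inp_below_def)
  have "R ^ 0 \<le> B" using pow_le_trans[OF assms(4) R, of 0] by simp
  then have B: "0 < B" by simp
  have c: "code_at (comp_com 0 c) 0 (comp_com 0 c)" by (simp add: code_at_def)
  have "below R ?st" using R by (simp add: below_def)
  moreover have "repr ?st (\<lambda>_. 0)" by (simp add: repr_def)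
  ultimately obtain t' r' where *: "t' \<le> cost I c ?st"
    "trace (comp_com 0 c) I ?S B (0, \<lambda>_. 0) t' (0 + length (comp_com 0 c), r')" "repr (sem I c ?st) r'"
    using comp_com_correct[OF c assms(2) _ _ _ _ assms(4,3)] assms(1) B unfolding hoare_def by blast
  have "fst (sem I c ?st) 0 = r' 0" using *(3) by (simp add: repr_def)
  then have "runs_within (comp_com 0 c) I t' ?S B (fst (sem I c ?st) 0)"
    using trace_step_at[OF *(2)] unfolding runs_within_def conf_at_def init_conf_def
    by (auto simp: halted_def)
  then show ?thesis using assms(1) *(1) unfolding hoare_def by (meson order_trans)
qed

subsection \<open>A constant-geometry fast Fourier transform\<close>

text \<open>A self-sorting transform: each stage writes its results in natural order, so no bit
  reversal is needed. The exponent \<open>q\<close> ranges over a full period; for a primitive root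
  the minus sign of the usual butterfly is contained in w^q, and one formula serves all
  positions.\<close>

fun fft :: "nat \<Rightarrow> complex \<Rightarrow> (nat \<Rightarrow> complex) \<Rightarrow> nat \<Rightarrow> nat \<Rightarrow> complex" where
  "fft N w x 0 i = x i"
| "fft N w x (Suc h) i =
     (let M = N div 2 ^ Suc h; r = i mod M; q = i - r
      in fft N w x h (2 * q mod N + r) + w ^ q * fft N w x h (2 * q mod N + r + M))"

lemma power_mod_root:
  fixes w :: complex
  assumes "w ^ N = 1"
  shows "w ^ (a mod N) = w ^ a"
proof -
  have "w ^ a = w ^ (N * (a div N) + a mod N)" by simp
  also have "\<dots> = w ^ (a mod N)" unfolding power_add power_mult assms by simp
  finally show ?thesis by simp
qed

lemma sum_even_odd: "(\<Sum>j<2 * n. f j) = (\<Sum>j<n. f (2 * j)) + (\<Sum>j<n. f (2 * j + 1))"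
  for f :: "nat \<Rightarrow> 'a::comm_monoid_add"
  by (induction n) (auto simp: ac_simps)

text \<open>The invariant behind the stages: position k 2^(K - h) + r holds the coefficient of
  frequency k of the transform of length 2^h of the inputs whose index is r modulo 2^(K - h).
  Splitting j by parity separates the residue r of the coarser class into r and r + M of the finer
  one.\<close>

lemma fft_eq_sum:
  assumes w: "w ^ (2 ^ K) = 1" and "h \<le> K" "r < 2 ^ (K - h)" "k < 2 ^ h"
  shows "fft (2 ^ K) w x h (k * 2 ^ (K - h) + r) =
    (\<Sum>j<2 ^ h. x (r + j * 2 ^ (K - h)) * w ^ (j * k * 2 ^ (K - h)))"
  using assms(2-)
proof (induction h arbitrary: r k)
  case 0
  then show ?case by simp
next
  case (Suc h)
  define M where "M = (2::nat) ^ (K - Suc h)"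
  have e: "K - h = Suc (K - Suc h)" "K = (K - Suc h) + Suc h" using Suc.prems by auto
  have M2: "2 ^ (K - h) = 2 * M" unfolding e(1) M_def by simp
  have KM: "2 ^ K = M * 2 ^ Suc h" unfolding M_def power_add[symmetric] using e(2) by metis
  have div: "2 ^ K div 2 ^ Suc h = M" unfolding KM by simp
  have r: "r < M" using Suc.prems by (simp add: M_def)
  have i: "(k * M + r) mod M = r" "k * M + r - r = k * M" using r by auto
  \<comment> \<open>The half-length transforms have period 2^h in the frequency, which is why the
    read position may be reduced modulo 2^K.\<close>
  define k' where "k' = k mod 2 ^ h"
  have q: "2 * (k * M) mod 2 ^ K = k' * (2 * M)"
    unfolding KM k'_def by (simp add: mult_mod_left mult.assoc mult.left_commute mult.commute)
  have k': "k' < 2 ^ h" by (simp add: k'_def)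
  have w': "w ^ (j * k' * (2 * M)) = w ^ (j * k * (2 * M))" for j
  proof -
    have "(j * k' * (2 * M)) mod 2 ^ K = (j * k * (2 * M)) mod 2 ^ K"
    proof -
      have "(j * k' * (2 * M)) mod (2 ^ h * (2 * M)) = (j * k' mod 2 ^ h) * (2 * M)"
        by (rule mod_mult_mult2)
      also have "\<dots> = (j * k mod 2 ^ h) * (2 * M)" by (simp add: k'_def mod_mult_right_eq)
      also have "\<dots> = (j * k * (2 * M)) mod (2 ^ h * (2 * M))" by (rule mod_mult_mult2[symmetric])
      also have "2 ^ h * (2 * M) = 2 ^ K" unfolding KM by simp
      finally show ?thesis .
    qed
    then show ?thesis using power_mod_root[OF w] by metis
  qed
  have "fft (2 ^ K) w x (Suc h) (k * M + r) =
      fft (2 ^ K) w x h (k' * (2 * M) + r) + w ^ (k * M) * fft (2 ^ K) w x h (k' * (2 * M) + (r + M))"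
    unfolding fft.simps Let_def div i q by (simp add: add.assoc)
  also have "fft (2 ^ K) w x h (k' * (2 * M) + r) =
      (\<Sum>j<2 ^ h. x (r + j * (2 * M)) * w ^ (j * k * (2 * M)))"
    using Suc.IH[of r k'] k' r Suc.prems by (simp add: M2 w')
  also have "fft (2 ^ K) w x h (k' * (2 * M) + (r + M)) =
      (\<Sum>j<2 ^ h. x (r + M + j * (2 * M)) * w ^ (j * k * (2 * M)))"
    using Suc.IH[of "r + M" k'] k' r Suc.prems by (simp add: M2 w')
  also have "w ^ (k * M) * (\<Sum>j<2 ^ h. x (r + M + j * (2 * M)) * w ^ (j * k * (2 * M))) =
      (\<Sum>j<2 ^ h. x (r + (2 * j + 1) * M) * w ^ ((2 * j + 1) * k * M))"
    unfolding sum_distrib_left by (intro sum.cong) (auto simp: power_add algebra_simps)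
  also have "(\<Sum>j<2 ^ h. x (r + j * (2 * M)) * w ^ (j * k * (2 * M))) =
      (\<Sum>j<2 ^ h. x (r + (2 * j) * M) * w ^ ((2 * j) * k * M))"
    by (intro sum.cong) (auto simp: algebra_simps)
  finally show ?case
    unfolding M_def[symmetric] power_Suc sum_even_odd .
qed

lemma fft_eq_dft:
  assumes "w ^ (2 ^ K) = 1" "k < 2 ^ K"
  shows "fft (2 ^ K) w x K k = (\<Sum>j<2 ^ K. x j * w ^ (j * k))"
  using fft_eq_sum[OF assms(1), of K 0 k x] assms(2) by simp

lemma fft_index:
  fixes i :: nat
  assumes "h < K" "i < 2 ^ K"
  defines "M \<equiv> (2::nat) ^ K div 2 ^ Suc h"
  shows "2 * (i - i mod M) mod 2 ^ K + i mod M + M < 2 ^ K"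
proof -
  have e: "K = (K - Suc h) + Suc h" using assms by auto
  have "(2::nat) ^ K = 2 ^ (K - Suc h) * 2 ^ Suc h" unfolding power_add[symmetric] using e by metis
  then have KM: "2 ^ K = M * 2 ^ Suc h" and M: "0 < M" unfolding M_def by auto
  have "i - i mod M = (i div M) * M" by (simp add: minus_mod_eq_div_mult)
  then have "2 * (i - i mod M) mod 2 ^ K = (i div M * (2 * M)) mod (2 ^ h * (2 * M))"
    unfolding KM by (simp add: ac_simps)
  also have "\<dots> = (i div M mod 2 ^ h) * (2 * M)" by (rule mod_mult_mult2)
  finally have *: "2 * (i - i mod M) mod 2 ^ K = (i div M mod 2 ^ h) * (2 * M)" .
  have "i div M mod 2 ^ h + 1 \<le> 2 ^ h" by (simp add: Suc_le_eq)
  then have "(i div M mod 2 ^ h + 1) * (2 * M) \<le> 2 ^ h * (2 * M)" by (rule mult_right_mono) simp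
  also have "\<dots> = 2 ^ K" unfolding KM by simp
  finally have "2 * (i - i mod M) mod 2 ^ K + 2 * M \<le> 2 ^ K" unfolding * by simp
  moreover have "i mod M < M" using M by simp
  ultimately show ?thesis by linarith
qed

lemma fft_norm_le:
  assumes "cmod w = 1" "\<And>i. i < 2 ^ K \<Longrightarrow> cmod (x i) \<le> X" "h \<le> K" "i < 2 ^ K"
  shows "cmod (fft (2 ^ K) w x h i) \<le> 2 ^ h * X"
  using assms(3-)
proof (induction h arbitrary: i)
  case 0
  then show ?case using assms by simp
next
  case (Suc h)
  define M where "M = (2::nat) ^ K div 2 ^ Suc h"
  define r where "r = i mod M"
  define q where "q = i - r"
  have "2 * q mod 2 ^ K + r + M < 2 ^ K"
    using fft_index[of h K i] Suc.prems by (simp add: M_def r_def q_def)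
  then have "cmod (fft (2 ^ K) w x h (2 * q mod 2 ^ K + r)) \<le> 2 ^ h * X"
    "cmod (fft (2 ^ K) w x h (2 * q mod 2 ^ K + r + M)) \<le> 2 ^ h * X"
    using Suc.IH Suc.prems by auto
  moreover have "fft (2 ^ K) w x (Suc h) i = fft (2 ^ K) w x h (2 * q mod 2 ^ K + r) +
      w ^ q * fft (2 ^ K) w x h (2 * q mod 2 ^ K + r + M)"
    unfolding fft.simps Let_def M_def r_def q_def by simp
  ultimately show ?case
    using norm_triangle_ineq[of "fft (2 ^ K) w x h (2 * q mod 2 ^ K + r)"
        "w ^ q * fft (2 ^ K) w x h (2 * q mod 2 ^ K + r + M)"] assms(1)
    by (simp add: norm_mult norm_power)
qed

text \<open>The factor 3 is 1 + 2: the first operand passes its error on unchanged, the second is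
  multiplied by an approximate twiddle factor of modulus at most 1 + \<delta> <= 2. The error of the
  twiddle factor itself meets the exact value, of modulus at most 2^K X.\<close>

lemma fft_step_error:
  assumes w: "cmod w = 1" and x: "\<And>i. i < 2 ^ K \<Longrightarrow> cmod (x i) \<le> X"
    and g: "\<And>i. i < 2 ^ K \<Longrightarrow> cmod (g i - fft (2 ^ K) w x h i) \<le> E"
    and W: "\<And>i. i < 2 ^ K \<Longrightarrow> cmod (W i - w ^ i) \<le> \<delta>" "\<delta> \<le> 1"
    and h: "h < K" "i < 2 ^ K"
  defines "M \<equiv> (2::nat) ^ K div 2 ^ Suc h"
  defines "r \<equiv> i mod M"
  defines "q \<equiv> i - r"
  shows "cmod (g (2 * q mod 2 ^ K + r) + W q * g (2 * q mod 2 ^ K + r + M) -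
    fft (2 ^ K) w x (Suc h) i) \<le> 3 * E + \<delta> * 2 ^ K * X"
proof -
  let ?a = "2 * q mod 2 ^ K + r" and ?b = "2 * q mod 2 ^ K + r + M"
  let ?f = "fft (2 ^ K) w x h"
  have b: "?b < 2 ^ K" using fft_index[OF h] by (simp add: M_def r_def q_def)
  then have a: "?a < 2 ^ K" by simp
  have q: "q < 2 ^ K" using h by (simp add: q_def)
  have E: "0 \<le> E" by (rule order_trans[OF norm_ge_zero g[OF b]])
  have d: "0 \<le> \<delta>" by (rule order_trans[OF norm_ge_zero W(1)[OF q]])
  have X: "0 \<le> X" by (rule order_trans[OF norm_ge_zero x[OF b]])
  have fb: "cmod (?f ?b) \<le> 2 ^ K * X"
  proof -
    have "cmod (?f ?b) \<le> 2 ^ h * X" using fft_norm_le[OF w x] h b by simp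
    also have "\<dots> \<le> 2 ^ K * X" using X h by (intro mult_right_mono power_increasing) auto
    finally show ?thesis .
  qed
  have "cmod (W q) \<le> cmod (W q - w ^ q) + cmod (w ^ q)" using norm_triangle_ineq[of "W q - w ^ q" "w ^ q"] by simp
  also have "\<dots> \<le> 2" using W(1)[OF q] W(2) w by (simp add: norm_power)
  finally have Wq: "cmod (W q) \<le> 2" .
  have "g ?a + W q * g ?b - fft (2 ^ K) w x (Suc h) i =
     (g ?a - ?f ?a) + (W q * (g ?b - ?f ?b) + (W q - w ^ q) * ?f ?b)"
    unfolding fft.simps Let_def M_def[symmetric] r_def[symmetric] q_def[symmetric]
    by (simp add: algebra_simps)
  also have "cmod \<dots> \<le> E + (2 * E + \<delta> * (2 ^ K * X))"
    using g[OF a] g[OF b] W(1)[OF q] Wq fb E d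
    by (intro norm_triangle_mono) (auto simp: norm_mult intro!: mult_mono)
  finally show ?thesis by (simp add: mult.assoc)
qed

subsection \<open>Cyclic correlation\<close>

definition unity_root :: "nat \<Rightarrow> complex" where
  "unity_root N = cis (2 * pi / real N)"

lemma norm_unity_root [simp]: "cmod (unity_root N) = 1"
  by (simp add: unity_root_def)

lemma unity_root_power: "unity_root N ^ k = cis (2 * pi * real k / real N)"
  by (simp add: unity_root_def DeMoivre mult.commute)

lemma unity_root_power_N: "0 < N \<Longrightarrow> unity_root N ^ N = 1"
  by (simp add: unity_root_power)

lemma unity_root_inj:
  assumes "0 < N" "a < N" "b < N" "unity_root N ^ a = unity_root N ^ b"
  shows "a = b"
proof -
  have "inj_on (\<lambda>k. cis (2 * pi * real k / real N)) {..<N}"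
    using bij_betw_roots_unity[OF assms(1)] by (rule bij_betw_imp_inj_on)
  then show ?thesis using assms by (auto simp: unity_root_power inj_on_def)
qed

lemma sum_root_powers:
  fixes z :: complex
  assumes "z ^ N = 1"
  shows "(\<Sum>k<N. z ^ k) = (if z = 1 then of_nat N else 0)"
  using geometric_sum[of z N] assms by auto

text \<open>Reading the first transform at the index -k modulo N supplies the inverse powers of w.
  All three transforms can then use the same root and the same code, and orthogonality leaves only a
  = b + u modulo N. The factor N is removed later, when rounding.\<close>

lemma correlation:
  assumes N: "0 < N"
  defines "w \<equiv> unity_root N"
  shows "(\<Sum>k<N. ((\<Sum>a<N. t a * w ^ (a * ((N - k) mod N))) * (\<Sum>b<N. p b * w ^ (b * k))) * w ^ (k * u)) =
    of_nat N * (\<Sum>b<N. p b * t ((b + u) mod N))"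
proof -
  have wN: "w ^ N = 1" using unity_root_power_N[OF N] by (simp add: w_def)
  have w0: "w \<noteq> 0" using norm_unity_root[of N] by (metis norm_zero w_def zero_neq_one)
  have inv: "w ^ (a * ((N - k) mod N)) = inverse (w ^ a) ^ k" if "k < N" for a k
  proof -
    have "w ^ (a * ((N - k) mod N)) = (w ^ ((N - k) mod N)) ^ a" by (simp add: power_mult[symmetric] mult.commute)
    also have "w ^ ((N - k) mod N) = w ^ (N - k)" by (rule power_mod_root[OF wN])
    also have "w ^ (N - k) = inverse (w ^ k)"
      using that w0 wN by (simp add: power_diff divide_inverse)
    finally show ?thesis
      by (simp add: power_inverse power_mult[symmetric] mult.commute)
  qed
  have "(\<Sum>k<N. ((\<Sum>a<N. t a * w ^ (a * ((N - k) mod N))) * (\<Sum>b<N. p b * w ^ (b * k))) * w ^ (k * u)) =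
     (\<Sum>k<N. \<Sum>a<N. \<Sum>b<N. t a * p b * (w ^ (b + u) / w ^ a) ^ k)"
    unfolding sum_product unfolding sum_distrib_right
    by (intro sum.cong refl)
      (simp add: inv power_add power_mult_distrib divide_inverse power_mult[symmetric] mult_ac)
  also have "\<dots> = (\<Sum>b<N. \<Sum>a<N. t a * p b * (\<Sum>k<N. (w ^ (b + u) / w ^ a) ^ k))"
    unfolding sum_distrib_left by (subst sum.swap, subst (2) sum.swap, subst sum.swap) simp
  also have "\<dots> = (\<Sum>b<N. \<Sum>a<N. if a = (b + u) mod N then t a * p b * of_nat N else 0)"
  proof (intro sum.cong refl)
    fix b a assume "b \<in> {..<N}" "a \<in> {..<N}"
    have "(w ^ (b + u) / w ^ a) ^ N = 1"
      using wN by (metis div_by_1 power_divide power_mult mult.commute power_one)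
    moreover have "w ^ (b + u) / w ^ a = 1 \<longleftrightarrow> a = (b + u) mod N"
    proof -
      have "w ^ (b + u) / w ^ a = 1 \<longleftrightarrow> w ^ ((b + u) mod N) = w ^ a"
        using w0 by (simp add: power_mod_root[OF wN])
      also have "\<dots> \<longleftrightarrow> a = (b + u) mod N"
        using unity_root_inj[OF N] \<open>a \<in> {..<N}\<close> N by (auto simp: w_def)
      finally show ?thesis .
    qed
    ultimately show "t a * p b * (\<Sum>k<N. (w ^ (b + u) / w ^ a) ^ k) =
        (if a = (b + u) mod N then t a * p b * of_nat N else 0)"
      by (simp add: sum_root_powers)
  qed
  also have "\<dots> = (\<Sum>b<N. t ((b + u) mod N) * p b * of_nat N)"
    using N by (intro sum.cong refl) (simp add: sum.delta)
  also have "\<dots> = of_nat N * (\<Sum>b<N. p b * t ((b + u) mod N))"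
    by (simp add: sum_distrib_left mult_ac)
  finally show ?thesis .
qed

subsection \<open>Fixed-point complex numbers\<close>

text \<open>The pair (a, b) of naturals encodes ((a - Z) + (b - Z) i) / D; the offset Z makes room
  for negative components.\<close>

definition cv :: "nat \<Rightarrow> nat \<Rightarrow> nat \<Rightarrow> nat \<Rightarrow> complex" where
  "cv D Z a b = Complex ((real a - real Z) / real D) ((real b - real Z) / real D)"

lemma cv_Re: "Re (cv D Z a b) = (real a - real Z) / real D"
  and cv_Im: "Im (cv D Z a b) = (real b - real Z) / real D"
  by (simp_all add: cv_def)

lemma cv_int: "0 < D \<Longrightarrow> cv D Z (Z + D * n) Z = of_nat n"
  by (simp add: cv_def complex_eq_iff)

lemma real_div_bounds:
  fixes x D :: nat
  assumes "0 < D"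
  shows "real (x div D) \<le> real x / real D" "real x / real D < real (x div D) + 1"
proof -
  have eq: "x = D * (x div D) + x mod D" by simp
  have m: "x mod D < D" using assms by simp
  have "real x = real D * real (x div D) + real (x mod D)"
    by (subst eq) (simp only: of_nat_add of_nat_mult)
  moreover have "0 \<le> real (x mod D)" "real (x mod D) < real D" using m by simp_all
  ultimately show "real (x div D) \<le> real x / real D" "real x / real D < real (x div D) + 1"
    using assms by (simp_all add: field_simps)
qed

text \<open>The assumed margin makes Z + D y at least 1, so the truncated subtraction is exact and
  the only loss is the floor of one division.\<close>

lemma floor_div_nat:
  fixes p q D Z :: nat and y :: real
  assumes "0 < D" "real p - real q = real D * (real Z + real D * y)" "\<bar>y\<bar> * real D + 1 \<le> real Z"
  shows "\<bar>(real ((p - q) div D) - real Z) / real D - y\<bar> \<le> 1 / real D" "(p - q) div D \<le> 2 * Z"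
proof -
  have Dy: "\<bar>real D * y\<bar> + 1 \<le> real Z" using assms(1,3) by (simp add: abs_mult mult.commute)
  then have "0 \<le> real Z + real D * y" by linarith
  then have "0 \<le> real p - real q" using assms(2) by simp
  then have "real (p - q) = real p - real q" by (simp add: of_nat_diff)
  then have eq: "real (p - q) / real D = real Z + real D * y" using assms by simp
  note b = real_div_bounds[OF assms(1), of "p - q", unfolded eq]
  have "\<bar>(real ((p - q) div D) - real Z) - real D * y\<bar> \<le> 1" using b by linarith
  moreover have "(real ((p - q) div D) - real Z) / real D - y = ((real ((p - q) div D) - real Z) - real D * y) / real D"
    using assms(1) by (simp add: field_simps)
  ultimately show "\<bar>(real ((p - q) div D) - real Z) / real D - y\<bar> \<le> 1 / real D"
    using assms(1) by (simp add: abs_divide divide_right_mono)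
  have "real ((p - q) div D) \<le> real (2 * Z)" using b Dy by auto
  then show "(p - q) div D \<le> 2 * Z" using of_nat_le_iff by blast
qed

text \<open>The encoded form of (a, b) + (c, d) (e, f), multiplied out with all negative terms
  collected in a single subtraction. The squares of Z cancel in the real part and add up to 2 Z Z in
  the imaginary part.\<close>

definition fre :: "nat \<Rightarrow> nat \<Rightarrow> nat \<Rightarrow> nat \<Rightarrow> nat \<Rightarrow> nat \<Rightarrow> nat \<Rightarrow> nat" where
  "fre D Z a c d e f = (D * a + c * e + Z * d + Z * f - (d * f + Z * c + Z * e)) div D"

definition fim :: "nat \<Rightarrow> nat \<Rightarrow> nat \<Rightarrow> nat \<Rightarrow> nat \<Rightarrow> nat \<Rightarrow> nat \<Rightarrow> nat" where
  "fim D Z b c d e f = (D * b + c * f + d * e + 2 * Z * Z - (Z * c + Z * f + Z * d + Z * e)) div D"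

text \<open>Addition and multiplication are fused into one rounding per component, so the error is 1
  / D for each of the two components. The assumption is only on the modulus of the exact
  result.\<close>

lemma fma_error:
  assumes D: "0 < D" and z: "z = cv D Z a b + cv D Z c d * cv D Z e f"
    and b: "cmod z * real D + 1 \<le> real Z"
  shows "cmod (cv D Z (fre D Z a c d e f) (fim D Z b c d e f) - z) \<le> 2 / real D"
    "fre D Z a c d e f \<le> 2 * Z" "fim D Z b c d e f \<le> 2 * Z"
proof -
  let ?r = "\<lambda>x. real x - real Z"
  have Re: "Re z = ?r a / D + (?r c / D * (?r e / D) - ?r d / D * (?r f / D))"
    and Im: "Im z = ?r b / D + (?r c / D * (?r f / D) + ?r d / D * (?r e / D))"
    unfolding z by (simp_all add: cv_Re cv_Im)
  have "\<bar>Re z\<bar> * real D + 1 \<le> real Z" "\<bar>Im z\<bar> * real D + 1 \<le> real Z"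
    using mult_right_mono[OF abs_Re_le_cmod, of "real D" z] mult_right_mono[OF abs_Im_le_cmod, of "real D" z] b
    by linarith+
  moreover have "real (D * a + c * e + Z * d + Z * f) - real (d * f + Z * c + Z * e) = real D * (real Z + real D * Re z)"
    unfolding Re using D by (simp add: field_simps)
  moreover have "real (D * b + c * f + d * e + 2 * Z * Z) - real (Z * c + Z * f + Z * d + Z * e) = real D * (real Z + real D * Im z)"
    unfolding Im using D by (simp add: field_simps)
  ultimately have 1: "\<bar>(real (fre D Z a c d e f) - real Z) / real D - Re z\<bar> \<le> 1 / real D" "fre D Z a c d e f \<le> 2 * Z"
    "\<bar>(real (fim D Z b c d e f) - real Z) / real D - Im z\<bar> \<le> 1 / real D" "fim D Z b c d e f \<le> 2 * Z"
    unfolding fre_def fim_def using floor_div_nat[OF D] by blast+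
  then show "fre D Z a c d e f \<le> 2 * Z" "fim D Z b c d e f \<le> 2 * Z" by simp_all
  have "cmod (cv D Z (fre D Z a c d e f) (fim D Z b c d e f) - z) \<le>
    \<bar>Re (cv D Z (fre D Z a c d e f) (fim D Z b c d e f) - z)\<bar> + \<bar>Im (cv D Z (fre D Z a c d e f) (fim D Z b c d e f) - z)\<bar>"
    by (rule cmod_le)
  then show "cmod (cv D Z (fre D Z a c d e f) (fim D Z b c d e f) - z) \<le> 2 / real D"
    using 1 by (simp add: cv_Re cv_Im)
qed

text \<open>Adding D (2 L), half of D N, turns the floor into rounding to the nearest multiple of N.
  These multiples are at least 4 apart, so an error of 1 is unambiguous. The same summand prevents
  the subtraction of Z from being truncated.\<close>

lemma round_real:
  fixes a D N L Z c :: nat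
  assumes "0 < D" "0 < L" "N = 4 * L" and v: "\<bar>(real a - real Z) / real D - real N * real c\<bar> \<le> 1"
  shows "(a + D * (2 * L) - Z) div (D * N) = c"
proof -
  have "\<bar>((real a - real Z) / real D - real N * real c) * real D\<bar> \<le> 1 * real D"
    unfolding abs_mult using v by (intro mult_mono) auto
  moreover have "((real a - real Z) / real D - real N * real c) * real D = real a - real Z - real (N * c * D)"
    using assms(1) by (simp add: field_simps)
  ultimately have 1: "\<bar>real a - real Z - real (N * c * D)\<bar> \<le> real D" by simp
  then have "Z + N * c * D \<le> a + D" "a \<le> Z + N * c * D + D" by linarith+
  moreover have "D \<le> D * L" "0 < D * L" using assms by simp_all
  moreover have "N * c * D = D * N * c" "D * N = 4 * (D * L)" "D * (2 * L) = 2 * (D * L)" using assms(3) by auto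
  ultimately have "D * N * c \<le> a + D * (2 * L) - Z" "a + D * (2 * L) - Z < D * N * c + D * N"
    by linarith+
  then show ?thesis
    by (intro div_nat_eqI) (auto simp: algebra_simps)
qed

subsection \<open>Approximate roots of unity\<close>

lemma isqrt_real:
  fixes r n D :: nat
  assumes "r ^ 2 \<le> n" "n < (r + 1) ^ 2"
  shows "real r \<le> sqrt (real n)" "sqrt (real n) < real r + 1"
proof -
  have "real (r ^ 2) \<le> real n" using assms(1) of_nat_le_iff by blast
  then show "real r \<le> sqrt (real n)" by (simp add: real_le_rsqrt)
  have "real n < real ((r + 1) ^ 2)" using assms(2) of_nat_less_iff by blast
  then show "sqrt (real n) < real r + 1" by (intro real_less_lsqrt) (auto simp: add.commute)
qed

text \<open>This bound by subadditivity remains valid near 0, where the derivative of the square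
  root is unbounded.\<close>

lemma abs_sqrt_diff_le:
  assumes "0 \<le> x" "0 \<le> y"
  shows "\<bar>sqrt x - sqrt y\<bar> \<le> sqrt \<bar>x - y\<bar>"
proof -
  have *: "sqrt a - sqrt b \<le> sqrt (a - b)" if "0 \<le> b" "b \<le> a" for a b :: real
    using sqrt_add_le_add_sqrt[of "a - b" b] that by simp
  show ?thesis
  proof (cases "x \<le> y")
    case True
    then show ?thesis using *[of x y] assms by (simp add: abs_if)
  next
    case False
    then show ?thesis using *[of y x] assms by (simp add: abs_if)
  qed
qed

text \<open>Halving is well conditioned: the difference of the roots is half the difference of the
  cosines, divided by a sum that is at least cos (\<theta> / 2) >= 1 / 2. So \<epsilon> is passed on
  with factor 1, and 2 / D is new: one unit from the division by 2 and one from the integer square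
  root.\<close>

lemma cos_half_step:
  fixes C D r :: nat
  assumes D: "0 < D" and C: "C \<le> D" and \<theta>: "0 \<le> \<theta>" "\<theta> \<le> pi / 2"
    and e: "\<bar>real C / real D - cos \<theta>\<bar> \<le> \<epsilon>"
    and r: "r ^ 2 \<le> D * (D + C) div 2" "D * (D + C) div 2 < (r + 1) ^ 2"
  shows "\<bar>real r / real D - cos (\<theta> / 2)\<bar> \<le> \<epsilon> + 2 / real D" "r \<le> D"
proof -
  have "D * (D + C) \<le> 2 * D ^ 2" using mult_le_mono2[OF C, of D] by (simp add: power2_eq_square algebra_simps)
  then have "D * (D + C) div 2 \<le> D ^ 2" by linarith
  then have "r ^ 2 \<le> D ^ 2" using r by linarith
  then show "r \<le> D" by simp
  let ?n = "D * (D + C) div 2"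
  define x where "x = (1 + real C / real D) / 2"
  have x0: "0 \<le> x" by (simp add: x_def)
  have Dx: "real D * sqrt x = sqrt (real (D * (D + C)) / 2)"
  proof -
    have "real (D * (D + C)) / 2 = (real D)\<^sup>2 * x" using D by (simp add: x_def field_simps power2_eq_square)
    then show ?thesis by (simp add: real_sqrt_mult)
  qed
  have "real ?n \<le> real (D * (D + C)) / 2" "real (D * (D + C)) / 2 \<le> real ?n + 1"
    using real_div_bounds[of 2 "D * (D + C)"] by auto
  then have "sqrt (real ?n) \<le> real D * sqrt x" "real D * sqrt x \<le> sqrt (real ?n + 1)"
    unfolding Dx by (intro real_sqrt_le_mono; simp)+
  then have s1: "sqrt (real ?n) \<le> real D * sqrt x" "real D * sqrt x \<le> sqrt (real ?n) + 1"
    using sqrt_add_le_add_sqrt[of "real ?n" 1] by simp_all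
  note s2 = isqrt_real[OF r]
  have "\<bar>real r - real D * sqrt x\<bar> \<le> 2" using s1 s2 by linarith
  then have "\<bar>(real r - real D * sqrt x) / real D\<bar> \<le> 2 / real D"
    using D by (simp add: abs_divide divide_right_mono)
  then have 1: "\<bar>real r / real D - sqrt x\<bar> \<le> 2 / real D" using D by (simp add: diff_divide_distrib)
  have c0: "0 \<le> cos \<theta>" using \<theta> by (intro cos_ge_zero) auto
  have ch: "sqrt (1 / 2) \<le> cos (\<theta> / 2)" "cos (\<theta> / 2) ^ 2 = (1 + cos \<theta>) / 2"
  proof -
    have "cos \<theta> = 2 * cos (\<theta> / 2) ^ 2 - 1" using cos_double_cos[of "\<theta> / 2"] by simp
    then show *: "cos (\<theta> / 2) ^ 2 = (1 + cos \<theta>) / 2" by simp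
    have "0 \<le> cos (\<theta> / 2)" using \<theta> by (intro cos_ge_zero) auto
    then show "sqrt (1 / 2) \<le> cos (\<theta> / 2)"
      using c0 * by (intro real_le_lsqrt) auto
  qed
  have half: "1 / 2 \<le> sqrt (1 / 2 :: real)" by (intro real_le_rsqrt) (simp add: power2_eq_square)
  have "(sqrt x - cos (\<theta> / 2)) * (sqrt x + cos (\<theta> / 2)) = x - cos (\<theta> / 2) ^ 2"
    using x0 by (simp add: algebra_simps power2_eq_square)
  also have "\<dots> = (real C / real D - cos \<theta>) / 2" by (simp add: ch x_def field_simps)
  finally have eq: "\<bar>sqrt x - cos (\<theta> / 2)\<bar> * \<bar>sqrt x + cos (\<theta> / 2)\<bar> = \<bar>real C / real D - cos \<theta>\<bar> / 2"
    by (simp add: abs_mult[symmetric])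
  have "1 / 2 \<le> \<bar>sqrt x + cos (\<theta> / 2)\<bar>" using ch(1) half real_sqrt_ge_zero[OF x0] by linarith
  then have "\<bar>sqrt x - cos (\<theta> / 2)\<bar> * (1 / 2) \<le> \<bar>sqrt x - cos (\<theta> / 2)\<bar> * \<bar>sqrt x + cos (\<theta> / 2)\<bar>"
    by (intro mult_left_mono) auto
  also note eq
  finally have "\<bar>sqrt x - cos (\<theta> / 2)\<bar> * (1 / 2) \<le> \<bar>real C / real D - cos \<theta>\<bar> / 2" .
  moreover have "a * (1 / 2) \<le> b / 2 \<Longrightarrow> b \<le> \<epsilon> \<Longrightarrow> a \<le> \<epsilon>" for a b by simp
  ultimately have "\<bar>sqrt x - cos (\<theta> / 2)\<bar> \<le> \<epsilon>" using e by blast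
  then show "\<bar>real r / real D - cos (\<theta> / 2)\<bar> \<le> \<epsilon> + 2 / real D" using 1 by linarith
qed

text \<open>For small angles the passage from cosine to sine is badly conditioned and only the
  square root of the error survives. It is therefore performed once, after all halvings, rather than
  in every step.\<close>

lemma sin_from_cos:
  fixes C D r :: nat
  assumes D: "0 < D" and C: "C \<le> D" and \<theta>: "0 \<le> \<theta>" "\<theta> \<le> pi"
    and e: "\<bar>real C / real D - cos \<theta>\<bar> \<le> \<epsilon>"
    and r: "r ^ 2 \<le> D * D - C * C" "D * D - C * C < (r + 1) ^ 2"
  shows "\<bar>real r / real D - sin \<theta>\<bar> \<le> 1 / real D + sqrt (2 * \<epsilon>)" "r \<le> D"
proof -
  have "r ^ 2 \<le> D ^ 2" using r(1) by (simp add: power2_eq_square)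
  then show "r \<le> D" by simp
  define c where "c = real C / real D"
  have c: "0 \<le> c" "c \<le> 1" using C D by (auto simp: c_def)
  have "C * C \<le> D * D" using C by (rule mult_le_mono) (rule C)
  then have n: "real (D * D - C * C) = (real D)\<^sup>2 * (1 - c\<^sup>2)"
    using D by (simp add: c_def of_nat_diff field_simps power2_eq_square)
  have c1: "0 \<le> 1 - c\<^sup>2" using c by (simp add: power_le_one)
  have s: "sqrt (real (D * D - C * C)) = real D * sqrt (1 - c\<^sup>2)" unfolding n by (simp add: real_sqrt_mult)
  have "\<bar>real r - real D * sqrt (1 - c\<^sup>2)\<bar> \<le> 1" using isqrt_real[OF r] unfolding s by linarith
  then have "\<bar>(real r - real D * sqrt (1 - c\<^sup>2)) / real D\<bar> \<le> 1 / real D"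
    using D by (simp add: abs_divide divide_right_mono)
  then have 1: "\<bar>real r / real D - sqrt (1 - c\<^sup>2)\<bar> \<le> 1 / real D" using D by (simp add: diff_divide_distrib)
  have "0 \<le> sin \<theta>" using \<theta> by (intro sin_ge_zero) auto
  then have sn: "sin \<theta> = sqrt (1 - (cos \<theta>)\<^sup>2)" by (simp add: sin_squared_eq[symmetric])
  have "\<bar>sqrt (1 - c\<^sup>2) - sin \<theta>\<bar> \<le> sqrt \<bar>(1 - c\<^sup>2) - (1 - (cos \<theta>)\<^sup>2)\<bar>"
    unfolding sn by (rule abs_sqrt_diff_le) (use c1 in \<open>auto simp: abs_square_le_1\<close>)
  also have "\<dots> \<le> sqrt (2 * \<epsilon>)"
  proof (rule real_sqrt_le_mono)
    have c2: "\<bar>c + cos \<theta>\<bar> \<le> 2"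
      using c abs_cos_le_one[of \<theta>] abs_triangle_ineq[of c "cos \<theta>"] by linarith
    have "\<bar>(1 - c\<^sup>2) - (1 - (cos \<theta>)\<^sup>2)\<bar> = \<bar>c - cos \<theta>\<bar> * \<bar>c + cos \<theta>\<bar>"
      by (simp add: abs_mult[symmetric] algebra_simps power2_eq_square abs_minus_commute)
    also have "\<dots> \<le> \<epsilon> * 2"
      using e c2 by (intro mult_mono) (auto simp: c_def[symmetric])
    finally show "\<bar>(1 - c\<^sup>2) - (1 - (cos \<theta>)\<^sup>2)\<bar> \<le> 2 * \<epsilon>" by simp
  qed
  finally show "\<bar>real r / real D - sin \<theta>\<bar> \<le> 1 / real D + sqrt (2 * \<epsilon>)" using 1 by linarith
qed

subsection \<open>Matching as an arithmetic identity\<close>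

text \<open>Termwise 2 p t <= p p + [p > 0] t t, with equality exactly for a wildcard or equal
  values. Equality of the sums then forces equality of all terms, and stating it with both sides
  positive avoids subtraction of naturals.\<close>

lemma match_iff_sums:
  fixes p t :: "nat \<Rightarrow> nat"
  shows "(\<Sum>j<m. p j * p j) + (\<Sum>j<m. (p j div p j) * (t j * t j)) = 2 * (\<Sum>j<m. p j * t j) \<longleftrightarrow>
    (\<forall>j<m. p j = 0 \<or> p j = t j)"
proof -
  have le: "2 * (p j * t j) \<le> p j * p j + (p j div p j) * (t j * t j)" for j
  proof (cases "p j = 0")
    case False
    have "2 * (int (p j) * int (t j)) \<le> int (p j) * int (p j) + int (t j) * int (t j)"
      using sum_squares_ge_zero[of "int (p j) - int (t j)" 0] by (simp add: algebra_simps)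
    then have "int (2 * (p j * t j)) \<le> int (p j * p j + t j * t j)" by simp
    then show ?thesis using False unfolding of_nat_le_iff by simp
  qed simp
  have eq: "2 * (p j * t j) = p j * p j + (p j div p j) * (t j * t j) \<longleftrightarrow> p j = 0 \<or> p j = t j" for j
  proof (cases "p j = 0")
    case False
    have "2 * (p j * t j) = p j * p j + t j * t j \<longleftrightarrow>
        int (2 * (p j * t j)) = int (p j * p j + t j * t j)" unfolding of_nat_eq_iff ..
    also have "\<dots> \<longleftrightarrow> (int (p j) - int (t j)) * (int (p j) - int (t j)) = 0"
      by (simp add: algebra_simps; linarith)
    finally show ?thesis using False by simp
  qed simp
  have "(\<Sum>j<m. p j * p j) + (\<Sum>j<m. (p j div p j) * (t j * t j)) = 2 * (\<Sum>j<m. p j * t j) \<longleftrightarrow>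
      (\<Sum>j<m. 2 * (p j * t j)) = (\<Sum>j<m. p j * p j + (p j div p j) * (t j * t j))"
    by (auto simp: sum.distrib sum_distrib_left)
  also have "\<dots> \<longleftrightarrow> (\<forall>j<m. 2 * (p j * t j) = p j * p j + (p j div p j) * (t j * t j))"
  proof
    assume *: "(\<Sum>j<m. 2 * (p j * t j)) = (\<Sum>j<m. p j * p j + (p j div p j) * (t j * t j))"
    show "\<forall>j<m. 2 * (p j * t j) = p j * p j + (p j div p j) * (t j * t j)"
      using sum_mono_inv[OF *] le by auto
  qed (intro sum.cong, auto)
  finally show ?thesis unfolding eq .
qed

subsection \<open>Correlation by fast Fourier transforms\<close>

abbreviation "ad \<equiv> Bin OAdd"
abbreviation "su \<equiv> Bin OSub"
abbreviation "ml \<equiv> Bin OMul"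
abbreviation "dv \<equiv> Bin ODiv"
abbreviation "md \<equiv> Bin OMod"

lemma agreeD1: "agree X F st st' \<Longrightarrow> x \<notin> X \<Longrightarrow> fst st' x = fst st x"
  and agreeD2: "agree X F st st' \<Longrightarrow> f \<notin> F \<Longrightarrow> snd st' f = snd st f"
  by (simp_all add: agree_def)

text \<open>Variables: 3 block length L, 4 transform length N = 4 L, 5 binary logarithm of N,
  8 scale D, 9 offset Z; 19 to 22 loop counters, 23 stride, 24 index, 25 exponent of the twiddle
  factor. Arrays: 0 and 1 data, 2 and 3 scratch, 4 and 5 roots of unity, 6 and 7 saved transform.\<close>

definition fma_re :: "exp \<Rightarrow> exp \<Rightarrow> exp \<Rightarrow> exp \<Rightarrow> exp \<Rightarrow> exp" where
  "fma_re a c d e f = dv (su (ad (ad (ad (ml (Var 8) a) (ml c e)) (ml (Var 9) d)) (ml (Var 9) f))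
     (ad (ad (ml d f) (ml (Var 9) c)) (ml (Var 9) e))) (Var 8)"

definition fma_im :: "exp \<Rightarrow> exp \<Rightarrow> exp \<Rightarrow> exp \<Rightarrow> exp \<Rightarrow> exp" where
  "fma_im b c d e f = dv (su (ad (ad (ad (ml (Var 8) b) (ml c f)) (ml d e)) (ml (ml (Num 2) (Var 9)) (Var 9)))
     (ad (ad (ad (ml (Var 9) c) (ml (Var 9) f)) (ml (Var 9) d)) (ml (Var 9) e))) (Var 8)"

lemma val_fma [simp]:
  "val I (fma_re a c d e f) st = fre (fst st 8) (fst st 9) (val I a st) (val I c st) (val I d st) (val I e st) (val I f st)"
  "val I (fma_im a c d e f) st = fim (fst st 8) (fst st 9) (val I a st) (val I c st) (val I d st) (val I e st) (val I f st)"
  by (simp_all add: fma_re_def fma_im_def fre_def fim_def)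

lemma idx_ok_fma [simp]:
  "idx_ok I M (fma_re a c d e f) st \<longleftrightarrow> idx_ok I M a st \<and> idx_ok I M c st \<and> idx_ok I M d st \<and> idx_ok I M e st \<and> idx_ok I M f st"
  "idx_ok I M (fma_im a c d e f) st \<longleftrightarrow> idx_ok I M a st \<and> idx_ok I M c st \<and> idx_ok I M d st \<and> idx_ok I M e st \<and> idx_ok I M f st"
  by (auto simp add: fma_re_def fma_im_def)

lemma elen_fma [simp]:
  "elen (fma_re a c d e f) = elen a + 2 * elen c + 2 * elen d + 2 * elen e + 2 * elen f + 26"
  "elen (fma_im a c d e f) = elen a + 2 * elen c + 2 * elen d + 2 * elen e + 2 * elen f + 34"
  by (simp_all add: fma_re_def fma_im_def)

lemma wf_exp_fma [simp]:
  "wf_exp (fma_re a c d e f) \<longleftrightarrow> wf_exp a \<and> wf_exp c \<and> wf_exp d \<and> wf_exp e \<and> wf_exp f"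
  "wf_exp (fma_im a c d e f) \<longleftrightarrow> wf_exp a \<and> wf_exp c \<and> wf_exp d \<and> wf_exp e \<and> wf_exp f"
  by (auto simp add: fma_re_def fma_im_def)

definition pair_copy :: "nat \<Rightarrow> nat \<Rightarrow> com" where
  "pair_copy f g = For 21 22 (Var 4)
     (Seq (Sto f (Var 21) (Arr g (Var 21))) (Sto (Suc f) (Var 21) (Arr (Suc g) (Var 21))))"

text \<open>Other positions still need the entries that a position would overwrite, so the results
  go to the arrays 2 and 3. Variable 24 first holds the residue and then the read position.\<close>

definition butterfly :: com where
  "butterfly =
     Seq (Asg 24 (md (Var 21) (Var 23)))
    (Seq (Asg 25 (su (Var 21) (Var 24)))
    (Seq (Asg 24 (ad (md (ml (Num 2) (Var 25)) (Var 4)) (Var 24)))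
    (Seq (Sto 2 (Var 21) (fma_re (Arr 0 (Var 24)) (Arr 4 (Var 25)) (Arr 5 (Var 25))
            (Arr 0 (ad (Var 24) (Var 23))) (Arr 1 (ad (Var 24) (Var 23)))))
         (Sto 3 (Var 21) (fma_im (Arr 1 (Var 24)) (Arr 4 (Var 25)) (Arr 5 (Var 25))
            (Arr 0 (ad (Var 24) (Var 23))) (Arr 1 (ad (Var 24) (Var 23))))))))"

definition fft_com :: com where
  "fft_com = Seq (Asg 23 (Var 4)) (For 19 20 (Var 5)
     (Seq (Asg 23 (dv (Var 23) (Num 2))) (Seq (For 21 22 (Var 4) butterfly) (pair_copy 0 2))))"

definition load :: "exp \<Rightarrow> com" where
  "load e = For 21 22 (Var 4) (Seq (Sto 0 (Var 21) (ad (Var 9) (ml (Var 8) e))) (Sto 1 (Var 21) (Var 9)))"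

text \<open>The addend (Z, Z) encodes 0, so the fused operation is a plain product. The text
  transform is read at the negated index, as \<open>correlation\<close> demands, and the pattern
  transform comes from the saved arrays 6 and 7.\<close>

definition product :: com where
  "product = For 21 22 (Var 4)
     (Seq (Asg 24 (md (su (Var 4) (Var 21)) (Var 4)))
     (Seq (Sto 2 (Var 21) (fma_re (Var 9) (Arr 0 (Var 24)) (Arr 1 (Var 24)) (Arr 6 (Var 21)) (Arr 7 (Var 21))))
          (Sto 3 (Var 21) (fma_im (Var 9) (Arr 0 (Var 24)) (Arr 1 (Var 24)) (Arr 6 (Var 21)) (Arr 7 (Var 21))))))"

text \<open>The quotient is that of \<open>round_real\<close>; dividing by D N at once removes the
  scale and the missing normalisation of the inverse transform. The exact values are integers, so
  the real part suffices.\<close>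

definition accumulate :: "nat \<Rightarrow> com" where
  "accumulate f = For 21 22 (Var 3) (Sto f (Var 21) (ad (Arr f (Var 21))
     (dv (su (ad (Arr 0 (Var 21)) (ml (Var 8) (ml (Num 2) (Var 3)))) (Var 9)) (ml (Var 8) (Var 4)))))"

definition corr :: "exp \<Rightarrow> exp \<Rightarrow> nat \<Rightarrow> com" where
  "corr ep et f = Seq (load ep) (Seq fft_com (Seq (pair_copy 6 0) (Seq (load et) (Seq fft_com
     (Seq product (Seq (pair_copy 0 2) (Seq fft_com (accumulate f))))))))"

section \<open>Frames and well-formedness of the correlation program\<close>

lemma vars_simps [simp]:
  "vars (pair_copy f g) = {21, 22}" "vars butterfly = {24, 25}" "vars (load e) = {21, 22}"
  "vars product = {21, 22, 24}" "vars (accumulate f) = {21, 22}"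
  by (auto simp: pair_copy_def butterfly_def load_def product_def accumulate_def)

lemma arrs_simps [simp]:
  "arrs (pair_copy f g) = {f, Suc f}" "arrs butterfly = {2, 3}" "arrs (load e) = {0, 1}"
  "arrs product = {2, 3}" "arrs (accumulate f) = {f}"
  by (auto simp: pair_copy_def butterfly_def load_def product_def accumulate_def)

lemma vars_fft_com [simp]: "vars fft_com = {19, 20, 21, 22, 23, 24, 25}"
  and arrs_fft_com [simp]: "arrs fft_com = {0, 1, 2, 3}"
  by (auto simp: fft_com_def)

lemma vars_corr [simp]: "vars (corr ep et f) = {19, 20, 21, 22, 23, 24, 25}"
  and arrs_corr [simp]: "arrs (corr ep et f) = {0, 1, 2, 3, 6, 7, f}"
  by (auto simp: corr_def)

lemma wf_com_simps [simp]:
  "wf_com (pair_copy f g) \<longleftrightarrow> f < 9 \<and> g < 9" "wf_com butterfly"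
  "wf_com (load e) \<longleftrightarrow> wf_exp e \<and> edepth e \<le> 17" "wf_com product" "wf_com (accumulate f) \<longleftrightarrow> f < 10"
  by (auto simp: pair_copy_def butterfly_def load_def product_def accumulate_def fma_re_def fma_im_def)

lemma wf_com_fft_com [simp]: "wf_com fft_com"
  by (simp add: fft_com_def)

lemma wf_com_corr [simp]:
  "wf_com (corr ep et f) \<longleftrightarrow> f < 10 \<and> wf_exp ep \<and> edepth ep \<le> 17 \<and> wf_exp et \<and> edepth et \<le> 17"
  by (auto simp: corr_def)

section \<open>Error analysis of transforms, products and rounding\<close>

locale fixed_point =
  fixes I :: wpm_input and R M D Z K L :: nat and \<delta> :: real
  assumes D: "0 < D" and ZR: "2 * Z < R" and KR: "2 * 2 ^ K < R" "K < R" and KM: "2 ^ K \<le> M"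
    and KL: "2 ^ K = 4 * L" and DR: "D < R" and \<delta>: "0 \<le> \<delta>" "\<delta> \<le> 1"
begin

abbreviation "w \<equiv> unity_root (2 ^ K)"

definition cfg :: "store \<Rightarrow> bool" where
  "cfg st \<longleftrightarrow> fst st 3 = L \<and> fst st 4 = 2 ^ K \<and> fst st 5 = K \<and> fst st 8 = D \<and> fst st 9 = Z \<and>
     (\<forall>i<2 ^ K. cmod (cv D Z (snd st 4 i) (snd st 5 i) - w ^ i) \<le> \<delta>)"

lemma cfg_agree:
  assumes "agree X F st st'" "cfg st" "X \<inter> {3, 4, 5, 8, 9} = {}" "F \<inter> {4, 5} = {}"
  shows "cfg st'"
proof -
  have "fst st' 3 = fst st 3" "fst st' 4 = fst st 4" "fst st' 5 = fst st 5" "fst st' 8 = fst st 8" "fst st' 9 = fst st 9"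
    using assms(3) by (auto intro!: agreeD1[OF assms(1)])
  moreover have "snd st' 4 = snd st 4" "snd st' 5 = snd st 5"
    using assms(4) by (auto intro!: agreeD2[OF assms(1)])
  ultimately show ?thesis using assms(2) by (simp add: cfg_def)
qed

text \<open>The bound 2 Z on the entries accompanies the accuracy because it keeps them below R, so
  that they may be copied and stored again.\<close>

definition approx :: "nat \<Rightarrow> store \<Rightarrow> (nat \<Rightarrow> complex) \<Rightarrow> real \<Rightarrow> bool" where
  "approx f st x e \<longleftrightarrow> (\<forall>i<2 ^ K. cmod (cv D Z (snd st f i) (snd st (Suc f) i) - x i) \<le> e \<and>
     snd st f i \<le> 2 * Z \<and> snd st (Suc f) i \<le> 2 * Z)"

lemma approx_agree:
  assumes "agree X F st st'" "approx f st x e" "f \<notin> F" "Suc f \<notin> F"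
  shows "approx f st' x e"
  using assms by (simp add: approx_def agreeD2)

lemma hoare_pair_copy:
  assumes c: "cfg st" and a: "approx g st x e" and fg: "f < 9" "g < 9" "{f, Suc f} \<inter> {g, Suc g} = {}"
    "f \<noteq> 4" "f \<noteq> 5" "f \<noteq> 3"
  shows "hoare I R M (pair_copy f g) st (7 + 2 ^ K * 40) (\<lambda>st'. approx f st' x e)"
proof -
  let ?body = "Seq (Sto f (Var 21) (Arr g (Var 21))) (Sto (Suc f) (Var 21) (Arr (Suc g) (Var 21)))"
  let ?I = "\<lambda>i st'. \<forall>j<i. snd st' f j = snd st g j \<and> snd st' (Suc f) j = snd st (Suc g) j"
  show ?thesis unfolding pair_copy_def
  proof (rule hoare_For[where t = 34 and n = "2 ^ K" and Inv = ?I])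
  show "wf_com (For 21 22 (Var 4) ?body)"
    using fg by simp
  show "val I (Var 4) st = 2 ^ K" using c by (simp add: cfg_def)
  show "2 ^ K < R" using KR by simp
next
  fix i and st' :: store
  assume i: "i < 2 ^ K" "fst st' 21 = i" and ag: "agree (vars (For 21 22 (Var 4) ?body)) (arrs ?body) st st'"
    and inv: "?I i st'"
  have g: "snd st' g = snd st g" "snd st' (Suc g) = snd st (Suc g)"
    using fg by (auto intro!: agreeD2[OF ag])
  have b: "snd st g i < R" "snd st (Suc g) i < R" using a i ZR by (auto simp: approx_def)
  show "hoare I R M ?body st' 34 (\<lambda>st''. ?I (Suc i) (setv 21 (Suc i) st''))"
    using i g b inv fg KM by (auto simp: hoare_def less_Suc_eq)
next
  fix st' :: store
  assume "?I (2 ^ K) st'"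
  then show "approx f st' x e" using a by (simp add: approx_def)
  qed simp_all
qed

lemma hoare_butterflies:
  fixes X E E' :: real
  assumes c: "cfg st" and a: "approx 0 st (fft (2 ^ K) w x h) E" and h: "h < K"
    and M23: "fst st 23 = 2 ^ K div 2 ^ Suc h"
    and x: "\<And>i. i < 2 ^ K \<Longrightarrow> cmod (x i) \<le> X"
    and E': "3 * E + \<delta> * 2 ^ K * X + 2 / D \<le> E'"
    and Zb: "(2 ^ K * X + E') * D + 1 \<le> Z"
  shows "hoare I R M (For 21 22 (Var 4) butterfly) st (7 + 2 ^ K * 400)
    (\<lambda>st'. approx 2 st' (fft (2 ^ K) w x (Suc h)) E')"
proof -
  let ?I = "\<lambda>i st'. \<forall>j<i. cmod (cv D Z (snd st' 2 j) (snd st' 3 j) - fft (2 ^ K) w x (Suc h) j) \<le> E' \<and>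
        snd st' 2 j \<le> 2 * Z \<and> snd st' 3 j \<le> 2 * Z"
  show ?thesis
  proof (rule hoare_For[where t = 394 and n = "2 ^ K" and Inv = ?I])
  show "val I (Var 4) st = 2 ^ K" using c by (simp add: cfg_def)
  show "2 ^ K < R" using KR by simp
next
  fix i and st' :: store
  assume i: "i < 2 ^ K" "fst st' 21 = i" and ag: "agree (vars (For 21 22 (Var 4) butterfly)) (arrs butterfly) st st'"
    and inv: "?I i st'"
  define m where "m = (2::nat) ^ K div 2 ^ Suc h"
  define r where "r = i mod m"
  define q where "q = i - r"
  define s where "s = 2 * q mod 2 ^ K + r"
  have s: "s + m < 2 ^ K" using fft_index[OF h i(1)] by (simp add: s_def r_def q_def m_def)
  have q: "q < 2 ^ K" using i by (simp add: q_def)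
  have ct: "cfg st'" by (rule cfg_agree[OF ag c]) auto
  have v: "fst st' 4 = 2 ^ K" "fst st' 8 = D" "fst st' 9 = Z" using ct by (auto simp: cfg_def)
  have m: "fst st' 23 = m" using agreeD1[OF ag, of 23] M23 by (simp add: m_def)
  have arr: "snd st' f = snd st f" if "f \<notin> {2, 3}" for f
    using agreeD2[OF ag, of f] that by simp
  let ?g = "\<lambda>i. cv D Z (snd st' 0 i) (snd st' (Suc 0) i)"
  let ?W = "\<lambda>i. cv D Z (snd st' 4 i) (snd st' 5 i)"
  define z where "z = ?g s + ?W q * ?g (s + m)"
  have g: "cmod (?g i - fft (2 ^ K) w x h i) \<le> E" if "i < 2 ^ K" for i
    using a that arr[of 0] arr[of 1] by (simp add: approx_def)
  have W: "cmod (?W i - w ^ i) \<le> \<delta>" if "i < 2 ^ K" for i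
    using ct that by (simp add: cfg_def)
  have err: "cmod (z - fft (2 ^ K) w x (Suc h) i) \<le> 3 * E + \<delta> * 2 ^ K * X"
    using fft_step_error[OF norm_unity_root x g W \<delta>(2) h i(1)]
    by (simp add: z_def s_def r_def q_def m_def)
  have X0: "0 \<le> X" using order_trans[OF norm_ge_zero x[of 0]] by simp
  have "cmod (fft (2 ^ K) w x (Suc h) i) \<le> 2 ^ Suc h * X"
    using h i by (intro fft_norm_le[OF norm_unity_root x]) auto
  also have "\<dots> \<le> 2 ^ K * X" using X0 h by (intro mult_right_mono power_increasing) auto
  finally have nf: "cmod (fft (2 ^ K) w x (Suc h) i) \<le> 2 ^ K * X" .
  have "cmod z \<le> cmod (z - fft (2 ^ K) w x (Suc h) i) + cmod (fft (2 ^ K) w x (Suc h) i)"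
    using norm_triangle_ineq[of "z - fft (2 ^ K) w x (Suc h) i" "fft (2 ^ K) w x (Suc h) i"] by simp
  moreover have D2: "0 \<le> 2 / real D" by simp
  ultimately have "cmod z \<le> 2 ^ K * X + E'" using err nf E' by linarith
  then have "cmod z * real D \<le> (2 ^ K * X + E') * D" by (intro mult_right_mono) auto
  then have zZ: "cmod z * real D + 1 \<le> real Z" using Zb by linarith
  let ?a = "snd st' 0 s" and ?b = "snd st' (Suc 0) s" and ?c = "snd st' 4 q" and ?d = "snd st' 5 q"
    and ?e = "snd st' 0 (s + m)" and ?f = "snd st' (Suc 0) (s + m)"
  have zz: "z = cv D Z ?a ?b + cv D Z ?c ?d * cv D Z ?e ?f" by (simp add: z_def)
  note F = fma_error[OF D zz zZ]
  let ?fr = "fre D Z ?a ?c ?d ?e ?f" and ?fi = "fim D Z ?b ?c ?d ?e ?f"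
  have "cmod (cv D Z ?fr ?fi - fft (2 ^ K) w x (Suc h) i) \<le> E'"
    using norm_triangle_ineq[of "cv D Z ?fr ?fi - z" "z - fft (2 ^ K) w x (Suc h) i"] F(1) err E' by simp
  moreover have "r < R" "q < R" "s < R" "i mod m = r" "i - r = q" "2 * q mod 2 ^ K + r = s"
    using s i KR q unfolding r_def[symmetric] q_def[symmetric] s_def[symmetric]
    by (auto simp: r_def intro: le_less_trans[OF mod_less_eq_dividend])
  moreover have "s < M" "s + m < M" "q < M" "i < M" using s q i KM by auto
  ultimately show "hoare I R M butterfly st' 394 (\<lambda>st''. ?I (Suc i) (setv 21 (Suc i) st''))"
    using inv F(2,3) ZR i v m unfolding hoare_def butterfly_def
    by (simp add: less_Suc_eq all_conj_distrib imp_conjR del: fft.simps)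
next
  fix st' :: store
  assume "?I (2 ^ K) st'"
  then show "approx 2 st' (fft (2 ^ K) w x (Suc h)) E'" by (simp add: approx_def del: fft.simps)
  qed (auto simp: butterfly_def fma_re_def fma_im_def)
qed

text \<open>A closed bound for K iterations of E -> 3 E + c started at e, where c collects the
  twiddle error and the rounding of one stage.\<close>

definition fft_err :: "real \<Rightarrow> real \<Rightarrow> real" where
  "fft_err e X = 3 ^ K * (e + (\<delta> * 2 ^ K * X + 2 / D))"

lemma hoare_fft:
  fixes X e :: real
  assumes c: "cfg st" and a: "approx 0 st x e"
    and x: "\<And>i. i < 2 ^ K \<Longrightarrow> cmod (x i) \<le> X"
    and Zb: "(2 ^ K * X + fft_err e X) * D + 1 \<le> Z"
  shows "hoare I R M fft_com st (12 + K * (30 + 2 ^ K * 440))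
    (\<lambda>st'. approx 0 st' (\<lambda>k. \<Sum>j<2 ^ K. x j * w ^ (j * k)) (fft_err e X))"
proof -
  define st'0 where "st'0 = \<delta> * 2 ^ K * X + 2 / D"
  have X0: "0 \<le> X" using order_trans[OF norm_ge_zero x[of 0]] by simp
  have t0: "0 \<le> st'0" using X0 \<delta> by (simp add: st'0_def)
  have "0 \<le> e" using order_trans[OF norm_ge_zero, of _ e] a unfolding approx_def by (meson zero_less_power zero_less_numeral)
  then have et: "0 \<le> e + st'0" using t0 by simp
  \<comment> \<open>Subtracting the per-stage error makes the sequence start at e and absorb E -> 3
    E + \<open>st'0\<close> without a geometric sum.\<close>
  define E where "E h = 3 ^ h * (e + st'0) - st'0" for h
  have ES: "3 * E h + \<delta> * 2 ^ K * X + 2 / D \<le> E (Suc h)" for h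
    using t0 unfolding E_def by (simp add: st'0_def algebra_simps)
  have EK: "E h \<le> fft_err e X" if "h \<le> K" for h
  proof -
    have "3 ^ h * (e + st'0) \<le> 3 ^ K * (e + st'0)" using et that by (intro mult_right_mono power_increasing) auto
    then show ?thesis using t0 by (simp add: E_def fft_err_def st'0_def)
  qed
  let ?body = "Seq (Asg 23 (dv (Var 23) (Num 2))) (Seq (For 21 22 (Var 4) butterfly) (pair_copy 0 2))"
  have "hoare I R M (For 19 20 (Var 5) ?body) (setv 23 (2 ^ K) st) (8 + K * (30 + 2 ^ K * 440))
    (\<lambda>st'. approx 0 st' (\<lambda>k. \<Sum>j<2 ^ K. x j * w ^ (j * k)) (fft_err e X))"
  proof (rule hoare_For[where t = "24 + 2 ^ K * 440" and n = K and
      Inv = "\<lambda>h st'. approx 0 st' (fft (2 ^ K) w x h) (E h) \<and> fst st' 23 = 2 ^ K div 2 ^ h"])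
    show "val I (Var 5) (setv 23 (2 ^ K) st) = K" using c by (simp add: cfg_def)
    show "K < R" using KR by simp
    show "approx 0 (setv 19 0 (setv 20 K (setv 23 (2 ^ K) st))) (fft (2 ^ K) w x 0) (E 0) \<and>
      fst (setv 19 0 (setv 20 K (setv 23 (2 ^ K) st))) 23 = 2 ^ K div 2 ^ 0"
      using a by (simp add: E_def approx_def)
  next
    fix h and st' :: store
    assume h: "h < K" "fst st' 19 = h" and ag: "agree (vars (For 19 20 (Var 5) ?body)) (arrs ?body) (setv 23 (2 ^ K) st) st'"
      and inv: "approx 0 st' (fft (2 ^ K) w x h) (E h) \<and> fst st' 23 = 2 ^ K div 2 ^ h"
    have "cfg (setv 23 (2 ^ K) st)" using c by (simp add: cfg_def)
    from cfg_agree[OF ag this] have ct: "cfg st'" by auto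
    define st'1 where "st'1 = setv 23 (2 ^ K div 2 ^ Suc h) st'"
    have c1: "cfg st'1" using ct by (simp add: st'1_def cfg_def)
    have a1: "approx 0 st'1 (fft (2 ^ K) w x h) (E h)" using inv by (simp add: st'1_def approx_def)
    have Zb1: "(2 ^ K * X + E (Suc h)) * D + 1 \<le> Z"
    proof -
      have "(2 ^ K * X + E (Suc h)) * D \<le> (2 ^ K * X + fft_err e X) * D"
        using EK[of "Suc h"] h by (intro mult_right_mono) auto
      then show ?thesis using Zb by linarith
    qed
    have lt: "(2::nat) ^ K div 2 ^ Suc h < R"
      using KR div_le_dividend[of "2 ^ K" "2 ^ Suc h"] by linarith
    have M1: "fst st'1 23 = 2 ^ K div 2 ^ Suc h" by (simp add: st'1_def)
    have 1: "hoare I R M (Asg 23 (dv (Var 23) (Num 2))) st' 6 (\<lambda>st'. st' = st'1)"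
      using inv lt by (simp add: hoare_def st'1_def div_mult2_eq[symmetric] mult.commute)
    have 2: "hoare I R M (pair_copy 0 2) st'2 (7 + 2 ^ K * 40)
        (\<lambda>st''. approx 0 (setv 19 (Suc h) st'') (fft (2 ^ K) w x (Suc h)) (E (Suc h)) \<and>
          fst (setv 19 (Suc h) st'') 23 = 2 ^ K div 2 ^ Suc h)"
      if "approx 2 st'2 (fft (2 ^ K) w x (Suc h)) (E (Suc h))"
        "agree (vars (For 21 22 (Var 4) butterfly)) (arrs (For 21 22 (Var 4) butterfly)) st'1 st'2" for st'2
    proof (rule hoare_conseq[OF hoare_pair_copy[OF _ that(1)] order_refl])
      show "cfg st'2" using cfg_agree[OF that(2) c1] by auto
      fix st'' :: store assume ap: "approx 0 st'' (fft (2 ^ K) w x (Suc h)) (E (Suc h))" "agree (vars (pair_copy 0 2)) (arrs (pair_copy 0 2)) st'2 st''"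
      have "fst st'' 23 = fst st'2 23" using agreeD1[OF ap(2), of 23] by simp
      also have "\<dots> = fst st'1 23" using agreeD1[OF that(2), of 23] by simp
      finally show "approx 0 (setv 19 (Suc h) st'') (fft (2 ^ K) w x (Suc h)) (E (Suc h)) \<and>
          fst (setv 19 (Suc h) st'') 23 = 2 ^ K div 2 ^ Suc h"
        using ap(1) M1 by (simp add: approx_def del: fft.simps)
    qed auto
    show "hoare I R M ?body st' (24 + 2 ^ K * 440)
        (\<lambda>st''. approx 0 (setv 19 (Suc h) st'') (fft (2 ^ K) w x (Suc h)) (E (Suc h)) \<and>
          fst (setv 19 (Suc h) st'') 23 = 2 ^ K div 2 ^ Suc h)"
      apply (rule hoare_Seq[where ta = 6 and tb = "14 + 2 ^ K * 440"])
       apply (rule hoare_conseq[OF 1 order_refl])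
       apply (simp only:)
       apply (rule hoare_Seq[where ta = "7 + 2 ^ K * 400" and tb = "7 + 2 ^ K * 40"])
        apply (rule hoare_conseq[OF hoare_butterflies[OF c1 a1 h(1) M1 x ES Zb1] order_refl])
         apply assumption
        apply (rule 2; assumption)
       apply simp_all
      done
  next
    fix st' :: store assume "approx 0 st' (fft (2 ^ K) w x K) (E K) \<and> fst st' 23 = 2 ^ K div 2 ^ K"
    moreover have "fft (2 ^ K) w x K k = (\<Sum>j<2 ^ K. x j * w ^ (j * k))" if "k < 2 ^ K" for k
      using that by (intro fft_eq_dft unity_root_power_N) auto
    ultimately show "approx 0 st' (\<lambda>k. \<Sum>j<2 ^ K. x j * w ^ (j * k)) (fft_err e X)"
      using EK[of K] by (auto simp: approx_def intro: order_trans)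
  qed (auto simp: algebra_simps)
  moreover have "hoare I R M (Asg 23 (Var 4)) st 4 (\<lambda>st'. st' = setv 23 (2 ^ K) st)"
    using c KR by (simp add: hoare_def cfg_def)
  ultimately show ?thesis
    unfolding fft_com_def
    by (intro hoare_Seq[where ta = 4 and tb = "8 + K * (30 + 2 ^ K * 440)"])
      (auto elim!: hoare_conseq)
qed

lemma hoare_load:
  assumes c: "cfg st" and E: "elen e \<le> 100" and W: "wf_exp e" "edepth e \<le> 17"
    and e: "\<And>st' j. j < 2 ^ K \<Longrightarrow> fst st' 21 = j \<Longrightarrow> (\<And>x. x \<noteq> 21 \<Longrightarrow> x \<noteq> 22 \<Longrightarrow> fst st' x = fst st x) \<Longrightarrow>
      val I e st' = p j \<and> idx_ok I M e st'"
    and p: "\<And>j. j < 2 ^ K \<Longrightarrow> D * p j \<le> Z"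
  shows "hoare I R M (load e) st (7 + 2 ^ K * 130) (\<lambda>st'. approx 0 st' (\<lambda>j. of_nat (p j)) 0)"
proof -
  let ?body = "Seq (Sto 0 (Var 21) (ad (Var 9) (ml (Var 8) e))) (Sto 1 (Var 21) (Var 9))"
  let ?I = "\<lambda>i st'. \<forall>j<i. snd st' 0 j = Z + D * p j \<and> snd st' (Suc 0) j = Z"
  show ?thesis unfolding load_def
  proof (rule hoare_For[where t = 124 and n = "2 ^ K" and Inv = ?I])
  show "val I (Var 4) st = 2 ^ K" using c by (simp add: cfg_def)
  show "2 ^ K < R" using KR by simp
next
  fix i and st' :: store
  assume i: "i < 2 ^ K" "fst st' 21 = i" and ag: "agree (vars (For 21 22 (Var 4) ?body)) (arrs ?body) st st'"
    and inv: "?I i st'"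
  have "cfg st'" using cfg_agree[OF ag c] by auto
  then have v: "fst st' 8 = D" "fst st' 9 = Z" by (auto simp: cfg_def)
  have "val I e st' = p i \<and> idx_ok I M e st'"
    using agreeD1[OF ag] by (intro e[OF i]) auto
  moreover have "Z + D * p i < R" using p[OF i(1)] ZR by linarith
  ultimately show "hoare I R M ?body st' 124 (\<lambda>st''. ?I (Suc i) (setv 21 (Suc i) st''))"
    using i inv v KM E by (auto simp: hoare_def less_Suc_eq)
next
  fix st' :: store assume "?I (2 ^ K) st'"
  then show "approx 0 st' (\<lambda>j. of_nat (p j)) 0" using p by (simp add: approx_def cv_int[OF D])
  qed (use W in \<open>auto simp: load_def\<close>)
qed

lemma hoare_product:
  fixes X e e' :: real
  assumes c: "cfg st" and x: "approx 0 st x e" and y: "approx 6 st y e"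
    and X: "\<And>i. i < 2 ^ K \<Longrightarrow> cmod (x i) \<le> X" "\<And>i. i < 2 ^ K \<Longrightarrow> cmod (y i) \<le> X"
    and e': "e * (2 * X + e) + 2 / D \<le> e'" and Zb: "(X * X + e') * D + 1 \<le> Z"
  shows "hoare I R M product st (7 + 2 ^ K * 400) (\<lambda>st'. approx 2 st' (\<lambda>k. x ((2 ^ K - k) mod 2 ^ K) * y k) e')"
proof -
  let ?body = "Seq (Asg 24 (md (su (Var 4) (Var 21)) (Var 4)))
     (Seq (Sto 2 (Var 21) (fma_re (Var 9) (Arr 0 (Var 24)) (Arr 1 (Var 24)) (Arr 6 (Var 21)) (Arr 7 (Var 21))))
          (Sto 3 (Var 21) (fma_im (Var 9) (Arr 0 (Var 24)) (Arr 1 (Var 24)) (Arr 6 (Var 21)) (Arr 7 (Var 21)))))"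
  let ?I = "\<lambda>i st'. \<forall>j<i. cmod (cv D Z (snd st' 2 j) (snd st' 3 j) - x ((2 ^ K - j) mod 2 ^ K) * y j) \<le> e' \<and>
        snd st' 2 j \<le> 2 * Z \<and> snd st' 3 j \<le> 2 * Z"
  show ?thesis unfolding product_def
  proof (rule hoare_For[where t = 394 and n = "2 ^ K" and Inv = ?I])
  show "val I (Var 4) st = 2 ^ K" using c by (simp add: cfg_def)
  show "2 ^ K < R" using KR by simp
next
  fix i and st' :: store
  assume i: "i < 2 ^ K" "fst st' 21 = i" and ag: "agree (vars (For 21 22 (Var 4) ?body)) (arrs ?body) st st'"
    and inv: "?I i st'"
  define k where "k = (2 ^ K - i) mod (2 ^ K)"
  have k: "k < 2 ^ K" by (simp add: k_def)
  have "cfg st'" using cfg_agree[OF ag c] by auto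
  then have v: "fst st' 4 = 2 ^ K" "fst st' 8 = D" "fst st' 9 = Z" by (auto simp: cfg_def)
  have arr: "snd st' f = snd st f" if "f \<notin> {2, 3}" for f
    using agreeD2[OF ag, of f] that by simp
  let ?c = "snd st' 0 k" and ?d = "snd st' (Suc 0) k" and ?e = "snd st' 6 i" and ?f = "snd st' 7 i"
  define z where "z = cv D Z Z Z + cv D Z ?c ?d * cv D Z ?e ?f"
  have cv0: "cv D Z Z Z = 0" by (simp add: cv_def complex_eq_iff)
  have 1: "cmod (cv D Z ?c ?d - x k) \<le> e" using x k arr[of 0] arr[of "Suc 0"] by (simp add: approx_def)
  have 2: "cmod (cv D Z ?e ?f - y i) \<le> e" using y i arr[of 6] arr[of 7] by (simp add: approx_def)
  have e0: "0 \<le> e" by (rule order_trans[OF norm_ge_zero 1])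
  have X0: "0 \<le> X" by (rule order_trans[OF norm_ge_zero X(1)[OF k]])
  have n: "cmod (cv D Z ?e ?f) \<le> X + e"
    using norm_triangle_ineq[of "cv D Z ?e ?f - y i" "y i"] 2 X(2)[OF i(1)] by simp
  have "z - x k * y i = (cv D Z ?c ?d - x k) * cv D Z ?e ?f + x k * (cv D Z ?e ?f - y i)"
    by (simp add: z_def cv0 algebra_simps)
  also have "cmod \<dots> \<le> e * (X + e) + X * e"
    using 1 2 n X(1)[OF k] e0 X0
    by (intro norm_triangle_mono) (auto simp: norm_mult intro!: mult_mono)
  also have "\<dots> = e * (2 * X + e)" by (simp add: algebra_simps)
  finally have err: "cmod (z - x k * y i) \<le> e * (2 * X + e)" .
  have "cmod (x k * y i) \<le> X * X" using X(1)[OF k] X(2)[OF i(1)] X0 by (auto simp: norm_mult intro!: mult_mono)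
  moreover have "cmod z \<le> cmod (z - x k * y i) + cmod (x k * y i)"
    using norm_triangle_ineq[of "z - x k * y i" "x k * y i"] by simp
  moreover have D2: "0 \<le> 2 / real D" by simp
  ultimately have "cmod z \<le> X * X + e'" using err e' by linarith
  then have "cmod z * real D \<le> (X * X + e') * D" by (intro mult_right_mono) auto
  then have zZ: "cmod z * real D + 1 \<le> real Z" using Zb by linarith
  note F = fma_error[OF D z_def zZ]
  let ?fr = "fre D Z Z ?c ?d ?e ?f" and ?fi = "fim D Z Z ?c ?d ?e ?f"
  have "cmod (cv D Z ?fr ?fi - x k * y i) \<le> e'"
    using norm_triangle_ineq[of "cv D Z ?fr ?fi - z" "z - x k * y i"] F(1) err e' by simp
  moreover have "k < R" "k < M" "i < M" using k i KR KM by auto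
  ultimately show "hoare I R M ?body st' 394 (\<lambda>st''. ?I (Suc i) (setv 21 (Suc i) st''))"
    using inv F(2,3) ZR i v unfolding hoare_def
    by (simp add: less_Suc_eq all_conj_distrib imp_conjR k_def[symmetric])
next
  fix st' :: store
  assume "?I (2 ^ K) st'"
  then show "approx 2 st' (\<lambda>k. x ((2 ^ K - k) mod 2 ^ K) * y k) e'" by (simp add: approx_def)
  qed (auto simp: fma_re_def fma_im_def)
qed

lemma hoare_accumulate:
  assumes c: "cfg st" and a: "approx 0 st (\<lambda>u. of_nat (2 ^ K * c u)) 1" and f: "f = 8 \<or> f = 9"
    and b: "\<And>u. u < L \<Longrightarrow> snd st f u + c u < R" and L: "0 < L"
  shows "hoare I R M (accumulate f) st (7 + 2 ^ K * 60) (\<lambda>st'. \<forall>u<L. snd st' f u = snd st f u + c u)"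
proof -
  let ?body = "Sto f (Var 21) (ad (Arr f (Var 21))
     (dv (su (ad (Arr 0 (Var 21)) (ml (Var 8) (ml (Num 2) (Var 3)))) (Var 9)) (ml (Var 8) (Var 4))))"
  let ?I = "\<lambda>i st'. (\<forall>u<i. snd st' f u = snd st f u + c u) \<and> (\<forall>u\<ge>i. snd st' f u = snd st f u)"
  show ?thesis unfolding accumulate_def
  proof (rule hoare_For[where t = 54 and n = L and Inv = ?I])
  show "val I (Var 3) st = L" using c by (simp add: cfg_def)
  show "L < R" using KR KL by simp
  show "elen (Var 3) + 5 + L * (54 + 6) \<le> 7 + 2 ^ K * 60" using KL by simp
next
  fix i and st' :: store
  assume i: "i < L" "fst st' 21 = i" and ag: "agree (vars (For 21 22 (Var 3) ?body)) (arrs ?body) st st'"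
    and inv: "?I i st'"
  have "cfg st'" using cfg_agree[OF ag c] f by auto
  then have v: "fst st' 3 = L" "fst st' 4 = 2 ^ K" "fst st' 8 = D" "fst st' 9 = Z" by (auto simp: cfg_def)
  have arr: "snd st' 0 = snd st 0" using agreeD2[OF ag, of 0] f by auto
  have iK: "i < 2 ^ K" using i KL by simp
  have "cmod (cv D Z (snd st 0 i) (snd st (Suc 0) i) - of_nat (2 ^ K * c i)) \<le> 1"
    using a iK by (simp add: approx_def)
  then have "\<bar>Re (cv D Z (snd st 0 i) (snd st (Suc 0) i) - of_nat (2 ^ K * c i))\<bar> \<le> 1"
    using abs_Re_le_cmod order_trans by blast
  then have "(snd st 0 i + D * (2 * L) - Z) div (D * 2 ^ K) = c i"
    using round_real[OF D L KL, of "snd st 0 i" Z "c i"] by (simp add: cv_Re)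
  then show "hoare I R M ?body st' 54 (\<lambda>st''. ?I (Suc i) (setv 21 (Suc i) st''))"
    using i iK inv v arr KM b[OF i(1)] f by (auto simp: hoare_def less_Suc_eq)
  qed (use f in auto)
qed

end

lemma hoareD:
  assumes "hoare I R M c st t Q"
  shows "ok I R M c st" "cost I c st \<le> t" "Q (sem I c st)" "agree (vars c) (arrs c) st (sem I c st)"
  using assms agree_sem by (auto simp: hoare_def)

lemma norm_dft_le:
  fixes X :: real
  assumes "\<And>j. j < 2 ^ K \<Longrightarrow> cmod (x j) \<le> X"
  shows "cmod (\<Sum>j<2 ^ K. x j * unity_root (2 ^ K) ^ (j * k)) \<le> 2 ^ K * X"
proof -
  have "cmod (\<Sum>j<2 ^ K. x j * unity_root (2 ^ K) ^ (j * k)) \<le> (\<Sum>j<(2::nat) ^ K. X)"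
    using assms by (intro sum_norm_le) (auto simp: norm_mult norm_power)
  then show ?thesis by simp
qed

text \<open>The error ledger of one correlation: \<open>X\<close> bounds the integer inputs,
  \<open>X1\<close> their exact spectra, \<open>E1\<close> is the error of the first two transforms,
  \<open>e2\<close> that of the pointwise product. \<open>Z1\<close> to \<open>Z3\<close> provide
  head room for the three phases, and the final error 1 in \<open>E3\<close> is what
  \<open>round_real\<close> tolerates.\<close>

locale correlator = fixed_point +
  fixes X :: nat and E1 e2 X1 :: real
  assumes L: "0 < L"
    and E1_def: "E1 = fft_err 0 X"
    and X1_def: "X1 = 2 ^ K * real X"
    and e2_def: "e2 = E1 * (2 * X1 + E1) + 2 / D"
    and Z1: "(X1 + E1) * D + 1 \<le> Z"
    and Z2: "(X1 * X1 + e2) * D + 1 \<le> Z"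
    and Z3: "(2 ^ K * (X1 * X1) + 1) * D + 1 \<le> Z"
    and E3: "fft_err e2 (X1 * X1) \<le> 1"
begin

lemma hoare_corr:
  assumes c: "cfg st" and f: "f = 8 \<or> f = 9"
    and lenp: "elen ep \<le> 100" and wp: "wf_exp ep" "edepth ep \<le> 17"
    and ep: "\<And>st' j. j < 2 ^ K \<Longrightarrow> fst st' 21 = j \<Longrightarrow> (\<And>x. x \<notin> {19..25} \<Longrightarrow> fst st' x = fst st x) \<Longrightarrow>
      val I ep st' = p j \<and> idx_ok I M ep st'"
    and lent: "elen et \<le> 100" and wt: "wf_exp et" "edepth et \<le> 17"
    and et: "\<And>st' j. j < 2 ^ K \<Longrightarrow> fst st' 21 = j \<Longrightarrow> (\<And>x. x \<notin> {19..25} \<Longrightarrow> fst st' x = fst st x) \<Longrightarrow>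
      val I et st' = t j \<and> idx_ok I M et st'"
    and p: "\<And>j. j < 2 ^ K \<Longrightarrow> p j \<le> X" and t: "\<And>j. j < 2 ^ K \<Longrightarrow> t j \<le> X"
    and R: "\<And>u. u < L \<Longrightarrow> snd st f u + (\<Sum>b<2 ^ K. p b * t ((b + u) mod 2 ^ K)) < R"
  shows "hoare I R M (corr ep et f) st (1500 * (2 ^ K * (K + 1)))
    (\<lambda>st'. \<forall>u<L. snd st' f u = snd st f u + (\<Sum>b<2 ^ K. p b * t ((b + u) mod 2 ^ K)))"
proof -
  let ?F = "\<lambda>x k. \<Sum>j<2 ^ K. of_nat (x j) * w ^ (j * k) :: complex"
  have E10: "0 \<le> E1" using \<delta> by (simp add: E1_def fft_err_def)
  have DX: "D * x \<le> Z" if "x \<le> X" for x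
  proof -
    have "real X * 1 \<le> real X * 2 ^ K" by (intro mult_left_mono) auto
    then have "real x \<le> X1 + E1" using that E10 by (simp add: X1_def mult.commute)
    then have "real x * real D \<le> (X1 + E1) * D" by (intro mult_right_mono) auto
    then have "real (D * x) \<le> real Z" using Z1 by (simp add: mult.commute)
    then show ?thesis unfolding of_nat_le_iff .
  qed
  have Z1': "(2 ^ K * real X + fft_err 0 (real X)) * D + 1 \<le> Z"
    using Z1 by (simp add: X1_def E1_def)
  have nF: "cmod (?F x k) \<le> X1" if "\<And>j. j < 2 ^ K \<Longrightarrow> x j \<le> X" for x k
    unfolding X1_def using that by (intro norm_dft_le) simp

  define s1 where "s1 = sem I (load ep) st"
  have "hoare I R M (load ep) st (7 + 2 ^ K * 130) (\<lambda>st'. approx 0 st' (\<lambda>j. of_nat (p j)) 0)"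
    by (rule hoare_load[OF c lenp wp], rule ep) (use p DX in auto)
  note 1 = hoareD[OF this, folded s1_def]
  have c1: "cfg s1" using cfg_agree[OF 1(4) c] by auto
  define s2 where "s2 = sem I fft_com s1"
  note 2 = hoareD[OF hoare_fft[OF c1 1(3) _ Z1'], folded s2_def E1_def, simplified, OF p]
  have c2: "cfg s2" using cfg_agree[OF 2(4) c1] by auto
  define s3 where "s3 = sem I (pair_copy 6 0) s2"
  note 3 = hoareD[OF hoare_pair_copy[OF c2 2(3), of 6, simplified], folded s3_def]
  have c3: "cfg s3" using cfg_agree[OF 3(4) c2] by auto
  have v3: "fst s3 x = fst st x" if "x \<notin> {19..25}" for x
    using that agreeD1[OF 3(4), of x] agreeD1[OF 2(4), of x] agreeD1[OF 1(4), of x] by auto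
  define s4 where "s4 = sem I (load et) s3"
  have "hoare I R M (load et) s3 (7 + 2 ^ K * 130) (\<lambda>st'. approx 0 st' (\<lambda>j. of_nat (t j)) 0)"
    by (rule hoare_load[OF c3 lent wt], rule et) (use t DX v3 in auto)
  note 4 = hoareD[OF this, folded s4_def]
  have c4: "cfg s4" using cfg_agree[OF 4(4) c3] by auto
  define s5 where "s5 = sem I fft_com s4"
  note 5 = hoareD[OF hoare_fft[OF c4 4(3) _ Z1'], folded s5_def E1_def, simplified, OF t]
  have c5: "cfg s5" using cfg_agree[OF 5(4) c4] by auto
  have P5: "approx 6 s5 (?F p) E1"
    using approx_agree[OF 5(4) approx_agree[OF 4(4) 3(3)]] by simp
  define s6 where "s6 = sem I product s5"
  note 6 = hoareD[OF hoare_product[OF c5 5(3) P5 nF[OF t] nF[OF p] eq_refl[OF e2_def[symmetric]] Z2], folded s6_def]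
  have c6: "cfg s6" using cfg_agree[OF 6(4) c5] by auto
  define s7 where "s7 = sem I (pair_copy 0 2) s6"
  note 7 = hoareD[OF hoare_pair_copy[OF c6 6(3), of 0, simplified], folded s7_def]
  have c7: "cfg s7" using cfg_agree[OF 7(4) c6] by auto
  let ?G = "\<lambda>k. ?F t ((2 ^ K - k) mod 2 ^ K) * ?F p k"
  have X10: "0 \<le> X1" by (simp add: X1_def)
  have nG: "cmod (?G k) \<le> X1 * X1" for k
    using nF[OF t] nF[OF p] X10 unfolding norm_mult by (intro mult_mono) auto
  have "(2 ^ K * (X1 * X1) + fft_err e2 (X1 * X1)) * D \<le> (2 ^ K * (X1 * X1) + 1) * D"
    using E3 by (intro mult_right_mono) auto
  then have Z3': "(2 ^ K * (X1 * X1) + fft_err e2 (X1 * X1)) * D + 1 \<le> Z" using Z3 by linarith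
  define s8 where "s8 = sem I fft_com s7"
  note 8 = hoareD[OF hoare_fft[OF c7 7(3) nG Z3'], folded s8_def]
  have c8: "cfg s8" using cfg_agree[OF 8(4) c7] by auto
  let ?c = "\<lambda>u. \<Sum>b<2 ^ K. p b * t ((b + u) mod 2 ^ K)"
  \<comment> \<open>From here on exactness returns: the approximated quantity is N times a natural
    number.\<close>
  have "(\<Sum>j<2 ^ K. ?G j * w ^ (j * u)) = of_nat (2 ^ K * ?c u)" for u
    using correlation[of "2 ^ K" "\<lambda>j. of_nat (t j)" "\<lambda>j. of_nat (p j)" u] by simp
  then have a8: "approx 0 s8 (\<lambda>u. of_nat (2 ^ K * ?c u)) 1"
    using 8(3) E3 unfolding approx_def by (auto intro: order_trans)
  have f8: "snd s8 f = snd st f"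
    using f agreeD2[OF 8(4), of f] agreeD2[OF 7(4), of f] agreeD2[OF 6(4), of f] agreeD2[OF 5(4), of f]
      agreeD2[OF 4(4), of f] agreeD2[OF 3(4), of f] agreeD2[OF 2(4), of f] agreeD2[OF 1(4), of f] by auto
  note 9 = hoareD[OF hoare_accumulate[OF c8 a8 f _ L, unfolded f8, OF R]]
  have K4: "1 \<le> (2::nat) ^ K" by simp
  have "7 + 2 ^ K * 130 + ((12 + K * (30 + 2 ^ K * 440)) + ((7 + 2 ^ K * 40) + ((7 + 2 ^ K * 130) +
      ((12 + K * (30 + 2 ^ K * 440)) + ((7 + 2 ^ K * 400) + ((7 + 2 ^ K * 40) +
      ((12 + K * (30 + 2 ^ K * 440)) + (7 + 2 ^ K * 60)))))))) \<le> 1500 * (2 ^ K * (K + 1))"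
  proof -
    have "K * 90 \<le> K * (L * 720)" using L by (intro mult_left_mono) auto
    then have "78 + K * 90 \<le> K * (L * 720) + L * 2800" using L by linarith
    then show ?thesis using K4 KL L by (simp add: algebra_simps)
  qed
  moreover have "sem I (corr ep et f) st = sem I (accumulate f) s8"
    by (simp add: corr_def s1_def s2_def s3_def s4_def s5_def s6_def s7_def s8_def)
  moreover have "ok I R M (corr ep et f) st"
    using 1(1) 2(1) 3(1) 4(1) 5(1) 6(1) 7(1) 8(1) 9(1)
    by (simp add: corr_def s1_def s2_def s3_def s4_def s5_def s6_def s7_def s8_def)
  moreover have "cost I (corr ep et f) st = cost I (load ep) st + (cost I fft_com s1 + (cost I (pair_copy 6 0) s2 +
     (cost I (load et) s3 + (cost I fft_com s4 + (cost I product s5 + (cost I (pair_copy 0 2) s6 +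
     (cost I fft_com s7 + cost I (accumulate f) s8)))))))"
    by (simp add: corr_def s1_def s2_def s3_def s4_def s5_def s6_def s7_def s8_def)
  ultimately show ?thesis
    unfolding hoare_def using 1(2) 2(2) 3(2) 4(2) 5(2) 6(2) 7(2) 8(2) 9(2) 9(3) by auto
qed

end

subsection \<open>Preparation of the parameters and the roots of unity\<close>

text \<open>The exponents are constants of the program, so a power can be unrolled into an
  expression. Nesting to the left keeps the number of temporaries for powers of a variable at
  two.\<close>

primrec pow_exp :: "nat \<Rightarrow> exp \<Rightarrow> exp" where
  "pow_exp 0 e = Num 1"
| "pow_exp (Suc k) e = ml (pow_exp k e) e"

lemma pow_exp_simps [simp]:
  "val I (pow_exp k e) st = val I e st ^ k" "elen (pow_exp k e) = 1 + k * (elen e + 1)"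
  "idx_ok I M e st \<Longrightarrow> idx_ok I M (pow_exp k e) st" "wf_exp e \<Longrightarrow> wf_exp (pow_exp k e)"
  "edepth (pow_exp k (Var x)) \<le> 2"
  by (induction k) (simp_all add: mult.commute)

definition setup_block :: com where
  "setup_block = Seq (Asg 3 (Num 1)) (Seq (Asg 5 (Num 2)) (Seq (For 17 18 Par
     (If (su (ad Par (Num 1)) (ml (Num 2) (Var 3)))
       (Seq (Asg 3 (ml (Num 2) (Var 3))) (Asg 5 (ad (Var 5) (Num 1)))) Skip))
     (Asg 4 (ml (Num 4) (Var 3)))))"

text \<open>The variable 6 becomes the least power of two above the text length; the scale and the
  offset of the fixed-point arithmetic are powers of it.\<close>

definition setup_base :: com where
  "setup_base = Seq (Asg 6 (Num 1)) (Seq (Asg 7 (Num 0)) (For 17 18 TLen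
     (If (su (ad TLen (Num 1)) (Var 6))
       (Seq (Asg 6 (ml (Num 2) (Var 6))) (Asg 7 (ad (Var 7) (Num 1)))) Skip)))"

text \<open>The root is found bit by bit from the top. Variable 13 is the part found so far,
  variable 14 the current bit, which starts at 2 D and is halved before each test; D = 2^(alpha J)
  and J is in variable 7, so the number of bits is available.\<close>

definition isqrt_com :: "nat \<Rightarrow> com" where
  "isqrt_com alpha = Seq (Asg 13 (Num 0)) (Seq (Asg 14 (ml (Num 2) (Var 8)))
     (For 15 16 (ad (ml (Num alpha) (Var 7)) (Num 1))
       (Seq (Asg 14 (dv (Var 14) (Num 2)))
         (If (su (ad (Var 12) (Num 1)) (ml (ad (Var 13) (Var 14)) (ad (Var 13) (Var 14))))
           (Asg 13 (ad (Var 13) (Var 14))) Skip))))"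

definition cos_com :: "nat \<Rightarrow> com" where
  "cos_com alpha = For 17 18 (su (Var 5) (Num 2))
     (Seq (Asg 12 (dv (ml (Var 8) (ad (Var 8) (Var 10))) (Num 2))) (Seq (isqrt_com alpha) (Asg 10 (Var 13))))"

definition table_com :: com where
  "table_com = For 17 18 (su (Var 4) (Num 1))
     (Seq (Sto 4 (ad (Var 17) (Num 1)) (fma_re (Var 9) (Arr 4 (Var 17)) (Arr 5 (Var 17)) (Var 10) (Var 11)))
          (Sto 5 (ad (Var 17) (Num 1)) (fma_im (Var 9) (Arr 4 (Var 17)) (Arr 5 (Var 17)) (Var 10) (Var 11))))"

definition setup_roots :: "nat \<Rightarrow> nat \<Rightarrow> com" where
  "setup_roots alpha beta = Seq (Asg 8 (pow_exp alpha (Var 6))) (Seq (Asg 9 (pow_exp beta (Var 6))) (Seq (Asg 10 (Num 0))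
     (Seq (cos_com alpha) (Seq (Asg 12 (su (ml (Var 8) (Var 8)) (ml (Var 10) (Var 10))))
     (Seq (isqrt_com alpha) (Seq (Asg 11 (ad (Var 9) (Var 13))) (Seq (Asg 10 (ad (Var 9) (Var 10)))
     (Seq (Sto 4 (Num 0) (ad (Var 9) (Var 8))) (Seq (Sto 5 (Num 0) (Var 9)) table_com)))))))))"

lemma vars_setup [simp]: "vars setup_block = {3, 4, 5, 17, 18}" "vars setup_base = {6, 7, 17, 18}"
  "vars (isqrt_com alpha) = {13, 14, 15, 16}" "vars (cos_com alpha) = {10, 12, 13, 14, 15, 16, 17, 18}"
  "vars table_com = {17, 18}"
  "vars (setup_roots alpha beta) = {8, 9, 10, 11, 12, 13, 14, 15, 16, 17, 18}"
  by (auto simp: setup_block_def setup_base_def isqrt_com_def cos_com_def table_com_def setup_roots_def)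

lemma arrs_setup [simp]: "arrs setup_block = {}" "arrs setup_base = {}" "arrs (isqrt_com alpha) = {}"
  "arrs (cos_com alpha) = {}" "arrs table_com = {4, 5}" "arrs (setup_roots alpha beta) = {4, 5}"
  by (auto simp: setup_block_def setup_base_def isqrt_com_def cos_com_def table_com_def setup_roots_def)

lemma wf_com_setup [simp]: "wf_com setup_block" "wf_com setup_base" "wf_com (isqrt_com alpha)" "wf_com (cos_com alpha)"
  "wf_com table_com" "wf_com (setup_roots alpha beta)"
proof -
  show 1: "wf_com setup_block" "wf_com setup_base" "wf_com (isqrt_com alpha)"
    by (simp_all add: setup_block_def setup_base_def isqrt_com_def)
  then show 2: "wf_com (cos_com alpha)" by (simp add: cos_com_def)
  show 3: "wf_com table_com" by (simp add: table_com_def fma_re_def fma_im_def)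
  show "wf_com (setup_roots alpha beta)"
    using 1 2 3 order_trans[OF pow_exp_simps(5)[of _ 6]] by (simp add: setup_roots_def)
qed

text \<open>The invariant says that either the power is already maximal or every round so far has
  doubled it. After s rounds the second case is impossible unless the first holds too, since s <
  2^s.\<close>

lemma hoare_setup_block:
  assumes s: "1 \<le> in_par I" "4 * in_par I < R" "in_par I + 3 < R"
  shows "hoare I R M setup_block st (30 + in_par I * 40)
    (\<lambda>st'. \<exists>K\<ge>2. fst st' 5 = K \<and> fst st' 3 = 2 ^ (K - 2) \<and> fst st' 4 = 2 ^ K \<and>
       2 ^ (K - 2) \<le> in_par I \<and> in_par I < 2 * 2 ^ (K - 2))"
proof -
  let ?s = "in_par I"
  let ?body = "If (su (ad Par (Num 1)) (ml (Num 2) (Var 3)))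
       (Seq (Asg 3 (ml (Num 2) (Var 3))) (Asg 5 (ad (Var 5) (Num 1)))) Skip"
  let ?st = "setv 5 2 (setv 3 1 st)"
  let ?Q = "\<lambda>st'. \<exists>k. fst st' 5 = k + 2 \<and> fst st' 3 = 2 ^ k \<and> 2 ^ k \<le> ?s \<and> ?s < 2 * 2 ^ k"
  let ?I = "\<lambda>i st'. \<exists>k. fst st' 5 = k + 2 \<and> fst st' 3 = 2 ^ k \<and> 2 ^ k \<le> ?s \<and> (?s < 2 * 2 ^ k \<or> k = i)"
  have "hoare I R M (For 17 18 Par ?body) ?st (6 + ?s * 40) ?Q"
  proof (rule hoare_For[where n = ?s and t = 34 and Inv = ?I])
    show "?I 0 (setv 17 0 (setv 18 ?s ?st))"
      using s by (intro exI[of _ 0]) simp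
  next
    fix i and st' :: store
    assume "i < ?s" "?I i st'"
    then obtain k where k: "fst st' 5 = k + 2" "fst st' 3 = 2 ^ k" "2 ^ k \<le> ?s" "?s < 2 * 2 ^ k \<or> k = i" by auto
    have "k < 2 ^ k" by simp
    then have "k < ?s" using k by linarith
    then have kR: "k + 3 < R" "2 * 2 ^ k < R" using s k by linarith+
    show "hoare I R M ?body st' 34 (\<lambda>st''. ?I (Suc i) (setv 17 (Suc i) st''))"
    proof (cases "2 * 2 ^ k \<le> ?s")
      case True
      then show ?thesis using k kR by (auto simp: hoare_def intro!: exI[of _ "Suc k"])
    next
      case False
      then show ?thesis using k kR by (auto simp: hoare_def intro!: exI[of _ k])
    qed
  next
    fix st' :: store
    assume "?I ?s st'"
    moreover have "?s < 2 ^ ?s" by simp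
    ultimately show "?Q st'" by (metis linorder_not_le)
  qed (use s in auto)
  note 1 = hoareD[OF this]
  obtain k where k: "fst (sem I (For 17 18 Par ?body) ?st) 5 = k + 2"
    "fst (sem I (For 17 18 Par ?body) ?st) 3 = 2 ^ k" "2 ^ k \<le> ?s" "?s < 2 * 2 ^ k"
    using 1(3) by blast
  have "4 * 2 ^ k < R" using k(3) s(2) by linarith
  then show ?thesis
    using 1(1,2) k s unfolding hoare_def setup_block_def
    by (auto intro!: exI[of _ "k + 2"] simp del: sem.simps(6) ok.simps(6) cost.simps(6))
qed

lemma hoare_setup_base:
  assumes n: "1 \<le> length (in_text I)" "2 * length (in_text I) < R"
  shows "hoare I R M setup_base st (30 + length (in_text I) * 40)
    (\<lambda>st'. \<exists>J. fst st' 7 = J \<and> fst st' 6 = 2 ^ J \<and> length (in_text I) < 2 ^ J \<and> 2 ^ J \<le> 2 * length (in_text I))"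
proof -
  let ?n = "length (in_text I)"
  let ?body = "If (su (ad TLen (Num 1)) (Var 6))
       (Seq (Asg 6 (ml (Num 2) (Var 6))) (Asg 7 (ad (Var 7) (Num 1)))) Skip"
  let ?st = "setv 7 0 (setv 6 1 st)"
  let ?Q = "\<lambda>st'. \<exists>k. fst st' 7 = k \<and> fst st' 6 = 2 ^ k \<and> ?n < 2 ^ k \<and> 2 ^ k \<le> 2 * ?n"
  let ?I = "\<lambda>i st'. \<exists>k. fst st' 7 = k \<and> fst st' 6 = 2 ^ k \<and> 2 ^ k \<le> 2 * ?n \<and> (?n < 2 ^ k \<or> k = i)"
  have "hoare I R M (For 17 18 TLen ?body) ?st (6 + ?n * 40) ?Q"
  proof (rule hoare_For[where n = ?n and t = 34 and Inv = ?I])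
    show "?I 0 (setv 17 0 (setv 18 ?n ?st))"
      using n by (intro exI[of _ 0]) simp
  next
    fix i and st' :: store
    assume "i < ?n" "?I i st'"
    then obtain k where k: "fst st' 7 = k" "fst st' 6 = 2 ^ k" "2 ^ k \<le> 2 * ?n" "?n < 2 ^ k \<or> k = i" by auto
    have kk: "k < 2 ^ k" by simp
    show "hoare I R M ?body st' 34 (\<lambda>st''. ?I (Suc i) (setv 17 (Suc i) st''))"
    proof (cases "2 ^ k \<le> ?n")
      case True
      then have "Suc k < R" "2 * 2 ^ k < R" using n kk by linarith+
      then show ?thesis using True k by (auto simp: hoare_def)
    next
      case False
      then show ?thesis using k by (auto simp: hoare_def)
    qed
  next
    fix st' :: store
    assume "?I ?n st'"
    moreover have "?n < 2 ^ ?n" by simp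
    ultimately show "?Q st'" by auto
  qed (use n in auto)
  note 1 = hoareD[OF this]
  show ?thesis
    using 1 n unfolding hoare_def setup_base_def
    by (auto simp del: sem.simps(6) ok.simps(6) cost.simps(6))
qed

lemma hoare_isqrt:
  assumes D: "D = 2 ^ (alpha * J)" and s: "fst st 8 = D" "fst st 7 = J" "fst st 12 = x"
    and x: "x < (2 * D)\<^sup>2" and R: "2 * D < R"
  shows "hoare I R M (isqrt_com alpha) st (40 + (alpha * J + 1) * 60)
    (\<lambda>st'. (fst st' 13)\<^sup>2 \<le> x \<and> x < (fst st' 13 + 1)\<^sup>2)"
proof -
  let ?body = "Seq (Asg 14 (dv (Var 14) (Num 2)))
         (If (su (ad (Var 12) (Num 1)) (ml (ad (Var 13) (Var 14)) (ad (Var 13) (Var 14))))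
           (Asg 13 (ad (Var 13) (Var 14))) Skip)"
  let ?e = "ad (ml (Num alpha) (Var 7)) (Num 1)"
  let ?st = "setv 14 (2 * D) (setv 13 0 st)"
  let ?Q = "\<lambda>st'. (fst st' 13)\<^sup>2 \<le> x \<and> x < (fst st' 13 + 1)\<^sup>2"
  have le: "alpha * J + 1 \<le> D" unfolding D by (simp add: Suc_le_eq)
  \<comment> \<open>The root lies in an interval that starts at variable 13 and has length variable
    14; after the last round the length is 1.\<close>
  let ?I = "\<lambda>i st'. fst st' 14 = 2 ^ (alpha * J + 1 - i) \<and> (fst st' 13)\<^sup>2 \<le> x \<and> x < (fst st' 13 + fst st' 14)\<^sup>2"
  have "hoare I R M (For 15 16 ?e ?body) ?st (12 + (alpha * J + 1) * 60) ?Q"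
  proof (rule hoare_For[where n = "alpha * J + 1" and t = 54 and Inv = ?I])
    show "?I 0 (setv 15 0 (setv 16 (alpha * J + 1) ?st))"
      using x by (simp add: D)
  next
    fix i and st' :: store
    assume i: "i < alpha * J + 1" "fst st' 15 = i" and ag: "agree (vars (For 15 16 ?e ?body)) (arrs ?body) ?st st'"
      and inv: "?I i st'"
    define v where "v = (2::nat) ^ (alpha * J - i)"
    have e: "alpha * J + 1 - i = Suc (alpha * J - i)" using i by auto
    have w: "fst st' 14 = 2 * v" using inv unfolding e v_def by simp
    have vD: "v \<le> D" unfolding v_def D by (intro power_increasing) auto
    have x12: "fst st' 12 = x" using agreeD1[OF ag, of 12] s by simp
    define r where "r = fst st' 13"
    have r: "r\<^sup>2 \<le> x" "x < (r + 2 * v)\<^sup>2" using inv w by (auto simp: r_def)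
    have up: "r + v < 2 * D" if "(r + v)\<^sup>2 \<le> x"
      using that x by (meson le_less_trans power_less_imp_less_base zero_le)
    have exp: "alpha * J + 1 - Suc i = alpha * J - i" by simp
    show "hoare I R M ?body st' 54 (\<lambda>st''. ?I (Suc i) (setv 15 (Suc i) st''))"
      unfolding exp v_def[symmetric]
      using w x12 vD R r up by (auto simp: hoare_def r_def[symmetric] power2_eq_square algebra_simps)
  next
    fix st' :: store
    assume "?I (alpha * J + 1) st'"
    then show "?Q st'" by auto
  qed (use le R s in auto)
  note 1 = hoareD[OF this]
  show ?thesis
    using 1 s R unfolding hoare_def isqrt_com_def
    by (auto simp del: sem.simps(6) ok.simps(6) cost.simps(6))
qed

text \<open>The start value cos (pi / 2) = 0 is exact and each of the K - 2 halvings adds 2 / D, so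
  the error is linear in K.\<close>

lemma hoare_cos:
  assumes D: "D = 2 ^ (alpha * J)" and s: "fst st 8 = D" "fst st 7 = J" "fst st 5 = K" "fst st 10 = 0"
    and K: "2 \<le> K" "K < R" and R: "D * D < R" "2 * D < R"
  shows "hoare I R M (cos_com alpha) st (10 + K * (80 + (alpha * J + 1) * 60))
    (\<lambda>st'. \<bar>real (fst st' 10) / D - cos (2 * pi / 2 ^ K)\<bar> \<le> K * (2 / D) \<and> fst st' 10 \<le> D)"
proof -
  have D0: "0 < D" by (simp add: D)
  let ?body = "Seq (Asg 12 (dv (ml (Var 8) (ad (Var 8) (Var 10))) (Num 2))) (Seq (isqrt_com alpha) (Asg 10 (Var 13)))"
  let ?I = "\<lambda>i st'. \<bar>real (fst st' 10) / D - cos (2 * pi / 2 ^ (i + 2))\<bar> \<le> real i * (2 / D) \<and> fst st' 10 \<le> D"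
  show ?thesis unfolding cos_com_def
  proof (rule hoare_For[where n = "K - 2" and t = "74 + (alpha * J + 1) * 60" and Inv = ?I])
    show "?I 0 (setv 17 0 (setv 18 (K - 2) st))"
      using s by simp
  next
    fix i and st' :: store
    assume i: "i < K - 2" and ag: "agree (vars (For 17 18 (su (Var 5) (Num 2)) ?body)) (arrs ?body) st st'"
      and inv: "?I i st'"
    define C where "C = fst st' 10"
    define x where "x = D * (D + C) div 2"
    have C: "C \<le> D" using inv by (simp add: C_def)
    have v: "fst st' 8 = D" "fst st' 7 = J" using agreeD1[OF ag, of 8] agreeD1[OF ag, of 7] s by auto
    have "D * (D + C) \<le> 2 * (D * D)" using mult_le_mono2[OF C, of D] by (simp add: algebra_simps)
    then have xD: "x \<le> D * D" unfolding x_def by linarith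
    have "0 < D * D" using D0 by simp
    then have "x < 4 * (D * D)" using xD by linarith
  then have "x < (2 * D)\<^sup>2" by (simp add: power2_eq_square)
    moreover have "fst (setv 12 x st') 8 = D" "fst (setv 12 x st') 7 = J" "fst (setv 12 x st') 12 = x"
      using v by simp_all
    ultimately have "hoare I R M (isqrt_com alpha) (setv 12 x st') (40 + (alpha * J + 1) * 60)
      (\<lambda>st'. (fst st' 13)\<^sup>2 \<le> x \<and> x < (fst st' 13 + 1)\<^sup>2)"
      using R(2) by (intro hoare_isqrt[OF D])
    note 1 = hoareD[OF this]
    define r where "r = fst (sem I (isqrt_com alpha) (setv 12 x st')) 13"
    have th: "0 \<le> 2 * pi / 2 ^ (i + 2)" "2 * pi / 2 ^ (i + 2) \<le> pi / 2"
    proof -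
      have "(2::real) ^ 2 \<le> 2 ^ (i + 2)" by (intro power_increasing) auto
      then show "2 * pi / 2 ^ (i + 2) \<le> pi / 2" by (simp add: field_simps)
    qed simp
    have "\<bar>real r / D - cos (2 * pi / 2 ^ (i + 2) / 2)\<bar> \<le> i * (2 / D) + 2 / D" "r \<le> D"
      using cos_half_step[OF D0 C th _ 1(3)[folded r_def, THEN conjunct1, unfolded x_def]
          1(3)[folded r_def, THEN conjunct2, unfolded x_def]] inv by (auto simp: C_def)
    moreover have "2 * pi / 2 ^ (i + 2) / 2 = 2 * pi / 2 ^ (Suc i + 2)" by simp
    moreover have "i * (2 / D) + 2 / D = Suc i * (2 / D)"
      unfolding of_nat_Suc distrib_right by simp
    ultimately have r: "\<bar>real r / D - cos (2 * pi / 2 ^ (Suc i + 2))\<bar> \<le> Suc i * (2 / D)" "r \<le> D" by metis+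
    have "x < R" "r < R" using xD r(2) R by linarith+
    then show "hoare I R M ?body st' (74 + (alpha * J + 1) * 60) (\<lambda>st''. ?I (Suc i) (setv 17 (Suc i) st''))"
      using 1(1,2) r v unfolding hoare_def
      by (simp add: C_def[symmetric] x_def[symmetric] r_def[symmetric])
  next
    fix st' :: store
    assume inv: "?I (K - 2) st'"
    have "real (K - 2) * (2 / D) \<le> real K * (2 / D)" by (intro mult_right_mono) auto
    moreover have "K - 2 + 2 = K" using K by simp
    ultimately show "\<bar>real (fst st' 10) / D - cos (2 * pi / 2 ^ K)\<bar> \<le> K * (2 / D) \<and> fst st' 10 \<le> D"
      using inv by (metis order_trans)
  next
    show "elen (su (Var 5) (Num 2)) + 5 + (K - 2) * (74 + (alpha * J + 1) * 60 + 6) \<le> 10 + K * (80 + (alpha * J + 1) * 60)"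
      by (simp add: mult_right_mono add_mono algebra_simps diff_mult_distrib)
  qed (use s K in auto)
qed

section \<open>The table of roots of unity\<close>

context fixed_point
begin

text \<open>Each power is the previous one times the approximate root. The error grows by at most
  \<open>d1\<close> per entry: 2 (e1 + e2) because the previous entry has modulus at most 2, and 2 /
  D for rounding. The old error is multiplied only by the exact root, of modulus 1, hence linear
  rather than exponential growth.\<close>

lemma hoare_table:
  fixes e1 e2 :: real and st :: store
  assumes s: "fst st 3 = L" "fst st 4 = 2 ^ K" "fst st 5 = K" "fst st 8 = D" "fst st 9 = Z"
    and cs: "fst st 10 = Z + C" "fst st 11 = Z + S"
    and C: "\<bar>real C / D - cos (2 * pi / 2 ^ K)\<bar> \<le> e1" and S: "\<bar>real S / D - sin (2 * pi / 2 ^ K)\<bar> \<le> e2"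
    and W0: "snd st 4 0 = Z + D" "snd st 5 0 = Z"
    and d: "2 ^ K * (2 * (e1 + e2) + 2 / D) \<le> \<delta>" and Z: "4 * D + 1 \<le> Z"
  shows "hoare I R M table_com st (9 + 2 ^ K * 400) cfg"
proof -
  define d1 where "d1 = 2 * (e1 + e2) + 2 / D"
  let ?w1 = "cv D Z (Z + C) (Z + S)"
  have w: "w = cis (2 * pi / 2 ^ K)" by (simp add: unity_root_def)
  have w1: "cmod (?w1 - w) \<le> e1 + e2"
    using cmod_le[of "?w1 - w"] C S by (simp add: cv_Re cv_Im w)
  have e0: "0 \<le> e1 + e2" by (rule order_trans[OF norm_ge_zero w1])
  have D0: "0 \<le> 2 / real D" by simp
  have d10: "0 \<le> d1" unfolding d1_def
    by (rule add_nonneg_nonneg[OF mult_nonneg_nonneg[OF _ e0] D0]) simp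
  have jd: "real j * d1 \<le> 1" if "j < 2 ^ K" for j
  proof -
    have "real j \<le> 2 ^ K" using that by (metis of_nat_less_iff of_nat_numeral of_nat_power less_imp_le)
    then have "real j * d1 \<le> 2 ^ K * d1" using d10 by (rule mult_right_mono)
    then show ?thesis using d \<delta> by (simp add: d1_def)
  qed
  have "0 \<le> a \<Longrightarrow> 0 \<le> b \<Longrightarrow> a \<le> 2 * a + b" for a b :: real by simp
  then have "e1 + e2 \<le> d1" unfolding d1_def using e0 D0 by blast
  then have "2 ^ K * (e1 + e2) \<le> 2 ^ K * d1" by (intro mult_left_mono) auto
  also have "2 ^ K * d1 \<le> 1" using d \<delta>(2) unfolding d1_def by (rule order_trans)
  finally have "2 ^ K * (e1 + e2) \<le> 1" .
  moreover have "1 * (e1 + e2) \<le> 2 ^ K * (e1 + e2)" using e0 by (intro mult_right_mono) auto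
  ultimately have "1 * (e1 + e2) \<le> 1" by (rule order_trans[rotated])
  then have e1: "e1 + e2 \<le> 1" by simp
  have nw1: "cmod ?w1 \<le> 2" using norm_triangle_ineq[of "?w1 - w" w] w1 e1 by simp
  let ?body = "Seq (Sto 4 (ad (Var 17) (Num 1)) (fma_re (Var 9) (Arr 4 (Var 17)) (Arr 5 (Var 17)) (Var 10) (Var 11)))
          (Sto 5 (ad (Var 17) (Num 1)) (fma_im (Var 9) (Arr 4 (Var 17)) (Arr 5 (Var 17)) (Var 10) (Var 11)))"
  let ?I = "\<lambda>i st'. \<forall>j\<le>i. cmod (cv D Z (snd st' 4 j) (snd st' 5 j) - w ^ j) \<le> real j * d1"
  show ?thesis unfolding table_com_def
  proof (rule hoare_For[where n = "2 ^ K - 1" and t = 394 and Inv = ?I])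
    show "wf_com (For 17 18 (su (Var 4) (Num 1)) ?body)" by (simp add: fma_re_def fma_im_def)
    have "cv D Z (Z + D) Z = 1" using D by (simp add: cv_def complex_eq_iff)
    then show "?I 0 (setv 17 0 (setv 18 (2 ^ K - 1) st))"
      using W0 by simp
    show "2 ^ K - 1 < R" using KR by simp
    show "elen (su (Var 4) (Num 1)) + 5 + (2 ^ K - 1) * (394 + 6) \<le> 9 + 2 ^ K * 400" by simp
  next
    fix i and st' :: store
    assume i: "i < 2 ^ K - 1" "fst st' 17 = i" and ag: "agree (vars (For 17 18 (su (Var 4) (Num 1)) ?body)) (arrs ?body) st st'"
      and inv: "?I i st'"
    have v: "fst st' 8 = D" "fst st' 9 = Z" "fst st' 10 = Z + C" "fst st' 11 = Z + S"
      using agreeD1[OF ag] s cs by simp_all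
    let ?z = "cv D Z (snd st' 4 i) (snd st' 5 i)"
    define z where "z = cv D Z Z Z + ?z * ?w1"
    have cv0: "cv D Z Z Z = 0" by (simp add: cv_def complex_eq_iff)
    have zi: "cmod (?z - w ^ i) \<le> i * d1" using inv by simp
    have iK: "i < 2 ^ K" "i + 1 < 2 ^ K" using i by auto
    have nz: "cmod ?z \<le> 2"
      using norm_triangle_ineq[of "?z - w ^ i" "w ^ i"] zi jd[OF iK(1)] by (simp add: norm_power)
    have "cmod z \<le> 2 * 2" unfolding z_def cv0 add_0 norm_mult using nz nw1 by (intro mult_mono) auto
    then have "cmod z * D \<le> (2 * 2) * real D" by (intro mult_right_mono) auto
    then have zZ: "cmod z * D + 1 \<le> Z" using Z by linarith
    have "z - w ^ Suc i = ?z * (?w1 - w) + (?z - w ^ i) * w" by (simp add: z_def cv0 algebra_simps)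
    also have "cmod \<dots> \<le> 2 * (e1 + e2) + i * d1"
    proof (rule norm_triangle_mono)
      show "cmod (?z * (?w1 - w)) \<le> 2 * (e1 + e2)"
        unfolding norm_mult using nz w1 by (intro mult_mono) auto
      show "cmod ((?z - w ^ i) * w) \<le> i * d1" using zi by (simp add: norm_mult)
    qed
    finally have err: "cmod (z - w ^ Suc i) \<le> 2 * (e1 + e2) + i * d1" .
    note F = fma_error[OF D z_def zZ]
    let ?fr = "fre D Z Z (snd st' 4 i) (snd st' 5 i) (Z + C) (Z + S)"
    let ?fi = "fim D Z Z (snd st' 4 i) (snd st' 5 i) (Z + C) (Z + S)"
    have "cv D Z ?fr ?fi - w ^ Suc i = (cv D Z ?fr ?fi - z) + (z - w ^ Suc i)" by simp
    also have "cmod \<dots> \<le> 2 / D + (2 * (e1 + e2) + i * d1)" by (rule norm_triangle_mono[OF F(1) err])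
    also have "\<dots> = Suc i * d1" unfolding of_nat_Suc distrib_right by (simp add: d1_def)
    finally have "cmod (cv D Z ?fr ?fi - w ^ Suc i) \<le> Suc i * d1" .
    then have "\<forall>j\<le>Suc i. cmod (cv D Z (((snd st' 4)(Suc i := ?fr)) j) (((snd st' 5)(Suc i := ?fi)) j) - w ^ j) \<le> j * d1"
      using inv by (auto simp: le_Suc_eq simp del: power_Suc)
    then show "hoare I R M ?body st' 394 (\<lambda>st''. ?I (Suc i) (setv 17 (Suc i) st''))"
      using F(2,3) ZR KM iK i v unfolding hoare_def by (simp del: power_Suc)
  next
    fix st' :: store
    assume ag: "agree (vars (For 17 18 (su (Var 4) (Num 1)) ?body)) (arrs ?body) st st'"
      and inv: "?I (2 ^ K - 1) st'"
    have "cmod (cv D Z (snd st' 4 j) (snd st' 5 j) - w ^ j) \<le> \<delta>" if "j < 2 ^ K" for j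
    proof -
      have "real j \<le> 2 ^ K" using that by (metis of_nat_less_iff of_nat_numeral of_nat_power less_imp_le)
      then have "real j * d1 \<le> 2 ^ K * d1" using d10 by (rule mult_right_mono)
      moreover have "cmod (cv D Z (snd st' 4 j) (snd st' 5 j) - w ^ j) \<le> j * d1"
      proof -
        have "j \<le> 2 ^ K - 1" using that by linarith
        then show ?thesis using inv by blast
      qed
      ultimately show ?thesis using d unfolding d1_def by linarith
    qed
    moreover have "fst st' 3 = L" "fst st' 4 = 2 ^ K" "fst st' 5 = K" "fst st' 8 = D" "fst st' 9 = Z"
      using agreeD1[OF ag] s by simp_all
    ultimately show "cfg st'" by (simp add: cfg_def)
  qed (use s in simp_all)
qed

lemma hoare_setup_roots:
  fixes st :: store
  assumes s: "fst st 3 = L" "fst st 4 = 2 ^ K" "fst st 5 = K" "fst st 6 = 2 ^ J" "fst st 7 = J"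
    and K: "2 \<le> K" and Dd: "D = 2 ^ (alpha * J)" and Zd: "Z = 2 ^ (beta * J)"
    and R: "D * D < R" and Z: "4 * D + 1 \<le> Z"
    and d: "2 ^ K * (2 * (K * (2 / D) + (1 / D + sqrt (2 * (K * (2 / D))))) + 2 / D) \<le> \<delta>"
  shows "hoare I R M (setup_roots alpha beta) st (200 + 3 * alpha + 3 * beta + (K + 1) * (80 + (alpha * J + 1) * 60) + 2 ^ K * 400) cfg"
proof -
  let ?e = "real K * (2 / D)"
  have D2R: "2 * D < R" using Z ZR by linarith
  define s0 where "s0 = setv 10 0 (setv 9 Z (setv 8 D st))"
  have G: "(2 ^ J) ^ alpha = D" "(2 ^ J) ^ beta = Z" unfolding Dd Zd by (simp_all add: power_mult mult.commute)
  have v0: "fst s0 8 = D" "fst s0 7 = J" "fst s0 5 = K" "fst s0 10 = 0" using s by (simp_all add: s0_def)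
  define s1 where "s1 = sem I (cos_com alpha) s0"
  note 1 = hoareD[OF hoare_cos[OF Dd v0 K KR(2) R D2R, of I M], folded s1_def]
  define C where "C = fst s1 10"
  have C: "\<bar>real C / D - cos (2 * pi / 2 ^ K)\<bar> \<le> ?e" "C \<le> D" using 1(3) by (simp_all add: C_def)
  define x where "x = D * D - C * C"
  define s2 where "s2 = setv 12 x s1"
  have v1: "fst s1 8 = D" "fst s1 7 = J" using agreeD1[OF 1(4), of 8] agreeD1[OF 1(4), of 7] v0 by simp_all
  then have v2: "fst s2 8 = D" "fst s2 7 = J" "fst s2 12 = x" by (simp_all add: s2_def)
  have xD: "x \<le> D * D" by (simp add: x_def)
  have "0 < D * D" using D by simp
  then have "x < 4 * (D * D)" using xD by linarith
  then have "x < (2 * D)\<^sup>2" by (simp add: power2_eq_square)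
  define s3 where "s3 = sem I (isqrt_com alpha) s2"
  note 3 = hoareD[OF hoare_isqrt[OF Dd v2 \<open>x < (2 * D)\<^sup>2\<close> D2R, of I M], folded s3_def]
  define S where "S = fst s3 13"
  have th: "0 \<le> 2 * pi / 2 ^ K" "2 * pi / 2 ^ K \<le> pi"
  proof -
    have "(2::real) ^ 1 \<le> 2 ^ K" using K by (intro power_increasing) auto
    then show "2 * pi / 2 ^ K \<le> pi" by (simp add: field_simps)
  qed simp
  have S: "\<bar>real S / D - sin (2 * pi / 2 ^ K)\<bar> \<le> 1 / D + sqrt (2 * ?e)" "S \<le> D"
    using sin_from_cos[OF D C(2) th C(1), of S] 3(3) by (simp_all add: S_def x_def)
  have v3: "fst s3 x = fst st x" if "x \<in> {3, 4, 5, 6, 7}" for x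
    using that agreeD1[OF 3(4), of x] agreeD1[OF 1(4), of x] by (auto simp: s0_def s2_def)
  have v3': "fst s3 8 = D" "fst s3 9 = Z" "fst s3 10 = C"
    using agreeD1[OF 3(4), of 8] agreeD1[OF 3(4), of 9] agreeD1[OF 3(4), of 10] agreeD1[OF 1(4), of 9] v2
    by (simp_all add: s2_def s0_def C_def)
  define s4 where "s4 = seta 5 0 Z (seta 4 0 (Z + D) (setv 10 (Z + C) (setv 11 (Z + S) s3)))"
  have 4: "hoare I R M table_com s4 (9 + 2 ^ K * 400) cfg"
    by (rule hoare_table[where C = C and S = S, OF _ _ _ _ _ _ _ C(1) S(1) _ _ d Z])
      (use v3 v3' s in \<open>simp_all add: s4_def\<close>)
  note 4 = hoareD[OF this]
  have small: "Z + D < R" "Z + C < R" "Z + S < R" "x < R" "Z < R" "0 < R" "0 < M"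
    using ZR Z C(2) S(2) xD R KM order_less_le_trans[of 0 "2 ^ K" M] by (linarith | simp)+
  have okc: "ok I R M (setup_roots alpha beta) st"
    using 1(1) 3(1) 4(1) s v1 v3' small DR unfolding setup_roots_def
    by (simp add: G s0_def[symmetric] s1_def[symmetric] C_def[symmetric] x_def[symmetric] s2_def[symmetric]
      s3_def[symmetric] S_def[symmetric] s4_def[symmetric])
  have sm: "sem I (setup_roots alpha beta) st = sem I table_com s4"
    using s v1 v3' unfolding setup_roots_def
    by (simp add: G s0_def[symmetric] s1_def[symmetric] C_def[symmetric] x_def[symmetric] s2_def[symmetric]
      s3_def[symmetric] S_def[symmetric] s4_def[symmetric])
  have ct: "cost I (setup_roots alpha beta) st = 3 * alpha + 3 * beta + 55 + cost I (cos_com alpha) s0 + cost I (isqrt_com alpha) s2 + cost I table_com s4"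
    using s v1 v3' unfolding setup_roots_def
    by (simp add: G s0_def[symmetric] s1_def[symmetric] C_def[symmetric] x_def[symmetric] s2_def[symmetric]
      s3_def[symmetric] S_def[symmetric] s4_def[symmetric])
  show ?thesis unfolding hoare_def using okc 4(3) sm 1(2) 3(2) 4(2) ct by (simp add: algebra_simps)
qed

end

subsection \<open>Searching block by block\<close>

definition pat_exp :: exp where
  "pat_exp = Pat (ad (ml (Var 28) (Var 3)) (Var 21))"

text \<open>The shift by one matches the encoding of pattern symbols, where 0 is reserved for the
  wildcard. Beyond the text the value is 1; alignments that reach there are rejected by
  \<open>match_test\<close>.\<close>

definition txt_exp :: exp where
  "txt_exp = ad (Txt (ad (ad (ml (Var 26) (Var 3)) (ml (Var 28) (Var 3))) (Var 21))) (Num 1)"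

text \<open>Since 0 div 0 = 0, the quotient x div x is the indicator of x > 0.\<close>

definition in_block :: exp where
  "in_block = dv (su (Var 3) (Var 21)) (su (Var 3) (Var 21))"

definition block_com :: com where
  "block_com = Seq (corr (ml in_block pat_exp) txt_exp 8)
     (corr (ml in_block (dv pat_exp pat_exp)) (ml txt_exp txt_exp) 9)"

definition clear_com :: com where
  "clear_com = For 17 18 (Var 3) (Seq (Sto 8 (Var 17) (Num 0)) (Sto 9 (Var 17) (Num 0)))"

text \<open>A conjunction as a product. The first factor is nonzero iff i + m <= n. In the second,
  the sum of the two truncated differences is the distance between both sides of
  \<open>match_iff_sums\<close>, so the factor is 1 on equality and 0 otherwise.\<close>

definition match_test :: exp where
  "match_test = ml (su (ad TLen (Num 1)) (ad (ad (ml (Var 26) (Var 3)) (Var 17)) PLen))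
     (su (Num 1) (ad (su (ad (Var 30) (Arr 9 (Var 17))) (ml (Num 2) (Arr 8 (Var 17))))
                     (su (ml (Num 2) (Arr 8 (Var 17))) (ad (Var 30) (Arr 9 (Var 17))))))"

definition check_com :: com where
  "check_com = For 17 18 (Var 3)
     (If match_test (Asg 0 (ad (ad (ml (Var 26) (Var 3)) (Var 17)) (Num 1))) Skip)"

text \<open>With one block more than the quotient, the blocks always cover the pattern; what lies
  beyond it reads as 0 and contributes nothing.\<close>

definition window_com :: com where
  "window_com = Seq clear_com (Seq (For 28 29 (ad (dv PLen (Var 3)) (Num 1)) block_com) check_com)"

definition energy_com :: com where
  "energy_com = Seq (Asg 30 (Num 0))
     (For 17 18 PLen (Asg 30 (ad (Var 30) (ml (Pat (Var 17)) (Pat (Var 17))))))"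

definition search_com :: com where
  "search_com = Seq energy_com (For 26 27 (ad (dv TLen (Var 3)) (Num 1)) window_com)"

definition wpm_com :: "nat \<Rightarrow> nat \<Rightarrow> com" where
  "wpm_com alpha beta = Seq setup_block (Seq setup_base (Seq (setup_roots alpha beta) search_com))"

lemma vars_main [simp]: "vars block_com = {19, 20, 21, 22, 23, 24, 25}" "vars clear_com = {17, 18}"
  "vars check_com = {0, 17, 18}" "vars energy_com = {17, 18, 30}"
  "vars window_com = {0, 17, 18, 19, 20, 21, 22, 23, 24, 25, 28, 29}"
  by (auto simp: block_com_def clear_com_def check_com_def window_com_def energy_com_def)

lemma arrs_main [simp]: "arrs block_com = {0, 1, 2, 3, 6, 7, 8, 9}" "arrs clear_com = {8, 9}"
  "arrs check_com = {}" "arrs energy_com = {}" "arrs window_com = {0, 1, 2, 3, 6, 7, 8, 9}"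
  by (auto simp: block_com_def clear_com_def check_com_def window_com_def energy_com_def)

lemma wf_com_main: "wf_com block_com" "wf_com clear_com" "wf_com check_com" "wf_com energy_com" "wf_com window_com"
  "wf_com search_com"
proof -
  show 1: "wf_com block_com" "wf_com clear_com" "wf_com check_com" "wf_com energy_com"
    by (simp_all add: block_com_def in_block_def pat_exp_def txt_exp_def clear_com_def check_com_def
      match_test_def energy_com_def)
  then show 2: "wf_com window_com" by (simp add: window_com_def)
  show "wf_com search_com" using 1 2 by (simp add: search_com_def)
qed

declare wf_com_main [simp]

lemma wf_com_wpm_com: "wf_com (wpm_com alpha beta)"
  by (simp add: wpm_com_def)

section \<open>Correctness of the search by blocks\<close>

lemma sum_lessThan_add: "(\<Sum>j<n + k. f j) = (\<Sum>j<n. f j) + (\<Sum>j<k. f (n + j))"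
  for f :: "nat \<Rightarrow> 'a::comm_monoid_add"
  by (induction k) (simp_all add: add.assoc)

text \<open>Zero padding restricts b to b < L, so b + u < 2 L < N and the cyclic correlation
  coincides with the ordinary one.\<close>

lemma sum_block:
  fixes f g :: "nat \<Rightarrow> nat"
  assumes "N = 4 * L" "u < L"
  shows "(\<Sum>b<N. (if b < L then f b else 0) * g ((b + u) mod N)) = (\<Sum>b<L. f b * g (b + u))"
proof -
  have "(\<Sum>b<N. (if b < L then f b else 0) * g ((b + u) mod N)) = (\<Sum>b<L. (if b < L then f b else 0) * g ((b + u) mod N))"
    using assms by (intro sum.mono_neutral_right) auto
  also have "\<dots> = (\<Sum>b<L. f b * g (b + u))" using assms by (intro sum.cong) auto
  finally show ?thesis .
qed

locale matcher = correlator +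
  assumes pX: "\<And>j. pat_at I j \<le> X" and tX: "\<And>j. (txt_at I j + 1) * (txt_at I j + 1) \<le> X"
    and RX: "(length (in_pat I) + L) * (X * X) < R"
    and Rn: "length (in_text I) + 2 < R" "length (in_pat I) + 2 < R"
begin

abbreviation "n \<equiv> length (in_text I)"
abbreviation "m \<equiv> length (in_pat I)"
abbreviation "p \<equiv> pat_at I"
abbreviation "t i \<equiv> txt_at I i + 1"

definition occurs :: "nat \<Rightarrow> bool" where
  "occurs i \<longleftrightarrow> i + m \<le> n \<and> (\<forall>j<m. p j = 0 \<or> p j = t (i + j))"

lemma p_ge: "m \<le> j \<Longrightarrow> p j = 0"
  by (simp add: pat_at_def)

lemma p_pos: "0 < p j \<Longrightarrow> j < m" "0 < p j div p j \<Longrightarrow> j < m"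
  using p_ge[of j] by (auto simp: not_less[symmetric] intro: ccontr)

lemma X1: "1 \<le> X"
  using tX[of 0] by simp

lemma tX1: "t j \<le> X"
  by (rule order_trans[OF le_square tX])

lemma ind_le: "p j div p j \<le> X"
  using X1 by (cases "p j = 0") auto

lemma sum_bound:
  assumes "\<And>j. f j \<le> X * X" "k \<le> m + L"
  shows "(\<Sum>j<k. f j) < R"
proof -
  have "(\<Sum>j<k. f j) \<le> k * (X * X)" using sum_bounded_above[of "{..<k}" f "X * X"] assms(1) by simp
  also have "\<dots> \<le> (m + L) * (X * X)" using assms(2) by (rule mult_le_mono1)
  finally show ?thesis using RX by linarith
qed

definition partial :: "nat \<Rightarrow> nat \<Rightarrow> store \<Rightarrow> bool" where
  "partial a k st \<longleftrightarrow> (\<forall>u<L. snd st 8 u = (\<Sum>j<k. p j * t (a * L + u + j)) \<and>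
     snd st 9 u = (\<Sum>j<k. (p j div p j) * (t (a * L + u + j) * t (a * L + u + j))))"

lemma hoare_block:
  assumes c: "cfg st" and a: "fst st 26 = a" and b: "fst st 28 = b" "b \<le> m div L"
    and P: "partial a (b * L) st"
  shows "hoare I R M block_com st (3000 * (2 ^ K * (K + 1))) (partial a (Suc b * L))"
proof -
  let ?p1 = "\<lambda>j. if j < L then p (b * L + j) else 0"
  let ?p2 = "\<lambda>j. if j < L then p (b * L + j) div p (b * L + j) else 0"
  let ?t1 = "\<lambda>j. t (a * L + b * L + j)"
  let ?t2 = "\<lambda>j. t (a * L + b * L + j) * t (a * L + b * L + j)"
  have "b * L \<le> m" using b(2) L by (meson div_le_dividend le_trans mult_le_mono1 div_times_less_eq_dividend)
  then have bL: "b * L + L \<le> m + L" by simp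
  have s1: "(\<Sum>j<b * L. p j * t (a * L + u + j)) + (\<Sum>j<2 ^ K. ?p1 j * ?t1 ((j + u) mod 2 ^ K)) =
      (\<Sum>j<b * L + L. p j * t (a * L + u + j))" if "u < L" for u
    unfolding sum_block[OF KL that, of "\<lambda>j. p (b * L + j)" ?t1] sum_lessThan_add
    by (simp only: add_ac)
  have s2: "(\<Sum>j<b * L. (p j div p j) * (t (a * L + u + j) * t (a * L + u + j))) + (\<Sum>j<2 ^ K. ?p2 j * ?t2 ((j + u) mod 2 ^ K)) =
      (\<Sum>j<b * L + L. (p j div p j) * (t (a * L + u + j) * t (a * L + u + j)))" if "u < L" for u
    unfolding sum_block[OF KL that, of "\<lambda>j. p (b * L + j) div p (b * L + j)" ?t2] sum_lessThan_add
    by (simp only: add_ac)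
  have l1: "p j * t i \<le> X * X" for i j using pX[of j] tX1[of i] by (intro mult_le_mono) auto
  have l2: "(p j div p j) * (t i * t i) \<le> X * X" for i j using ind_le[of j] tX[of i] by (intro mult_le_mono) auto
  let ?c1 = "corr (ml in_block pat_exp) txt_exp 8"
  let ?c2 = "corr (ml in_block (dv pat_exp pat_exp)) (ml txt_exp txt_exp) 9"
  have 1: "hoare I R M ?c1 st (1500 * (2 ^ K * (K + 1))) (\<lambda>st'. \<forall>u<L. snd st' 8 u =
      snd st 8 u + (\<Sum>j<2 ^ K. ?p1 j * ?t1 ((j + u) mod 2 ^ K)))"
  proof (rule hoare_corr[OF c])
    fix st' :: store and j
    assume "fst st' 21 = j" "\<And>x. x \<notin> {19..25} \<Longrightarrow> fst st' x = fst st x"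
    then have v: "fst st' 21 = j" "fst st' 3 = L" "fst st' 26 = a" "fst st' 28 = b"
      using c a b by (auto simp: cfg_def)
    show "val I (ml in_block pat_exp) st' = ?p1 j \<and> idx_ok I M (ml in_block pat_exp) st'"
      using v by (simp add: in_block_def pat_exp_def)
    show "val I txt_exp st' = ?t1 j \<and> idx_ok I M txt_exp st'" using v by (simp add: txt_exp_def)
  next
    fix u assume u: "u < L"
    show "snd st 8 u + (\<Sum>j<2 ^ K. ?p1 j * ?t1 ((j + u) mod 2 ^ K)) < R"
      using sum_bound[OF l1 bL, of "\<lambda>j. j" "\<lambda>j. a * L + u + j"] P u s1[OF u] by (simp add: partial_def)
  qed (use pX tX1 in \<open>simp_all add: in_block_def pat_exp_def txt_exp_def\<close>)
  note 1 = hoareD[OF 1]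
  define s where "s = sem I ?c1 st"
  have c2: "cfg s" using cfg_agree[OF 1(4) c] by (auto simp: s_def)
  have a2: "fst s 26 = a" "fst s 28 = b" "snd s 9 = snd st 9"
    using agreeD1[OF 1(4), of 26] agreeD1[OF 1(4), of 28] agreeD2[OF 1(4), of 9] a b by (simp_all add: s_def)
  have 2: "hoare I R M ?c2 s (1500 * (2 ^ K * (K + 1))) (\<lambda>st'. \<forall>u<L. snd st' 9 u =
      snd s 9 u + (\<Sum>j<2 ^ K. ?p2 j * ?t2 ((j + u) mod 2 ^ K)))"
  proof (rule hoare_corr[OF c2])
    fix st' :: store and j
    assume "fst st' 21 = j" "\<And>x. x \<notin> {19..25} \<Longrightarrow> fst st' x = fst s x"
    then have v: "fst st' 21 = j" "fst st' 3 = L" "fst st' 26 = a" "fst st' 28 = b"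
      using c2 a2 by (auto simp: cfg_def)
    show "val I (ml in_block (dv pat_exp pat_exp)) st' = ?p2 j \<and> idx_ok I M (ml in_block (dv pat_exp pat_exp)) st'"
      using v by (simp add: in_block_def pat_exp_def)
    show "val I (ml txt_exp txt_exp) st' = ?t2 j \<and> idx_ok I M (ml txt_exp txt_exp) st'" using v by (simp add: txt_exp_def)
  next
    fix u assume u: "u < L"
    show "snd s 9 u + (\<Sum>j<2 ^ K. ?p2 j * ?t2 ((j + u) mod 2 ^ K)) < R"
      using sum_bound[OF l2 bL, of "\<lambda>j. j" "\<lambda>j. a * L + u + j"] P u s2[OF u] a2(3) by (simp add: partial_def)
  qed (use ind_le tX in \<open>simp_all add: in_block_def pat_exp_def txt_exp_def\<close>)
  note 2 = hoareD[OF 2]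
  have "snd (sem I ?c2 s) 8 = snd s 8" using agreeD2[OF 2(4), of 8] by simp
  then have "partial a (Suc b * L) (sem I ?c2 s)"
    using 1(3) 2(3) P s1 s2 a2(3) unfolding partial_def s_def[symmetric] by (simp add: add.commute[of L])
  then show ?thesis
    using 1(1,2) 2(1,2) unfolding hoare_def block_com_def by (simp add: s_def)
qed

text \<open>Nothing is claimed about which occurrence is reported: later hits overwrite earlier
  ones. The value 0 asserts absence only among the alignments tested so far.\<close>

definition found :: "nat \<Rightarrow> store \<Rightarrow> bool" where
  "found k st \<longleftrightarrow> (if fst st 0 = 0 then \<forall>i<k. \<not> occurs i else occurs (fst st 0 - 1))"

lemma hoare_clear:
  assumes c: "cfg st"
  shows "hoare I R M clear_com st (7 + L * 30) (partial a 0)"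
  unfolding clear_com_def
proof (rule hoare_For[where n = L and t = 24 and Inv = "\<lambda>i st'. \<forall>u<i. snd st' 8 u = 0 \<and> snd st' 9 u = 0"])
  fix i and st' :: store
  assume "i < L" "fst st' 17 = i" "\<forall>u<i. snd st' 8 u = 0 \<and> snd st' 9 u = 0"
  then show "hoare I R M (Seq (Sto 8 (Var 17) (Num 0)) (Sto 9 (Var 17) (Num 0))) st' 24
      (\<lambda>st''. \<forall>u<Suc i. snd (setv 17 (Suc i) st'') 8 u = 0 \<and> snd (setv 17 (Suc i) st'') 9 u = 0)"
    using KL KM KR by (auto simp: hoare_def less_Suc_eq)
qed (use c KL KR in \<open>auto simp: partial_def cfg_def\<close>)

lemma hoare_check:
  assumes c: "cfg st" and a: "fst st 26 = a" and P: "partial a m st" and e: "fst st 30 = (\<Sum>j<m. p j * p j)"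
    and F: "found (a * L) st"
  shows "hoare I R M check_com st (7 + L * 120) (found (Suc a * L))"
  unfolding check_com_def
proof (rule hoare_For[where n = L and t = 114 and Inv = "\<lambda>u st'. found (a * L + u) st'"])
  let ?body = "If match_test (Asg 0 (ad (ad (ml (Var 26) (Var 3)) (Var 17)) (Num 1))) Skip"
  fix u and st' :: store
  assume u: "u < L" "fst st' 17 = u" and ag: "agree (vars (For 17 18 (Var 3) ?body)) (arrs ?body) st st'"
    and inv: "found (a * L + u) st'"
  have v: "fst st' 26 = a" "fst st' 3 = L" "fst st' 30 = (\<Sum>j<m. p j * p j)" "snd st' 8 = snd st 8" "snd st' 9 = snd st 9"
    using agreeD1[OF ag] agreeD2[OF ag] c a e by (auto simp: cfg_def)
  define i where "i = a * L + u"
  have s8: "snd st 8 u = (\<Sum>j<m. p j * t (i + j))"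
    and s9: "snd st 9 u = (\<Sum>j<m. (p j div p j) * (t (i + j) * t (i + j)))"
    using P u by (simp_all add: partial_def i_def)
  have uM: "u < M" using u KL KM by simp
  have "val I match_test st' = (n + 1 - (i + m)) * (1 - (((\<Sum>j<m. p j * p j) + snd st 9 u - 2 * snd st 8 u) +
      (2 * snd st 8 u - ((\<Sum>j<m. p j * p j) + snd st 9 u))))"
    using v u by (simp add: match_test_def i_def)
  moreover have "x * (1 - ((y - z) + (z - y))) \<noteq> 0 \<longleftrightarrow> x \<noteq> 0 \<and> y = z" for x y z :: nat by auto
  ultimately have "val I match_test st' \<noteq> 0 \<longleftrightarrow> n + 1 - (i + m) \<noteq> 0 \<and>
      (\<Sum>j<m. p j * p j) + snd st 9 u = 2 * snd st 8 u" by presburger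
  also have "n + 1 - (i + m) \<noteq> 0 \<longleftrightarrow> i + m \<le> n" by auto
  finally have test: "val I match_test st' \<noteq> 0 \<longleftrightarrow> occurs i"
    unfolding occurs_def s8 s9 match_iff_sums .
  have ld: "idx_ok I M match_test st'" using u uM by (simp add: match_test_def)
  have len: "elen match_test \<le> 90" by (simp add: match_test_def)
  show "hoare I R M ?body st' 114 (\<lambda>st''. found (a * L + Suc u) (setv 17 (Suc u) st''))"
  proof (cases "occurs i")
    case True
    then have "i + 1 < R" using Rn by (simp add: occurs_def)
    then show ?thesis using True test ld len v u
      by (simp add: hoare_def found_def i_def)
  next
    case False
    then have "found (a * L + Suc u) (setv 17 (Suc u) st')"
      using inv by (auto simp: found_def i_def less_Suc_eq)
    then show ?thesis using False test ld len by (simp add: hoare_def)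
  qed
next
  fix st' :: store assume "found (a * L + L) st'"
  then show "found (Suc a * L) st'" by (simp add: add.commute)
qed (use c KL KR F in \<open>auto simp: found_def cfg_def match_test_def\<close>)

definition window_time :: nat where
  "window_time = 30 + L * 150 + (m div L + 1) * (3000 * (2 ^ K * (K + 1)) + 6)"

text \<open>The last block may overshoot the pattern; \<open>pat_at\<close> is 0 from m on, so both
  sums can be cut back to m.\<close>

lemma partial_all: "m \<le> k \<Longrightarrow> partial a k st \<Longrightarrow> partial a m st"
proof -
  assume k: "m \<le> k" and P: "partial a k st"
  have "(\<Sum>j<k. p j * f j) = (\<Sum>j<m. p j * f j)" "(\<Sum>j<k. (p j div p j) * f j) = (\<Sum>j<m. (p j div p j) * f j)" for f
    using k by (auto intro!: sum.mono_neutral_right intro: p_pos)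
  then show ?thesis using P unfolding partial_def by (simp only:)
qed

lemma hoare_window:
  assumes c: "cfg st" and a: "fst st 26 = a" and e: "fst st 30 = (\<Sum>j<m. p j * p j)"
    and F: "found (a * L) st"
  shows "hoare I R M window_com st window_time (found (Suc a * L))"
proof -
  define s1 where "s1 = sem I clear_com st"
  note 1 = hoareD[OF hoare_clear[OF c, of a], folded s1_def]
  have c1: "cfg s1" using cfg_agree[OF 1(4) c] by auto
  have a1: "fst s1 26 = a" "fst s1 30 = (\<Sum>j<m. p j * p j)" "fst s1 0 = fst st 0"
    using agreeD1[OF 1(4)] a e by auto
  let ?blocks = "For 28 29 (ad (dv PLen (Var 3)) (Num 1)) block_com"
  have "hoare I R M ?blocks s1 (12 + (m div L + 1) * (3000 * (2 ^ K * (K + 1)) + 6)) (partial a m)"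
  proof (rule hoare_For[where n = "m div L + 1" and t = "3000 * (2 ^ K * (K + 1))" and
      Inv = "\<lambda>b st'. partial a (b * L) st'"])
    show "m div L + 1 < R" using Rn(2) div_le_dividend[of m L] by linarith
  next
    fix b and st' :: store
    assume b: "b < m div L + 1" "fst st' 28 = b" and ag: "agree (vars ?blocks) (arrs block_com) s1 st'"
      and inv: "partial a (b * L) st'"
    have ct: "cfg st'" using cfg_agree[OF ag c1] by auto
    have at: "fst st' 26 = a" using agreeD1[OF ag, of 26] a1 by simp
    have "b \<le> m div L" using b by simp
    from hoare_block[OF ct at b(2) this inv]
    show "hoare I R M block_com st' (3000 * (2 ^ K * (K + 1))) (\<lambda>st''. partial a (Suc b * L) (setv 28 (Suc b) st''))"
      by (rule hoare_conseq) (auto simp: partial_def)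
  next
    fix st' :: store assume "partial a ((m div L + 1) * L) st'"
    moreover have "m \<le> (m div L + 1) * L" using L dividend_less_div_times[of L m] by simp
    ultimately show "partial a m st'" by (rule partial_all[rotated])
  qed (use c1 1(3) in \<open>auto simp: cfg_def partial_def\<close>)
  note 2 = hoareD[OF this]
  define s2 where "s2 = sem I ?blocks s1"
  have c2: "cfg s2" using cfg_agree[OF 2(4) c1] by (auto simp: s2_def)
  have a2: "fst s2 26 = a" "fst s2 30 = (\<Sum>j<m. p j * p j)" "fst s2 0 = fst st 0"
    using agreeD1[OF 2(4)] a1 by (auto simp: s2_def)
  have "found (a * L) s2" using F unfolding found_def a2(3) .
  from hoareD[OF hoare_check[OF c2 a2(1) 2(3)[folded s2_def] a2(2) this]]
  have 3: "ok I R M check_com s2" "cost I check_com s2 \<le> 7 + L * 120" "found (Suc a * L) (sem I check_com s2)" by blast+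
  have "sem I window_com st = sem I check_com s2"
    "cost I window_com st = cost I clear_com st + (cost I ?blocks s1 + cost I check_com s2)"
    "ok I R M window_com st \<longleftrightarrow> ok I R M clear_com st \<and> ok I R M ?blocks s1 \<and> ok I R M check_com s2"
    unfolding window_com_def sem.simps(4) cost.simps(4) ok.simps(4) s1_def s2_def by blast+
  then show ?thesis unfolding hoare_def window_time_def using 1(1,2) 2(1,2) 3 by simp
qed

lemma hoare_search:
  assumes c: "cfg st" and s0: "fst st 0 = 0"
  shows "hoare I R M search_com st (30 + m * 30 + (n div L + 1) * (window_time + 6))
    (\<lambda>st'. if fst st' 0 = 0 then \<forall>i. \<not> occurs i else occurs (fst st' 0 - 1))"
proof -
  let ?e = "For 17 18 PLen (Asg 30 (ad (Var 30) (ml (Pat (Var 17)) (Pat (Var 17)))))"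
  have l1: "p j * p j \<le> X * X" for j using pX[of j] by (intro mult_le_mono) auto
  have "hoare I R M ?e (setv 30 0 st) (6 + m * 30) (\<lambda>st'. fst st' 30 = (\<Sum>j<m. p j * p j))"
  proof (rule hoare_For[where n = m and t = 24 and Inv = "\<lambda>i st'. fst st' 30 = (\<Sum>j<i. p j * p j)"])
    fix i and st' :: store
    assume i: "i < m" "fst st' 17 = i" "fst st' 30 = (\<Sum>j<i. p j * p j)"
    have "(\<Sum>j<Suc i. p j * p j) < R" using i(1) by (intro sum_bound l1) simp
    then show "hoare I R M (Asg 30 (ad (Var 30) (ml (Pat (Var 17)) (Pat (Var 17))))) st' 24
        (\<lambda>st''. fst (setv 17 (Suc i) st'') 30 = (\<Sum>j<Suc i. p j * p j))"
      using i by (simp add: hoare_def)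
  qed (use Rn in auto)
  note 1 = hoareD[OF this]
  define s1 where "s1 = sem I ?e (setv 30 0 st)"
  have "cfg (setv 30 0 st)" using c by (simp add: cfg_def)
  then have c1: "cfg s1" using cfg_agree[OF 1(4)] by (auto simp: s1_def)
  have a1: "fst s1 30 = (\<Sum>j<m. p j * p j)" "fst s1 0 = 0"
    using agreeD1[OF 1(4), of 0] 1(3) s0 by (simp_all add: s1_def)
  let ?w = "For 26 27 (ad (dv TLen (Var 3)) (Num 1)) window_com"
  have "hoare I R M ?w s1 (12 + (n div L + 1) * (window_time + 6)) (\<lambda>st'. if fst st' 0 = 0 then \<forall>i. \<not> occurs i else occurs (fst st' 0 - 1))"
  proof (rule hoare_For[where n = "n div L + 1" and t = window_time and Inv = "\<lambda>a st'. found (a * L) st'"])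
    show "n div L + 1 < R" using Rn(1) div_le_dividend[of n L] by linarith
  next
    fix a and st' :: store
    assume a: "a < n div L + 1" "fst st' 26 = a" and ag: "agree (vars ?w) (arrs window_com) s1 st'"
      and inv: "found (a * L) st'"
    have ct: "cfg st'" using cfg_agree[OF ag c1] by auto
    have at: "fst st' 30 = (\<Sum>j<m. p j * p j)" using agreeD1[OF ag, of 30] a1 by simp
    from hoare_window[OF ct a(2) at inv]
    show "hoare I R M window_com st' window_time (\<lambda>st''. found (Suc a * L) (setv 26 (Suc a) st''))"
      by (rule hoare_conseq) (auto simp: found_def)
  next
    fix st' :: store assume F: "found ((n div L + 1) * L) st'"
    have "n < (n div L + 1) * L" using L dividend_less_div_times[of L n] by simp
    \<comment> \<open>An occurrence satisfies i <= n, so the windows that were searched contain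
      every candidate.\<close>
    then have "occurs i \<Longrightarrow> i < (n div L + 1) * L" for i unfolding occurs_def by linarith
    then show "if fst st' 0 = 0 then \<forall>i. \<not> occurs i else occurs (fst st' 0 - 1)"
      using F unfolding found_def by metis
  qed (use c1 a1 in \<open>auto simp: cfg_def found_def\<close>)
  note 2 = hoareD[OF this]
  define wc where "wc = ?w"
  define ec where "ec = ?e"
  note 1 = 1[folded ec_def] and 2 = 2[folded wc_def]
  have sm: "sem I search_com st = sem I wc s1"
    and ct: "cost I search_com st = 3 + cost I ec (setv 30 0 st) + cost I wc s1"
    and okc: "ok I R M search_com st \<longleftrightarrow> ok I R M ec (setv 30 0 st) \<and> ok I R M wc s1"
    using Rn unfolding search_com_def energy_com_def wc_def[symmetric] ec_def[symmetric] s1_def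
    by (simp_all add: ec_def[symmetric])
  show ?thesis unfolding hoare_def sm
  proof (intro conjI)
    show "cost I search_com st \<le> 30 + m * 30 + (n div L + 1) * (window_time + 6)"
      using 1(2) 2(2) unfolding ct by linarith
  qed (use 1(1) 2(1,3) okc in blast)+
qed

end

text \<open>The condition i + m <= n guarantees that the text is read inside its range, where
  \<open>txt_at\<close> is not the default value. Both encodings are shifted by one, so comparing
  codes is comparing symbols.\<close>

lemma matches_at_iff:
  "matches_at T P i \<longleftrightarrow> i + length P \<le> length T \<and>
    (\<forall>j<length P. pat_at (T, P, s) j = 0 \<or> pat_at (T, P, s) j = txt_at (T, P, s) (i + j) + 1)"
proof -
  have "P ! j = None \<or> P ! j = Some (T ! (i + j)) \<longleftrightarrow>
      pat_at (T, P, s) j = 0 \<or> pat_at (T, P, s) j = txt_at (T, P, s) (i + j) + 1"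
    if "j < length P" "i + length P \<le> length T" for j
    using that by (cases "P ! j") (auto simp: pat_at_def txt_at_def in_pat_def in_text_def)
  then show ?thesis unfolding matches_at_def by blast
qed

subsection \<open>Choice of the precision\<close>

locale precision =
  fixes G K d :: nat
  assumes G: "2 \<le> G" and NG: "2 ^ K \<le> G ^ 3"
begin

text \<open>The exponents are found backwards. The final error turns out to be at most G^(31 + 4 d)
  \<open>eps\<close>, which fixes \<open>margin\<close>. Since the sine costs a square root, D must
  dominate the square of G^\<open>margin\<close>, and the further 5 absorbs 4 K. The offset exceeds
  D by the largest magnitude of the last transform, see \<open>offset_bound\<close>.\<close>

definition margin :: nat where "margin = 31 + 4 * d"
definition alpha :: nat where "alpha = 2 * margin + 5"
definition beta :: nat where "beta = alpha + 11 + 4 * d"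

abbreviation "g \<equiv> real G"
abbreviation "D \<equiv> G ^ alpha"
abbreviation "Z \<equiv> G ^ beta"
abbreviation "X \<equiv> G ^ (2 * d)"

definition eps :: real where "eps = 1 / g ^ margin"
text \<open>The accuracy of the table of roots: three powers of G pay for its 2^K entries and three
  for the numerical factor 8 of a single step.\<close>

definition del :: real where "del = g ^ 6 * eps"

lemma g2: "2 \<le> g"
  using G by simp

lemma gpos: "0 < g ^ k"
  using g2 by simp

lemma g_mono: "a \<le> b \<Longrightarrow> g ^ a \<le> g ^ b"
  using g2 by (intro power_increasing) auto

lemma g_ge_1: "1 \<le> g ^ a"
  using g2 by (intro one_le_power) auto

lemma g_double: "2 * g ^ a \<le> g ^ Suc a"
  using g2 gpos[of a] by simp

lemma g_add: "a \<le> c \<Longrightarrow> b \<le> c \<Longrightarrow> g ^ a + g ^ b \<le> g ^ Suc c"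
  using g_mono[of a c] g_mono[of b c] g_double[of c] by linarith

lemma eps: "0 < eps" "eps \<le> 1"
  using gpos[of margin] g_ge_1[of margin] by (auto simp: eps_def)

lemma N: "2 ^ K \<le> g ^ 3"
  using NG of_nat_mono[OF NG, where 'a = real] by simp

lemma three_K: "3 ^ K \<le> g ^ 6"
proof -
  have "(3::real) ^ K \<le> 4 ^ K" by (intro power_mono) auto
  also have "\<dots> = (2 ^ K) ^ 2" by (simp add: power_mult[symmetric] mult.commute[of K] power_mult)
  also have "\<dots> \<le> (g ^ 3) ^ 2" using N by (intro power_mono) auto
  finally show ?thesis by (simp add: power_mult[symmetric])
qed

lemma two_D: "2 / real D \<le> eps"
proof -
  have "2 * g ^ margin \<le> g ^ Suc margin" by (rule g_double)
  also have "\<dots> \<le> g ^ alpha" by (rule g_mono) (simp add: alpha_def)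
  finally show ?thesis using gpos[of margin] gpos[of alpha] by (simp add: eps_def field_simps)
qed

lemma del: "0 \<le> del" "del \<le> 1"
proof -
  show "0 \<le> del" using eps gpos[of 6] by (simp add: del_def)
  have "g ^ 6 \<le> g ^ margin" by (rule g_mono) (simp add: margin_def)
  then show "del \<le> 1" using gpos[of margin] by (simp add: del_def eps_def)
qed

lemma root_precision:
  "2 ^ K * (2 * (K * (2 / D) + (1 / D + sqrt (2 * (K * (2 / D))))) + 2 / D) \<le> del"
proof -
  have "real K \<le> 2 ^ K" using less_imp_le[OF less_exp[of K]] of_nat_mono[of K "2 ^ K", where 'a = real] by simp
  then have K: "real K \<le> g ^ 3" using N by linarith
  have "4 * real K \<le> 2 * (2 * g ^ 3)" using K by simp
  also have "\<dots> \<le> 2 * g ^ 4" using g_double[of 3] by simp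
  also have "\<dots> \<le> g ^ 5" using g_double[of 4] by simp
  finally have K4: "4 * real K \<le> g ^ 5" .
  have D: "real D = g ^ 5 * (g ^ margin)\<^sup>2" by (simp add: alpha_def power_add power_mult[symmetric] mult.commute)
  have "2 * (K * (2 / D)) \<le> eps\<^sup>2"
    unfolding D eps_def using K4 gpos[of margin] gpos[of 5] by (simp add: field_simps power_divide)
  note ke = this
  have se: "sqrt (2 * (K * (2 / D))) \<le> eps" using ke eps by (intro real_le_lsqrt) auto
  have ee: "eps\<^sup>2 \<le> eps" using eps by (simp add: power2_eq_square)
  have D0: "0 \<le> 1 / real D" "2 / real D = 2 * (1 / real D)" "0 \<le> K * (2 / real D)" by simp_all
  \<comment> \<open>Replacing the quotients and the square root by variables leaves a purely linear
    inequality.\<close>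
  have "2 * a \<le> e2 \<Longrightarrow> s \<le> e \<Longrightarrow> e2 \<le> e \<Longrightarrow> 0 \<le> b \<Longrightarrow> q = 2 * b \<Longrightarrow> 0 \<le> a \<Longrightarrow> q \<le> e \<Longrightarrow>
      2 * (a + (b + s)) + q \<le> 8 * e" for a b e e2 s q :: real
    unfolding distrib_left by linarith
  from this[OF ke se ee D0 two_D]
  have "2 * (K * (2 / D) + (1 / D + sqrt (2 * (K * (2 / D))))) + 2 / D \<le> 8 * eps" .
  then have "2 ^ K * (2 * (K * (2 / D) + (1 / D + sqrt (2 * (K * (2 / D))))) + 2 / D) \<le> g ^ 3 * (8 * eps)"
    using N gpos[of 3] by (intro mult_mono) auto
  also have "\<dots> = g ^ 3 * 8 * eps" by simp
  also have "\<dots> \<le> g ^ 3 * g ^ 3 * eps"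
  proof -
    have "(2::real) ^ 3 \<le> g ^ 3" using g2 by (intro power_mono) auto
    then show ?thesis using gpos[of 3] eps by (intro mult_right_mono mult_left_mono) auto
  qed
  also have "\<dots> = del" by (simp add: del_def power_add[symmetric])
  finally show ?thesis .
qed

definition err :: "real \<Rightarrow> real \<Rightarrow> real" where
  "err e x = 3 ^ K * (e + (del * 2 ^ K * x + 2 / D))"

text \<open>The bookkeeping rule for one transform: 6 of the 8 extra powers of G are the tripling, 2
  absorb the sum of three terms. The 9 in the side condition is 6 from \<open>del\<close> and 3 from
  the transform length.\<close>

lemma err_le:
  assumes e: "0 \<le> e" "e \<le> g ^ a * eps" and x: "0 \<le> x" "x \<le> g ^ b" and ab: "a \<le> c" "b + 9 \<le> c"
  shows "0 \<le> err e x" "err e x \<le> g ^ (c + 8) * eps"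
proof -
  have "0 \<le> del * 2 ^ K * x + 2 / D" using del x by simp
  then show "0 \<le> err e x" unfolding err_def using e by simp
  have "del * 2 ^ K * x \<le> del * g ^ 3 * g ^ b"
    using N x del gpos[of 3] by (intro mult_mono) auto
  also have "\<dots> = g ^ (b + 9) * eps"
    unfolding del_def by (simp add: power_add[symmetric] mult.commute mult.left_commute)
  also have "\<dots> \<le> g ^ c * eps" using g_mono[OF ab(2)] eps by (intro mult_right_mono) auto
  finally have 1: "del * 2 ^ K * x \<le> g ^ c * eps" .
  have 2: "e \<le> g ^ c * eps"
    using e g_mono[OF ab(1)] eps by (meson mult_right_mono order_trans less_imp_le)
  have 3: "2 / D \<le> g ^ c * eps"
    using two_D mult_right_mono[OF g_ge_1[of c], of eps] eps by linarith
  have "e + (del * 2 ^ K * x + 2 / D) \<le> 4 * (g ^ c * eps)"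
    using 1 2 3 gpos[of c] eps by (smt (verit) mult_pos_pos)
  also have "\<dots> = 2 * (2 * g ^ c) * eps" by simp
  also have "\<dots> \<le> g ^ (c + 2) * eps"
    using g_double[of c] g_double[of "Suc c"] eps by (intro mult_right_mono) auto
  finally have "err e x \<le> g ^ 6 * (g ^ (c + 2) * eps)"
    unfolding err_def using three_K gpos[of 6] \<open>0 \<le> del * 2 ^ K * x + 2 / D\<close> e by (intro mult_mono) auto
  also have "\<dots> = (g ^ 6 * g ^ (c + 2)) * eps" by simp
  also have "g ^ 6 * g ^ (c + 2) = g ^ (c + 8)" by (subst power_add[symmetric]) (simp add: add.commute)
  finally show "err e x \<le> g ^ (c + 8) * eps" .
qed

definition X1 :: real where "X1 = 2 ^ K * real X"
definition E1 :: real where "E1 = err 0 (real X)"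
definition e2 :: real where "e2 = E1 * (2 * X1 + E1) + 2 / D"

lemma X1: "0 \<le> X1" "X1 \<le> g ^ (3 + 2 * d)"
  using N gpos[of "2 * d"] by (auto simp: X1_def power_add intro: mult_right_mono)

lemma X1_sq: "X1 * X1 \<le> g ^ (6 + 4 * d)"
  using mult_mono[OF X1(2) X1(2)] X1(1) gpos[of "3 + 2 * d"] by (simp add: power_add[symmetric] algebra_simps)

lemma g_eps: "a \<le> margin \<Longrightarrow> g ^ a * eps \<le> 1"
  using g_mono[of a margin] gpos[of margin] by (simp add: eps_def)

lemma E1: "0 \<le> E1" "E1 \<le> g ^ (17 + 2 * d) * eps" "E1 \<le> 1"
proof -
  show "0 \<le> E1" "E1 \<le> g ^ (17 + 2 * d) * eps"
    using err_le[of 0 "9 + 2 * d" "real X" "2 * d" "9 + 2 * d"] eps gpos[of "9 + 2 * d"] unfolding E1_def by auto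
  then show "E1 \<le> 1" using g_eps[of "17 + 2 * d"] by (simp add: margin_def)
qed

lemma e2: "0 \<le> e2" "e2 \<le> g ^ (23 + 4 * d) * eps"
proof -
  show "0 \<le> e2" unfolding e2_def using E1 X1 by simp
  have "2 * X1 + E1 \<le> 2 * g ^ (3 + 2 * d) + g ^ (3 + 2 * d)"
    using X1 E1(3) g_ge_1[of "3 + 2 * d"] by linarith
  also have "\<dots> \<le> 2 * (2 * g ^ (3 + 2 * d))" using gpos[of "3 + 2 * d"] by simp
  also have "\<dots> \<le> g ^ (5 + 2 * d)"
    using g_double[of "3 + 2 * d"] g_double[of "4 + 2 * d"] by simp
  finally have "E1 * (2 * X1 + E1) \<le> (g ^ (17 + 2 * d) * eps) * g ^ (5 + 2 * d)"
    using E1 X1(1) by (intro mult_mono) auto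
  also have "\<dots> = (g ^ (17 + 2 * d) * g ^ (5 + 2 * d)) * eps" by simp
  also have "g ^ (17 + 2 * d) * g ^ (5 + 2 * d) = g ^ (22 + 4 * d)" by (simp flip: power_add)
  finally have "e2 \<le> g ^ (22 + 4 * d) * eps + 1 * eps" unfolding e2_def using two_D by simp
  also have "\<dots> = (g ^ (22 + 4 * d) + g ^ 0) * eps" by (simp add: algebra_simps)
  also have "\<dots> \<le> g ^ (23 + 4 * d) * eps"
    using g_add[of "22 + 4 * d" "22 + 4 * d" 0] eps by (intro mult_right_mono) auto
  finally show "e2 \<le> g ^ (23 + 4 * d) * eps" .
qed

lemma e2_le_1: "e2 \<le> 1"
  using e2(2) g_eps[of "23 + 4 * d"] by (simp add: margin_def)

lemma err2: "err e2 (X1 * X1) \<le> 1"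
proof -
  have "err e2 (X1 * X1) \<le> g ^ (23 + 4 * d + 8) * eps"
    using e2 X1 X1_sq by (intro err_le(2)[where a = "23 + 4 * d" and b = "6 + 4 * d"]) auto
  then show ?thesis using g_eps[of "31 + 4 * d"] by (simp add: margin_def)
qed

text \<open>The exponent 9 + 4 d belongs to the last transform: 3 for its length and 6 + 4 d for
  products of two spectra. Each of the two summands 1 costs one more power of G, which gives the 11
  in \<open>beta\<close>.\<close>

lemma offset_bound:
  assumes "y \<le> g ^ (9 + 4 * d) + 1"
  shows "y * D + 1 \<le> real Z"
proof -
  have "y \<le> g ^ (10 + 4 * d)" using assms g_add[of "9 + 4 * d" "9 + 4 * d" 0] by simp
  then have "y * D \<le> g ^ (10 + 4 * d) * D" by (intro mult_right_mono) auto
  also have "\<dots> = g ^ (10 + 4 * d + alpha)" by (simp add: power_add)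
  finally have "y * D + 1 \<le> g ^ (10 + 4 * d + alpha) + g ^ 0" by simp
  also have "\<dots> \<le> g ^ beta" using g_add[of "10 + 4 * d + alpha" "10 + 4 * d + alpha" 0] by (simp add: beta_def add_ac)
  finally show ?thesis by simp
qed

lemma Z1: "(X1 + E1) * D + 1 \<le> real Z"
  using X1 E1 g_mono[of "3 + 2 * d" "9 + 4 * d"] by (intro offset_bound) auto

lemma Z2: "(X1 * X1 + e2) * D + 1 \<le> real Z"
  using X1_sq e2_le_1 g_mono[of "6 + 4 * d" "9 + 4 * d"] by (intro offset_bound) auto

lemma Z3: "(2 ^ K * (X1 * X1) + 1) * D + 1 \<le> real Z"
proof -
  have "2 ^ K * (X1 * X1) \<le> g ^ 3 * g ^ (6 + 4 * d)"
    using N X1_sq X1(1) gpos[of 3] by (intro mult_mono) auto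
  then show ?thesis by (intro offset_bound) (simp add: power_add)
qed

lemma Z4: "4 * D + 1 \<le> Z"
proof -
  have "g ^ 2 \<le> g ^ (9 + 4 * d)" by (rule g_mono) simp
  moreover have "2 ^ 2 \<le> g ^ 2" using g2 by (intro power_mono) auto
  ultimately have "4 * real D + 1 \<le> real Z" by (intro offset_bound) simp
  then have "real (4 * D + 1) \<le> real Z" by simp
  then show ?thesis unfolding of_nat_le_iff .
qed

end

subsection \<open>Running time and conclusion\<close>

text \<open>With A windows and B pattern blocks, A L and B L are at most 2 n, and s < 2 L gives A B
  L s <= 8 n^2. So the A B pairs at cost O(L log L) each stay within n^2 / s times a logarithm. The
  second logarithm is needed only for the preparation of the roots, where K and J multiply.\<close>

lemma time_bound:
  fixes n m s L K J a b :: nat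
  assumes s: "1 \<le> s" "s \<le> n" and m: "m \<le> n" and L: "L \<le> s" "s < 2 * L"
    and K: "2 ^ K = 4 * L" and J: "2 ^ J \<le> 2 * n"
    and wt: "wt = 30 + L * 150 + (m div L + 1) * (3000 * (2 ^ K * (K + 1)) + 6)"
    and t: "t \<le> (30 + s * 40) + ((30 + n * 40) +
      ((200 + 3 * a + 3 * b + (K + 1) * (80 + (a * J + 1) * 60) + 2 ^ K * 400) +
      (30 + m * 30 + (n div L + 1) * (wt + 6))))"
  shows "real t \<le> (400000 + 600 * real a + 10 * real b) * (real n)\<^sup>2 / real s * (log 2 (real n + 1)) ^ 2"
proof -
  define l where "l = log 2 (real n + 1)"
  define U where "U = (real n)\<^sup>2 / real s * l ^ 2"
  define A where "A = n div L + 1"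
  define B where "B = m div L + 1"
  have n: "1 \<le> n" "0 < L" using s L by linarith+
  have "log 2 2 \<le> l" unfolding l_def using n by (intro log_mono) auto
  then have l: "1 \<le> l" by simp
  have ll: "l \<le> l ^ 2" using l by (simp add: power2_eq_square)
  \<comment> \<open>Because s <= n, everything linear in n or s is absorbed as well.\<close>
  have n1: "real n \<le> (real n)\<^sup>2 / real s"
  proof -
    have "real n * real s \<le> real n * real n" using s by (intro mult_left_mono) auto
    then show ?thesis using s by (simp add: field_simps power2_eq_square)
  qed
  define q where "q = (real n)\<^sup>2 / real s"
  have q: "1 \<le> q" "real n \<le> q" using n1 n by (auto simp: q_def)
  have U: "U = q * l ^ 2" by (simp add: U_def q_def)
  have l2: "1 \<le> l ^ 2" using l by simp
  have Uq: "q \<le> U" using q l2 unfolding U by (simp add: mult_le_cancel_left1)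
  have Ul2: "l ^ 2 \<le> U" using q l2 unfolding U by (simp add: mult_le_cancel_right1)
  have Uql: "q * l \<le> U" using q ll unfolding U by (intro mult_left_mono) auto
  have U1: "1 \<le> U" "real n \<le> U" "l \<le> U" using Uq Ul2 q ll by linarith+
  have logn: "log 2 (real n) \<le> l" unfolding l_def using n by (intro log_mono) auto
  have "(2::nat) ^ K \<le> 2 ^ 2 * n" using K L s by simp
  then have "real (2 ^ K) \<le> real (2 ^ 2 * n)" by (rule of_nat_mono)
  then have "log 2 (2 ^ K) \<le> log 2 (2 ^ 2 * real n)" by (intro log_mono) auto
  also have "\<dots> = log 2 (2 ^ 2) + log 2 (real n)" using n by (subst log_mult) auto
  also have "log 2 (2 ^ 2 :: real) = 2" by (simp only: log_nat_power log_eq_one)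
  also have "log 2 (2 ^ K :: real) = real K" by (simp add: log_nat_power)
  finally have K1: "real K + 1 \<le> 4 * l" using logn l by linarith
  have "real (2 ^ J) \<le> real (2 * n)" using J by (rule of_nat_mono)
  then have "log 2 (2 ^ J) \<le> log 2 (2 * real n)" by (intro log_mono) auto
  also have "\<dots> = log 2 2 + log 2 (real n)" using n by (subst log_mult) auto
  also have "log 2 (2 ^ J :: real) = real J" by (simp add: log_nat_power)
  finally have J1: "real J \<le> 2 * l" using logn l by simp
  have AL: "A * L \<le> 2 * n"
  proof -
    have "A * L = n div L * L + L" by (simp add: A_def)
    also have "\<dots> \<le> n + L" by (intro add_mono div_times_less_eq_dividend) simp
    finally show ?thesis using L s by linarith
  qed
  have BL: "B * L \<le> 2 * n"
  proof -
    have "B * L = m div L * L + L" by (simp add: B_def)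
    also have "\<dots> \<le> m + L" by (intro add_mono div_times_less_eq_dividend) simp
    finally show ?thesis using L s m by linarith
  qed
  have "(A * B * L) * s \<le> (A * B * L) * (2 * L)" using L by (intro mult_le_mono2) simp
  also have "\<dots> = 2 * ((A * L) * (B * L))" by (simp add: ac_simps)
  also have "\<dots> \<le> 2 * ((2 * n) * (2 * n))" by (rule mult_le_mono2[OF mult_le_mono[OF AL BL]])
  finally have "real ((A * B * L) * s) \<le> real (2 * ((2 * n) * (2 * n)))" by (rule of_nat_mono)
  then have ABL: "real (A * B * L) \<le> 8 * q"
    using s by (simp add: q_def field_simps power2_eq_square)
  have "A * (wt + 6) = A * 36 + (A * L) * 150 + A * B * (12000 * (L * (K + 1)) + 6)"
    unfolding wt K B_def[symmetric] by (simp add: algebra_simps)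
  also have "\<dots> \<le> (A * L) * 36 + (A * L) * 150 + A * B * (12006 * (L * (K + 1)))"
  proof -
    have "6 * 1 \<le> 6 * (L * (K + 1))" using n by (intro mult_le_mono2) simp
    then have "A * B * (12000 * (L * (K + 1)) + 6) \<le> A * B * (12006 * (L * (K + 1)))"
      by (intro mult_le_mono2) linarith
    moreover have "A * 1 \<le> A * L" using n by (intro mult_le_mono2) simp
    ultimately show ?thesis by linarith
  qed
  also have "\<dots> = (A * L) * 186 + 12006 * ((A * B * L) * (K + 1))" by (simp add: algebra_simps)
  finally have "real (A * (wt + 6)) \<le> real ((A * L) * 186 + 12006 * ((A * B * L) * (K + 1)))" by (rule of_nat_mono)
  also have "\<dots> = real (A * L) * 186 + 12006 * (real (A * B * L) * (real K + 1))" by (simp add: algebra_simps)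
  also have "\<dots> \<le> 372 * real n + 12006 * (8 * q * (4 * l))"
  proof -
    have "real (A * L) \<le> real (2 * n)" using AL by (rule of_nat_mono)
    then have "real (A * L) * 186 \<le> 372 * real n" by simp
    moreover have "real (A * B * L) * (real K + 1) \<le> 8 * q * (4 * l)"
      using ABL K1 q by (intro mult_mono) auto
    ultimately show ?thesis by linarith
  qed
  also have "\<dots> = 372 * real n + 384192 * (q * l)" by simp
  also have "\<dots> \<le> 372 * U + 384192 * U" using U1 Uql by linarith
  finally have main: "real (A * (wt + 6)) \<le> 384564 * U" by simp
  have "real ((K + 1) * (80 + (a * J + 1) * 60)) = (real K + 1) * (140 + 60 * (real a * real J))" by (simp add: algebra_simps)
  also have "\<dots> \<le> (4 * l) * (140 + 60 * (real a * (2 * l)))"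
    using K1 J1 by (intro mult_mono add_left_mono) (auto intro: mult_left_mono)
  also have "\<dots> = 560 * l + 480 * real a * l ^ 2" by (simp add: power2_eq_square algebra_simps)
  also have "\<dots> \<le> 560 * U + 480 * real a * U"
    using U1 Ul2 by (intro add_mono mult_left_mono) auto
  finally have su: "real ((K + 1) * (80 + (a * J + 1) * 60)) \<le> 560 * U + 480 * real a * U" .
  have "(2::nat) ^ K \<le> 4 * n" using K L s by simp
  then have KU: "real (2 ^ K * 400) \<le> 1600 * U" using U1 of_nat_mono[of "2 ^ K" "4 * n", where 'a = real] by simp
  have "real t \<le> real ((30 + s * 40) + ((30 + n * 40) +
      ((200 + 3 * a + 3 * b + (K + 1) * (80 + (a * J + 1) * 60) + 2 ^ K * 400) +
      (30 + m * 30 + A * (wt + 6)))))" using of_nat_mono[OF t, where 'a = real] by (simp only: A_def)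
  also have "\<dots> = 290 + 40 * real s + 40 * real n + 3 * real a + 3 * real b +
      real ((K + 1) * (80 + (a * J + 1) * 60)) + real (2 ^ K * 400) + 30 * real m + real (A * (wt + 6))"
    unfolding of_nat_add by simp
  also have "\<dots> \<le> 290 * U + 40 * U + 40 * U + 3 * (real a * U) + 3 * (real b * U) + (560 * U + 480 * real a * U) +
      1600 * U + 30 * U + 384564 * U"
  proof -
    have "real a * 1 \<le> real a * U" "real b * 1 \<le> real b * U" using U1 by (intro mult_left_mono; simp)+
    moreover have "real s \<le> U" "real m \<le> U" using U1 s m by linarith+
    ultimately show ?thesis using main su KU U1 by linarith
  qed
  also have "\<dots> \<le> (400000 + 600 * real a + 10 * real b) * U"
    using U1 by (simp add: algebra_simps)
  finally show ?thesis by (simp add: U_def l_def)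
qed

section \<open>Assembly of the program and its bounds\<close>

lemma symbols_le:
  assumes T: "\<forall>x\<in>set T. x < c" and P: "\<forall>x. Some x \<in> set P \<longrightarrow> x < c" and c: "0 < c"
  shows "txt_at (T, P, s) i + 1 \<le> c" "pat_at (T, P, s) i \<le> c"
proof -
  show "txt_at (T, P, s) i + 1 \<le> c" using T c by (auto simp: txt_at_def in_text_def Suc_le_eq)
  show "pat_at (T, P, s) i \<le> c"
  proof (cases "i < length P")
    case True
    then have "Some x \<in> set P" if "P ! i = Some x" for x using that nth_mem by metis
    then show ?thesis using P by (auto simp: pat_at_def in_pat_def Suc_le_eq split: option.split)
  qed (simp add: pat_at_def in_pat_def)
qed

lemma wpm_com_correct:
  fixes T :: "nat list" and P :: "nat option list" and s d :: nat
  assumes s: "1 \<le> s" "s \<le> length T" and m: "length P \<le> length T"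
    and T: "\<forall>x\<in>set T. x < (length T + 1) ^ d" and P: "\<forall>x. Some x \<in> set P \<longrightarrow> x < (length T + 1) ^ d"
  defines "a \<equiv> precision.alpha d"
  defines "b \<equiv> precision.beta d"
  shows "\<exists>t S out. runs_within (comp_com 0 (wpm_com a b)) (T, P, s) t S
      ((length T + 1) ^ (2 * ((2 * b + 3) * csize (wpm_com a b)))) out \<and>
    real t \<le> (400000 + 600 * real a + 10 * real b) * (real (length T))\<^sup>2 / real s * (log 2 (real (length T) + 1)) ^ 2 \<and>
    real S \<le> (400000 + 600 * real a + 10 * real b) * real s \<and> wpm_correct_output T P out"
proof -
  define I where "I = (T, P, s)"
  have I: "in_text I = T" "in_pat I = P" "in_par I = s"
    by (simp_all add: I_def in_text_def in_pat_def in_par_def)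
  let ?n = "length T" and ?m = "length P"
  let ?st = "(\<lambda>_. 0, \<lambda>_ _. 0) :: store"
  \<comment> \<open>R depends on J, and both K and J are results of the program. As
    \<open>sem\<close> does not mention R or M, the first two phases are evaluated under provisional
    bounds just to obtain these values, and are checked again once R is defined.\<close>
  define s1 where "s1 = sem I setup_block ?st"
  have "\<exists>K\<ge>2. fst s1 5 = K \<and> fst s1 3 = 2 ^ (K - 2) \<and> fst s1 4 = 2 ^ K \<and>
       2 ^ (K - 2) \<le> s \<and> s < 2 * 2 ^ (K - 2)"
    using hoareD(3)[OF hoare_setup_block[of I "4 * s + 4" 0 ?st]] s by (simp add: I s1_def)
  then obtain K where K: "2 \<le> K" "fst s1 5 = K" "fst s1 3 = 2 ^ (K - 2)" "fst s1 4 = 2 ^ K"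
       "2 ^ (K - 2) \<le> s" "s < 2 * 2 ^ (K - 2)" by blast
  define L where "L = (2::nat) ^ (K - 2)"
  have L: "0 < L" "L \<le> s" "s < 2 * L" using K by (simp_all add: L_def)
  have "(2::nat) ^ K = 2 ^ (2 + (K - 2))" unfolding le_add_diff_inverse[OF K(1)] ..
  then have KL: "2 ^ K = 4 * L" unfolding power_add L_def by simp
  define s2 where "s2 = sem I setup_base s1"
  have "\<exists>J. fst s2 7 = J \<and> fst s2 6 = 2 ^ J \<and> ?n < 2 ^ J \<and> 2 ^ J \<le> 2 * ?n"
    using hoareD(3)[OF hoare_setup_base[of I "2 * ?n + 1" 0 s1]] s by (simp add: I s2_def)
  then obtain J where J: "fst s2 7 = J" "fst s2 6 = 2 ^ J" "?n < 2 ^ J" "2 ^ J \<le> 2 * ?n" by blast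
  define G where "G = (2::nat) ^ J"
  have Gn: "?n < G" "G \<le> 2 * ?n" using J by (simp_all add: G_def)
  have G2: "2 \<le> G" using Gn s by linarith
  have pow_exp: "2 * G \<le> G ^ 2" "4 * G \<le> G ^ 3"
  proof -
    show "2 * G \<le> G ^ 2" using G2 by (simp add: power2_eq_square)
    then have "2 * (2 * G) \<le> G * G ^ 2" using G2 by (intro mult_le_mono) auto
    then show "4 * G \<le> G ^ 3" by (simp add: power3_eq_cube power2_eq_square)
  qed
  have NG: "2 ^ K \<le> G ^ 3"
    using pow_exp(2) KL L s Gn by linarith
  interpret precision G K d using G2 NG by unfold_locales
  have ab: "a = alpha" "b = beta" by (simp_all add: a_def b_def)
  \<comment> \<open>One power of G above all stored values: 2 Z needs exponent beta + 1, the squares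
    D D need 2 alpha, and the input and the accumulators need far less.\<close>
  define R where "R = G ^ (2 * beta + 3)"
  have lt: "x < R" if "x \<le> G ^ i" "i < 2 * beta + 3" for x i
  proof -
    have "G ^ i < R" unfolding R_def using G2 that(2) by (intro power_strict_increasing) auto
    then show ?thesis using that(1) by simp
  qed
  have sym: "txt_at I i + 1 \<le> G ^ d" "pat_at I i \<le> G ^ d" for i
  proof -
    have "(?n + 1) ^ d \<le> G ^ d" using Gn by (intro power_mono) auto
    then show "txt_at I i + 1 \<le> G ^ d" "pat_at I i \<le> G ^ d"
      using symbols_le[OF T P, of s i] by (auto simp: I_def)
  qed
  have GX: "G ^ d \<le> X" using G2 by (intro power_increasing) auto
  have KK: "K < 2 ^ K" by simp
  have inp: "inp_below I R"
    unfolding inp_below_def I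
  proof (intro conjI allI)
    show "2 \<le> R" using lt[of 2 1] G2 by simp
    show "?n < R" "?m < R" "s < R" using lt[of _ 1] Gn m s by auto
    show "txt_at I i < R" for i using sym(1)[of i] by (intro lt[of _ d]) (auto simp: beta_def)
    show "pat_at I i < R" for i using sym(2)[of i] by (intro lt[of _ d]) (auto simp: beta_def)
  qed
  interpret fp: fixed_point I R "2 ^ K" D Z K L del
  proof
    show "0 < D" using G2 by simp
    have "2 * Z \<le> G ^ (beta + 1)" using G2 by simp
    then show "2 * Z < R" by (rule lt) simp
    have "2 * 2 ^ K \<le> G ^ 4" using mult_le_mono[OF G2 NG] by (simp add: eval_nat_numeral)
    then show "2 * 2 ^ K < R" by (rule lt) (simp add: beta_def)
    have "K \<le> G ^ 3" using NG KK by linarith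
    then show "K < R" by (rule lt) (simp add: beta_def)
    show "D < R" by (rule lt[of _ alpha]) (auto simp: beta_def)
  qed (use KL del in auto)
  have fe: "fp.fft_err = err" by (simp add: fun_eq_iff fp.fft_err_def err_def)
  interpret mp: matcher I R "2 ^ K" D Z K L del X E1 e2 X1
  proof
    show "E1 = fp.fft_err 0 (real X)" "fp.fft_err e2 (X1 * X1) \<le> 1" unfolding fe using err2 by (simp_all add: E1_def)
    show "pat_at I j \<le> X" for j using sym(2)[of j] GX by simp
    have "G ^ d * G ^ d = X" by (simp add: power_add[symmetric] mult_2)
    then show "(txt_at I j + 1) * (txt_at I j + 1) \<le> X" for j
      using mult_le_mono[OF sym(1)[of j] sym(1)[of j]] by simp
    have "(?m + L) \<le> G ^ 2" using m L s Gn pow_exp by linarith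
    then have "(?m + L) * (X * X) \<le> G ^ 2 * (X * X)" by (rule mult_le_mono1)
    also have "\<dots> = G ^ (2 + 4 * d)" by (simp only: power_add[symmetric]) (simp add: algebra_simps)
    finally show "(length (in_pat I) + L) * (X * X) < R" unfolding I by (rule lt) (simp add: beta_def)
    have "?n + 2 \<le> G ^ 2" "?m + 2 \<le> G ^ 2" using m s Gn pow_exp by linarith+
    then show "length (in_text I) + 2 < R" "length (in_pat I) + 2 < R" unfolding I by (auto intro!: lt[of _ 2] simp: beta_def)
    show "X1 = 2 ^ K * real X" "e2 = E1 * (2 * X1 + E1) + 2 / real D" by (simp_all add: X1_def e2_def)
  qed (use L Z1 Z2 Z3 in auto)
  have R1: "4 * s < R" "s + 3 < R" "2 * ?n < R"
  proof -
    have "4 * s \<le> G ^ 3" "s + 3 \<le> G ^ 3" "2 * ?n \<le> G ^ 3" using pow_exp s Gn by linarith+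
    then show "4 * s < R" "s + 3 < R" "2 * ?n < R" by (auto intro!: lt[of _ 3] simp: beta_def)
  qed
  have "hoare I R (2 ^ K) setup_block ?st (30 + s * 40) (\<lambda>_. True)"
    using hoare_conseq[OF hoare_setup_block[of I R "2 ^ K" ?st] order_refl] s R1 by (simp add: I)
  note b1 = hoareD[OF this, folded s1_def]
  have "hoare I R (2 ^ K) setup_base s1 (30 + ?n * 40) (\<lambda>_. True)"
    using hoare_conseq[OF hoare_setup_base[of I R "2 ^ K" s1] order_refl] s R1 by (simp add: I)
  note b2 = hoareD[OF this, folded s2_def]
  have v2: "fst s2 3 = L" "fst s2 4 = 2 ^ K" "fst s2 5 = K" "fst s2 6 = 2 ^ J" "fst s2 7 = J" "fst s2 0 = 0"
    using agreeD1[OF b2(4), of 3] agreeD1[OF b2(4), of 4] agreeD1[OF b2(4), of 5] agreeD1[OF b2(4), of 0]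
      agreeD1[OF b1(4), of 0] K J by (simp_all add: L_def)
  have DZ: "D = 2 ^ (alpha * J)" "Z = 2 ^ (beta * J)" by (simp_all add: G_def power_mult[symmetric] mult.commute)
  have "D * D \<le> G ^ (2 * alpha)" by (simp add: power_add[symmetric] mult_2)
  then have DD: "D * D < R" by (rule lt) (simp add: beta_def)
  note b3 = hoareD[OF fp.hoare_setup_roots[OF v2(1-5) K(1) DZ DD Z4 root_precision]]
  define s3 where "s3 = sem I (setup_roots alpha beta) s2"
  have v3: "fst s3 0 = 0" using agreeD1[OF b3(4), of 0] v2 by (simp add: s3_def)
  note b4 = hoareD[OF mp.hoare_search[OF b3(3) v3[unfolded s3_def]], folded s3_def]
  let ?Q = "\<lambda>st'::store. if fst st' 0 = 0 then \<forall>i. \<not> mp.occurs i else mp.occurs (fst st' 0 - 1)"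
  let ?t = "(30 + s * 40) + ((30 + ?n * 40) +
      ((200 + 3 * alpha + 3 * beta + (K + 1) * (80 + (alpha * J + 1) * 60) + 2 ^ K * 400) +
      (30 + ?m * 30 + (?n div L + 1) * (mp.window_time + 6))))"
  have "hoare I R (2 ^ K) (wpm_com a b) ?st ?t ?Q"
    unfolding hoare_def wpm_com_def ab sem.simps(4) ok.simps(4) cost.simps(4) s1_def[symmetric] s2_def[symmetric] s3_def[symmetric]
    by (intro conjI add_mono b1(1,2) b2(1,2) b3(1,2)[folded s3_def] b4(1) b4(2)[unfolded I] b4(3))
  from hoare_runs_within[OF this wf_com_wpm_com inp order_refl]
  obtain t and st' :: store where t: "t \<le> ?t" and Q: "?Q st'"
    and run: "runs_within (comp_com 0 (wpm_com a b)) I t (60 + 10 * 2 ^ K) (R ^ csize (wpm_com a b)) (fst st' 0)"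
    by (elim exE conjE)
  \<comment> \<open>G <= 2 n <= (n + 1)^2 turns powers of G into powers of n + 1; the exponent
    depends only on the program and on d.\<close>
  have "R ^ csize (wpm_com a b) = G ^ ((2 * beta + 3) * csize (wpm_com a b))" by (simp add: R_def power_mult)
  also have "\<dots> \<le> ((?n + 1) ^ 2) ^ ((2 * beta + 3) * csize (wpm_com a b))"
  proof (rule power_mono)
    show "G \<le> (?n + 1) ^ 2" using Gn by (simp add: power2_eq_square)
  qed simp
  also have "\<dots> = (?n + 1) ^ (2 * ((2 * b + 3) * csize (wpm_com a b)))" by (simp only: power_mult ab)
  finally have "runs_within (comp_com 0 (wpm_com a b)) I t (60 + 10 * 2 ^ K) ((?n + 1) ^ (2 * ((2 * b + 3) * csize (wpm_com a b)))) (fst st' 0)"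
    using run unfolding runs_within_def by (meson less_le_trans)
  moreover have "real t \<le> (400000 + 600 * real a + 10 * real b) * (real ?n)\<^sup>2 / real s * (log 2 (real ?n + 1)) ^ 2"
    by (rule time_bound[OF s m L(2,3) KL J(4) _ t[folded ab]]) (simp add: mp.window_time_def I)
  moreover have "real (60 + 10 * 2 ^ K) \<le> (400000 + 600 * real a + 10 * real b) * real s"
  proof -
    have "real (60 + 10 * 2 ^ K) \<le> 100 * real s" unfolding KL using L s by simp
    also have "\<dots> \<le> (400000 + 600 * real a + 10 * real b) * real s" by (intro mult_right_mono) auto
    finally show ?thesis .
  qed
  moreover have "wpm_correct_output T P (fst st' 0)"
  proof -
    have "matches_at T P i \<longleftrightarrow> mp.occurs i" for i
      unfolding matches_at_iff[of T P i s] mp.occurs_def I I_def[symmetric] ..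
    then show ?thesis using Q by (auto simp: wpm_correct_output_def split: if_splits)
  qed
  ultimately show ?thesis unfolding I_def by blast
qed

text \<open>Symbols polynomial in n + 1 are those that fit into a constant number of words. The
  program is fixed once d is, since d enters only through the constants \<open>alpha\<close> and
  \<open>beta\<close> of the precision.\<close>

theorem theorem3:
  "\<forall>d::nat. \<exists>(prog::instr list) (c::real) (k::nat) (e::nat).
     \<forall>(T::nat list) (P::nat option list) (s::nat).
       1 \<le> s \<and> s \<le> length T \<and> length P \<le> length T \<and>
       (\<forall>x\<in>set T. x < (length T + 1) ^ d) \<and>
       (\<forall>x. Some x \<in> set P \<longrightarrow> x < (length T + 1) ^ d) \<longrightarrow>
       (\<exists>t S out.
          runs_within prog (T, P, s) t S ((length T + 1) ^ e) out \<and>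
          real t \<le> c * (real (length T))\<^sup>2 / real s * (log 2 (real (length T) + 1)) ^ k \<and>
          real S \<le> c * real s \<and>
          wpm_correct_output T P out)"
  \<comment> \<open>The word-size exponent \<open>e\<close> is left open and fixed by unification
    with \<open>wpm_com_correct\<close>; the power of the logarithm is 2.\<close>
  apply (rule allI)
  subgoal for d
    by (rule exI[of _ "comp_com 0 (wpm_com (precision.alpha d) (precision.beta d))"],
        rule exI[of _ "400000 + 600 * real (precision.alpha d) + 10 * real (precision.beta d)"],
        rule exI[of _ 2], rule exI, intro allI impI, elim conjE, rule wpm_com_correct)
  done

end
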